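(* Let $W$ be the $2|1$-dimensional complex $\mathbb Z_2$-graded vector space with basis $w_1$ (odd), $w_2,w_3$ (even). Let $c\in\mathbb C$ with $|c|\le1$ be generic, i.e. $c$ is not a nonpositive rational number and neither $c$ nor $1/c$ is a positive integer, and let $d_c=\psi^{1,1,0}_2+\psi^{1,0,1}_3c$. Let $t^1,t^2,t^3$ be even and $\theta^1,\theta^2$ odd parameters. Then $$d^1=\psi^{1,1,0}_2+\psi^{1,0,1}_3c+\psi^{1,0,0}_2t^1+\psi^{1,0,0}_3t^2+\varphi^{0,1,0}_2\theta^1+\varphi^{0,0,1}_3\theta^2+\psi^{1,0,1}_3t^3$$ is a miniversal deformation of $d_c$, with base $\mathbb C[[t^1,t^2,t^3,\theta^1,\theta^2]]/(t^1\theta^1,\ t^2\theta^2)$ (superscripts are indices, not powers).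
   Context: All spaces are $\mathbb Z_2$-graded over $\mathbb C$. $S(W)=\bigoplus_{n\ge1}S^n(W)$ is the symmetric coalgebra of $W$ (so $w_1^2=0$). $L_n=\mathrm{Hom}(S^n(W),W)$, and $L=\prod_{n\ge1}L_n$ is identified with the coderivations of $S(W)$, a $\mathbb Z_2$-graded Lie algebra under the graded commutator. An $L_\infty$ structure (codifferential) is an odd $d\in L$ with $[d,d]=0$. For a multi-index $I=(i_1,i_2,i_3)$ with $i_1\in\{0,1\}$, $i_2,i_3\ge0$, put $w_I=w_1^{i_1}w_2^{i_2}w_3^{i_3}$, $I!=i_1!i_2!i_3!$, and let $\varphi^I_j(w_J)=I!\,\delta^I_J\,w_j$, an element of $L_{|I|}$; when odd it is written $\psi^I_j$. Rings are $\mathbb Z_2$-graded commutative (even parameters commute, odd parameters anticommute and square to zero). For an augmented local ring $\mathcal A$ with maximal ideal $\mathfrak m$ and augmentation $\epsilon:\mathcal A\to\mathbb C$: $\mathcal A$ is an infinitesimal base if $\mathfrak m^2=0$, a formal base if $\mathcal A=\varprojlim_n\mathcal A/\mathfrak m^n$. A deformation of $d$ with base $\mathcal A$ is an $\mathcal A$-linear $L_\infty$ structure $\tilde d$ (odd, $[\tilde d,\tilde d]=0$) on the completed tensor product $W\hat\otimes\mathcal A$, i.e. an element of the completion of $L\otimes\mathcal A$ with the $\mathcal A$-linearly extended bracket, such that $(1\otimes\epsilon)(\tilde d)=d$. It is infinitesimal/formal if $\mathcal A$ is. Two deformations with base $\mathcal A$ are equivalent ($\sim$) if they are conjugate by an $\mathcal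 A$-linear coalgebra automorphism that reduces to the identity under $\epsilon$. A homomorphism $f:\mathcal A\to\mathcal B$ of such bases induces $f_*=1\otimes f$. A deformation $d^\infty$ with formal base $\mathcal A$ is versal if for every formal deformation $\tilde d$ with base $\mathcal B$ there is $f:\mathcal A\to\mathcal B$ with $f_*(d^\infty)\sim\tilde d$; it is miniversal if moreover $f$ is unique whenever $\mathcal B$ is infinitesimal. *)

theory Defs
  imports
    "HOL-Computational_Algebra.Formal_Power_Series"
    "HOL-Library.Z2"
    "HOL-Library.Product_Plus"
    "HOL-Library.Function_Algebras"
    Complex_Main
begin

section \<open>Graded commutative augmented algebras\<close>

text \<open>
  The grading is given by the projections \<open>hcomp p\<close> onto the homogeneous components.
  Odd elements square to zero by \<open>supercomm\<close>, since 2 is invertible.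
\<close>

class supercomm_algebra = ring_1 +
  fixes scaleC :: "complex \<Rightarrow> 'a \<Rightarrow> 'a"  (infixr \<open>*\<^sub>C\<close> 75)
    and hcomp :: "bit \<Rightarrow> 'a \<Rightarrow> 'a"
  assumes scaleC_add_right: "r *\<^sub>C (a + b) = r *\<^sub>C a + r *\<^sub>C b"
    and scaleC_add_left: "(r + s) *\<^sub>C a = r *\<^sub>C a + s *\<^sub>C a"
    and scaleC_scaleC: "r *\<^sub>C s *\<^sub>C a = (r * s) *\<^sub>C a"
    and scaleC_one: "1 *\<^sub>C a = a"
    and scaleC_mult_left: "(r *\<^sub>C a) * b = r *\<^sub>C (a * b)"
    and scaleC_mult_right: "a * (r *\<^sub>C b) = r *\<^sub>C (a * b)"
    and hcomp_add: "hcomp p (a + b) = hcomp p a + hcomp p b"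
    and hcomp_scaleC: "hcomp p (r *\<^sub>C a) = r *\<^sub>C hcomp p a"
    and hcomp_hcomp: "hcomp p (hcomp q a) = (if p = q then hcomp p a else 0)"
    and hcomp_sum: "hcomp 0 a + hcomp 1 a = a"
    and hcomp_one: "hcomp 0 1 = 1"
    and hcomp_mult: "hcomp p a = a \<Longrightarrow> hcomp q b = b \<Longrightarrow> hcomp (p + q) (a * b) = a * b"
    and supercomm: "hcomp p a = a \<Longrightarrow> hcomp q b = b \<Longrightarrow> a * b = (if p * q = 1 then - (b * a) else b * a)"

definition ksign :: "bit \<Rightarrow> 'a::ring_1" where
  "ksign p = (if p = 0 then 1 else - 1)"

definition homogeneous :: "bit \<Rightarrow> 'a::supercomm_algebra \<Rightarrow> bool" where
  "homogeneous p a \<longleftrightarrow> hcomp p a = a"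

text \<open>\<open>gsign p\<close> is the Koszul sign for moving \<open>a\<close> past an element of parity \<open>p\<close>.\<close>

definition gsign :: "bit \<Rightarrow> 'a::supercomm_algebra \<Rightarrow> 'a" where
  "gsign p a = (if p = 0 then a else hcomp 0 a - hcomp 1 a)"

class augmented_algebra = supercomm_algebra +
  fixes aug :: "'a \<Rightarrow> complex"
  assumes aug_add: "aug (a + b) = aug a + aug b"
    and aug_mult: "aug (a * b) = aug a * aug b"
    and aug_one: "aug 1 = 1"
    and aug_scaleC: "aug (r *\<^sub>C a) = r * aug a"
    and aug_odd: "hcomp 1 a = a \<Longrightarrow> aug a = 0"

definition is_ideal :: "'a::ring_1 set \<Rightarrow> bool" where
  "is_ideal I \<longleftrightarrow> 0 \<in> I \<and> (\<forall>x\<in>I. \<forall>y\<in>I. x + y \<in> I) \<and> (\<forall>x\<in>I. \<forall>r. r * x \<in> I \<and> x * r \<in> I)"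

definition maximal_ideal :: "'a::ring_1 set \<Rightarrow> bool" where
  "maximal_ideal M \<longleftrightarrow> is_ideal M \<and> M \<noteq> UNIV \<and>
     (\<forall>I. is_ideal I \<longrightarrow> M \<subseteq> I \<longrightarrow> I = M \<or> I = UNIV)"

definition ideal_gen :: "'a::ring_1 set \<Rightarrow> 'a set" where
  "ideal_gen S = \<Inter>{I. is_ideal I \<and> S \<subseteq> I}"

definition aug_ideal :: "'a::augmented_algebra set" where
  "aug_ideal = {a. aug a = 0}"

fun aug_power :: "nat \<Rightarrow> 'a::augmented_algebra set" where
  "aug_power 0 = UNIV"
| "aug_power (Suc n) = ideal_gen {x * y |x y. x \<in> aug_ideal \<and> y \<in> aug_power n}"

definition local_base :: "'a::augmented_algebra itself \<Rightarrow> bool" where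
  "local_base _ \<longleftrightarrow> (\<forall>M::'a set. maximal_ideal M \<longleftrightarrow> M = aug_ideal)"

definition infinitesimal_base :: "'a::augmented_algebra itself \<Rightarrow> bool" where
  "infinitesimal_base T \<longleftrightarrow> local_base T \<and> (aug_power 2 :: 'a set) = {0}"

text \<open>
  A point of the inverse limit of the quotients by the powers of the maximal ideal is given by
  a sequence of representatives \<open>x n\<close>; the condition says that the natural map to the
  inverse limit is bijective.
\<close>

definition formal_base :: "'a::augmented_algebra itself \<Rightarrow> bool" where
  "formal_base T \<longleftrightarrow> local_base T \<and>
     (\<forall>x :: nat \<Rightarrow> 'a. (\<forall>n. x (Suc n) - x n \<in> aug_power n) \<longrightarrow>
        (\<exists>!y. \<forall>n. y - x n \<in> aug_power n))"

definition base_hom :: "('a::augmented_algebra \<Rightarrow> 'b::augmented_algebra) \<Rightarrow> bool" where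
  "base_hom f \<longleftrightarrow>
     (\<forall>a b. f (a + b) = f a + f b) \<and> (\<forall>a b. f (a * b) = f a * f b) \<and> f 1 = 1 \<and>
     (\<forall>r a. f (r *\<^sub>C a) = r *\<^sub>C f a) \<and> (\<forall>p a. f (hcomp p a) = hcomp p (f a)) \<and>
     (\<forall>a. aug (f a) = aug a)"

instantiation complex :: augmented_algebra
begin

definition scaleC_complex :: "complex \<Rightarrow> complex \<Rightarrow> complex" where
  "scaleC_complex r a = r * a"

definition hcomp_complex :: "bit \<Rightarrow> complex \<Rightarrow> complex" where
  "hcomp_complex p a = (if p = 0 then a else 0)"

definition aug_complex :: "complex \<Rightarrow> complex" where
  "aug_complex a = a"

instance
  by standard
    (auto simp: scaleC_complex_def hcomp_complex_def aug_complex_def ksign_def algebra_simps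
      split: if_splits)

end


section \<open>The symmetric coalgebra of a space with one odd and two even generators\<close>

text \<open>
  The module \<open>S(W) \<otimes> A\<close> is the free right \<open>A\<close>-module on the monomials \<open>w_I\<close>, \<open>I \<in> mis\<close>.
  As \<open>w_1\<close> is the only odd generator, and no monomial contains it twice, rearranging the
  factors of a monomial produces no sign.
\<close>

type_synonym mi = "nat \<times> nat \<times> nat"

definition mis :: "mi set" where
  "mis = {(i1, i2, i3). i1 \<le> 1 \<and> (i1, i2, i3) \<noteq> (0, 0, 0)}"

fun wpar :: "mi \<Rightarrow> bit" where
  "wpar (i1, i2, i3) = of_nat i1"

fun mfact :: "mi \<Rightarrow> nat" where
  "mfact (i1, i2, i3) = fact i1 * fact i2 * fact i3"

fun mbinom :: "mi \<Rightarrow> mi \<Rightarrow> nat" where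
  "mbinom (i1, i2, i3) (j1, j2, j3) = (i1 choose j1) * (i2 choose j2) * (i3 choose j3)"

definition unit_mi :: "nat \<Rightarrow> mi" where
  "unit_mi j = (of_bool (j = 1), of_bool (j = 2), of_bool (j = 3))"

text \<open>
  An \<open>A\<close>-linear endomorphism \<open>T\<close> of \<open>S(W) \<otimes> A\<close> is given by its column-finite matrix:
  \<open>T I M\<close> is the coefficient of \<open>w_M\<close> in \<open>T(w_I)\<close>.
\<close>

type_synonym 'a smap = "mi \<Rightarrow> mi \<Rightarrow> 'a"

definition endos :: "'a::zero smap set" where
  "endos = {T. \<forall>I. finite {M. T I M \<noteq> 0} \<and> (\<forall>M. T I M \<noteq> 0 \<longrightarrow> I \<in> mis \<and> M \<in> mis)}"

definition has_parity :: "bit \<Rightarrow> 'a::supercomm_algebra smap \<Rightarrow> bool" where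
  "has_parity p T \<longleftrightarrow> (\<forall>I M. homogeneous (p + wpar I + wpar M) (T I M))"

definition id_smap :: "'a::ring_1 smap" where
  "id_smap I M = (if I \<in> mis \<and> I = M then 1 else 0)"

definition smap_comp :: "'a::ring_1 smap \<Rightarrow> 'a smap \<Rightarrow> 'a smap" where
  "smap_comp T U I M = (\<Sum>K | U I K \<noteq> 0. T K M * U I K)"

text \<open>
  The reduced coproduct \<open>\<Delta>\<close>: \<open>comul I (J, K)\<close> is the coefficient of \<open>w_J \<otimes> w_K\<close> in \<open>\<Delta>(w_I)\<close>.
\<close>

definition comul :: "mi \<Rightarrow> mi \<times> mi \<Rightarrow> nat" where
  "comul I = (\<lambda>(J, K). if I \<in> mis \<and> J \<in> mis \<and> K \<in> mis \<and> J + K = I then mbinom I J else 0)"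

text \<open>
  The tensor product of \<open>T\<close> and \<open>U\<close>, with \<open>U\<close> of parity \<open>u\<close>. Signs arise from moving \<open>U\<close> past
  \<open>w_P\<close>, and the coefficient \<open>T P J\<close> to the right past \<open>w_K\<close>.
\<close>

definition tensor ::
    "bit \<Rightarrow> 'a::supercomm_algebra smap \<Rightarrow> 'a smap \<Rightarrow> mi \<times> mi \<Rightarrow> mi \<times> mi \<Rightarrow> 'a" where
  "tensor u T U = (\<lambda>(P, Q) (J, K). ksign (u * wpar P) * gsign (wpar K) (T P J) * U Q K)"

definition comul_after :: "'a::ring_1 smap \<Rightarrow> mi \<Rightarrow> mi \<times> mi \<Rightarrow> 'a" where
  "comul_after T I JK = (\<Sum>M | T I M \<noteq> 0. of_nat (comul M JK) * T I M)"

definition before_comul :: "(mi \<times> mi \<Rightarrow> mi \<times> mi \<Rightarrow> 'a::ring_1) \<Rightarrow> mi \<Rightarrow> mi \<times> mi \<Rightarrow> 'a" where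
  "before_comul F I JK = (\<Sum>PQ | comul I PQ \<noteq> 0. F PQ JK * of_nat (comul I PQ))"

definition coderivation :: "bit \<Rightarrow> 'a::supercomm_algebra smap \<Rightarrow> bool" where
  "coderivation p T \<longleftrightarrow> T \<in> endos \<and> has_parity p T \<and>
     comul_after T = before_comul (tensor 0 T id_smap + tensor p id_smap T)"

definition coalgebra_aut :: "'a::supercomm_algebra smap \<Rightarrow> bool" where
  "coalgebra_aut g \<longleftrightarrow> g \<in> endos \<and> has_parity 0 g \<and>
     comul_after g = before_comul (tensor 0 g g) \<and>
     (\<exists>h\<in>endos. smap_comp g h = id_smap \<and> smap_comp h g = id_smap)"

definition gcommutator :: "bit \<Rightarrow> bit \<Rightarrow> 'a::ring_1 smap \<Rightarrow> 'a smap \<Rightarrow> 'a smap" where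
  "gcommutator p q T U I M = smap_comp T U I M - ksign (p * q) * smap_comp U T I M"

text \<open>
  The coderivation with corestriction \<open>w_J \<mapsto> (\<Sum>j. w_j (l J j))\<close>: a splitting \<open>w_J w_K\<close> of
  \<open>w_I\<close> is sent to \<open>(\<Sum>j. w_j (l J j)) w_K\<close>, and \<open>K = 0\<close> is allowed. The case distinction on
  \<open>M \<in> mis\<close> accounts for \<open>w_1 w_1 = 0\<close>. Coderivations of \<open>S(W) \<otimes> A\<close> correspond in this way to
  arbitrary families \<open>l\<close>, i.e. to elements of the product of the \<open>L_n \<otimes> A\<close> over all \<open>n\<close>.
\<close>

definition coder :: "(mi \<Rightarrow> nat \<Rightarrow> 'a::supercomm_algebra) \<Rightarrow> 'a smap" where
  "coder l I M = (if I \<in> mis \<and> M \<in> mis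
     then \<Sum>(J, K) \<in> {(J, K). J \<in> mis \<and> J + K = I}. \<Sum>j\<in>{1..3}.
       (if M = unit_mi j + K then of_nat (mbinom I J) * gsign (wpar K) (l J j) else 0)
     else 0)"

text \<open>
  The element of \<open>L \<otimes> A\<close> with first factor \<open>\<phi>^I_j\<close> (or \<open>\<psi>^I_j\<close>) and second factor \<open>a\<close>.
  Evaluation on \<open>w_I\<close> moves \<open>a\<close> past \<open>w_I\<close>.
\<close>

definition phi :: "mi \<Rightarrow> nat \<Rightarrow> 'a::supercomm_algebra \<Rightarrow> 'a smap" where
  "phi I j a =
     coder (\<lambda>J k. if J = I \<and> k = j then of_nat (mfact I) * gsign (wpar I) a else 0)"


section \<open>Deformations\<close>

definition linf_structure :: "'a::supercomm_algebra smap \<Rightarrow> bool" where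
  "linf_structure D \<longleftrightarrow> coderivation 1 D \<and> gcommutator 1 1 D D = 0"

definition deformation :: "complex smap \<Rightarrow> 'a::augmented_algebra smap \<Rightarrow> bool" where
  "deformation d D \<longleftrightarrow> linf_structure D \<and> (\<forall>I M. aug (D I M) = d I M)"

definition equivalent :: "'a::augmented_algebra smap \<Rightarrow> 'a smap \<Rightarrow> bool" where
  "equivalent D D' \<longleftrightarrow>
     (\<exists>g. coalgebra_aut g \<and> (\<forall>I M. aug (g I M) = id_smap I M) \<and> smap_comp g D = smap_comp D' g)"

definition push :: "('a \<Rightarrow> 'b) \<Rightarrow> 'a smap \<Rightarrow> 'b smap" where
  "push f D I M = f (D I M)"

text \<open>
  Bases are types of class \<open>augmented_algebra\<close>. The base of the deformation to be compared with
  is the type argument \<open>'b\<close>; (mini)versality is the statement for all types \<open>'b\<close>.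
\<close>

definition versal ::
    "'b::augmented_algebra itself \<Rightarrow> complex smap \<Rightarrow> 'a::augmented_algebra smap \<Rightarrow> bool" where
  "versal T d D \<longleftrightarrow> formal_base TYPE('a) \<and> deformation d D \<and>
     (formal_base T \<longrightarrow> (\<forall>D' :: 'b smap. deformation d D' \<longrightarrow>
        (\<exists>f. base_hom f \<and> equivalent (push f D) D')))"

definition miniversal ::
    "'b::augmented_algebra itself \<Rightarrow> complex smap \<Rightarrow> 'a::augmented_algebra smap \<Rightarrow> bool" where
  "miniversal T d D \<longleftrightarrow> versal T d D \<and>
     (infinitesimal_base T \<longrightarrow> (\<forall>D' :: 'b smap. deformation d D' \<longrightarrow>
        (\<forall>f f'. base_hom f \<and> equivalent (push f D) D' \<and>
          base_hom f' \<and> equivalent (push f' D) D' \<longrightarrow> f = f')))"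


section \<open>Power series in three even and two odd variables\<close>

text \<open>\<open>SPS a0 a1 a2 a12\<close> is \<open>a0 + a1 \<theta>1 + a2 \<theta>2 + a12 \<theta>1 \<theta>2\<close>.\<close>

datatype sps = SPS (c0: "complex fps fps fps") (c1: "complex fps fps fps")
  (c2: "complex fps fps fps") (c12: "complex fps fps fps")

definition ccst :: "complex \<Rightarrow> complex fps fps fps" where
  "ccst r = fps_const (fps_const (fps_const r))"

lemma ccst_simps:
  "ccst (r + s) = ccst r + ccst s" "ccst (r * s) = ccst r * ccst s" "ccst 1 = 1"
  by (simp_all add: ccst_def)

lemma ccst_nth: "fps_nth (fps_nth (fps_nth (ccst r) 0) 0) 0 = r"
  by (simp add: ccst_def)

lemma SPS_eq_iff: "SPS a b c d = x \<longleftrightarrow> c0 x = a \<and> c1 x = b \<and> c2 x = c \<and> c12 x = d"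
  by (cases x) auto

instantiation sps :: augmented_algebra
begin

definition "0 = SPS 0 0 0 0"
definition "1 = SPS 1 0 0 0"
definition "x + y = SPS (c0 x + c0 y) (c1 x + c1 y) (c2 x + c2 y) (c12 x + c12 y)"
definition "x - y = SPS (c0 x - c0 y) (c1 x - c1 y) (c2 x - c2 y) (c12 x - c12 y)"
definition "- x = SPS (- c0 x) (- c1 x) (- c2 x) (- c12 x)"
definition "x * y = SPS (c0 x * c0 y) (c0 x * c1 y + c1 x * c0 y) (c0 x * c2 y + c2 x * c0 y)
  (c0 x * c12 y + c12 x * c0 y + c1 x * c2 y - c2 x * c1 y)"
definition "r *\<^sub>C x = SPS (ccst r * c0 x) (ccst r * c1 x) (ccst r * c2 x) (ccst r * c12 x)"
definition "hcomp p x = (if p = 0 then SPS (c0 x) 0 0 (c12 x) else SPS 0 (c1 x) (c2 x) 0)"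
definition "aug x = fps_nth (fps_nth (fps_nth (c0 x) 0) 0) 0" for x :: sps

lemmas sps_defs = zero_sps_def one_sps_def plus_sps_def minus_sps_def uminus_sps_def
  times_sps_def scaleC_sps_def hcomp_sps_def aug_sps_def

instance
  by standard
    (auto simp: sps_defs SPS_eq_iff ccst_simps fps_mult_nth_0 ccst_nth algebra_simps
      split: if_splits)

end

text \<open>The variables \<open>t^1, t^2, t^3, \<theta>^1, \<theta>^2\<close>:\<close>

definition "T1 = SPS fps_X 0 0 0"
definition "T2 = SPS (fps_const fps_X) 0 0 0"
definition "T3 = SPS (fps_const (fps_const fps_X)) 0 0 0"
definition "Th1 = SPS 0 1 0 0"
definition "Th2 = SPS 0 0 1 0"

definition rel_ideal :: "sps set" where
  "rel_ideal = ideal_gen {T1 * Th1, T2 * Th2}"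

lemma is_ideal_ideal_gen: "is_ideal (ideal_gen S)"
  by (auto simp: is_ideal_def ideal_gen_def)

lemma ideal_gen_minimal: "is_ideal I \<Longrightarrow> S \<subseteq> I \<Longrightarrow> ideal_gen S \<subseteq> I"
  by (auto simp: ideal_gen_def)

lemma gen_in_ideal_gen: "s \<in> S \<Longrightarrow> s \<in> ideal_gen S"
  by (auto simp: ideal_gen_def)

lemma is_ideal_rel_ideal: "is_ideal rel_ideal"
  unfolding rel_ideal_def by (rule is_ideal_ideal_gen)

lemma rel_ideal_zero: "0 \<in> rel_ideal"
  and rel_ideal_add: "x \<in> rel_ideal \<Longrightarrow> y \<in> rel_ideal \<Longrightarrow> x + y \<in> rel_ideal"
  and rel_ideal_left: "x \<in> rel_ideal \<Longrightarrow> r * x \<in> rel_ideal"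
  and rel_ideal_right: "x \<in> rel_ideal \<Longrightarrow> x * r \<in> rel_ideal"
  using is_ideal_rel_ideal by (auto simp: is_ideal_def)

lemma rel_ideal_minus: "x \<in> rel_ideal \<Longrightarrow> - x \<in> rel_ideal"
  using rel_ideal_left[of x "- 1"] by simp

lemma rel_ideal_scaleC: "x \<in> rel_ideal \<Longrightarrow> r *\<^sub>C x \<in> rel_ideal"
  using rel_ideal_left[of x "r *\<^sub>C 1"] by (simp add: scaleC_mult_left)

lemma rel_ideal_aug: "x \<in> rel_ideal \<Longrightarrow> aug x = 0"
proof -
  have "is_ideal {x :: sps. aug x = 0}"
    by (auto simp: is_ideal_def aug_add aug_mult sps_defs fps_mult_nth_0)
  moreover have "{T1 * Th1, T2 * Th2} \<subseteq> {x :: sps. aug x = 0}"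
    by (auto simp: T1_def T2_def Th1_def Th2_def sps_defs)
  ultimately show "x \<in> rel_ideal \<Longrightarrow> aug x = 0"
    using ideal_gen_minimal unfolding rel_ideal_def by blast
qed

lemma rel_ideal_hcomp: "x \<in> rel_ideal \<Longrightarrow> hcomp p x \<in> rel_ideal"
proof -
  let ?J = "{x \<in> rel_ideal. \<forall>p. hcomp p x \<in> rel_ideal}"
  have h: "hcomp p (x * y) = hcomp p x * hcomp 0 y + hcomp (p + 1) x * hcomp 1 y"
    for p and x y :: sps
    by (cases "p = 0") (auto simp: sps_defs)
  have hcomp_zero: "hcomp p (0 :: sps) = 0" for p
    by (simp add: sps_defs)
  have "is_ideal ?J"
    by (auto simp: is_ideal_def rel_ideal_zero rel_ideal_add rel_ideal_left rel_ideal_right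
        hcomp_add h hcomp_zero)
  moreover have "{T1 * Th1, T2 * Th2} \<subseteq> ?J"
  proof -
    have "hcomp p s = (if p = 0 then 0 else s)" if "s \<in> {T1 * Th1, T2 * Th2}" for p s
      using that by (auto simp: T1_def T2_def Th1_def Th2_def sps_defs)
    then show ?thesis
      using rel_ideal_zero unfolding rel_ideal_def by (auto intro: gen_in_ideal_gen)
  qed
  ultimately show "x \<in> rel_ideal \<Longrightarrow> hcomp p x \<in> rel_ideal"
    using ideal_gen_minimal unfolding rel_ideal_def by blast
qed

definition rel_eq :: "sps \<Rightarrow> sps \<Rightarrow> bool" where
  "rel_eq x y \<longleftrightarrow> x - y \<in> rel_ideal"

lemma equivp_rel_eq: "equivp rel_eq"
proof (rule equivpI)
  show "reflp rel_eq"
    by (simp add: reflp_def rel_eq_def rel_ideal_zero)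
  show "symp rel_eq"
    unfolding symp_def rel_eq_def using rel_ideal_minus by fastforce
  show "transp rel_eq"
    unfolding transp_def rel_eq_def using rel_ideal_add by fastforce
qed

quotient_type vbase = sps / rel_eq
  by (rule equivp_rel_eq)

instantiation vbase :: augmented_algebra
begin

lift_definition zero_vbase :: vbase is 0 .
lift_definition one_vbase :: vbase is 1 .
lift_definition plus_vbase :: "vbase \<Rightarrow> vbase \<Rightarrow> vbase" is "(+)"
  unfolding rel_eq_def by (metis add_diff_add rel_ideal_add)
lift_definition minus_vbase :: "vbase \<Rightarrow> vbase \<Rightarrow> vbase" is "(-)"
  unfolding rel_eq_def by (metis (no_types, lifting) diff_add_eq diff_diff_eq2 add_diff_add
    diff_conv_add_uminus minus_diff_minus rel_ideal_add rel_ideal_minus)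
lift_definition uminus_vbase :: "vbase \<Rightarrow> vbase" is "uminus"
  unfolding rel_eq_def by (metis minus_diff_minus rel_ideal_minus)
lift_definition times_vbase :: "vbase \<Rightarrow> vbase \<Rightarrow> vbase" is "(*)"
  unfolding rel_eq_def by (metis mult_diff_mult rel_ideal_add rel_ideal_left rel_ideal_right)
lift_definition scaleC_vbase :: "complex \<Rightarrow> vbase \<Rightarrow> vbase" is scaleC
  unfolding rel_eq_def
  by (metis rel_ideal_scaleC scaleC_add_right diff_add_cancel add_diff_cancel)
lift_definition hcomp_vbase :: "bit \<Rightarrow> vbase \<Rightarrow> vbase" is hcomp
  unfolding rel_eq_def
  by (metis rel_ideal_hcomp hcomp_add diff_add_cancel add_diff_cancel)
lift_definition aug_vbase :: "vbase \<Rightarrow> complex" is aug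
  unfolding rel_eq_def
  by (metis rel_ideal_aug aug_add diff_add_cancel add_0)

instance
proof
  have hom: "\<exists>y. x = abs_vbase y \<and> hcomp p y = y" if "hcomp p x = x" for p and x :: vbase
  proof (rule exI[of _ "hcomp p (rep_vbase x)"], intro conjI)
    have "hcomp p (abs_vbase (rep_vbase x)) = abs_vbase (hcomp p (rep_vbase x))"
      by (rule hcomp_vbase.abs_eq)
    then show "x = abs_vbase (hcomp p (rep_vbase x))"
      using that by (simp add: Quotient_abs_rep[OF Quotient_vbase])
  qed (simp add: hcomp_hcomp)
  fix a b c :: vbase and r s :: complex and p q :: bit
  note [simp] = rel_eq_def rel_ideal_zero
  show "a * b * c = a * (b * c)" by transfer (simp add: mult.assoc)
  show "1 * a = a" by transfer simp
  show "a * 1 = a" by transfer simp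
  show "a + b + c = a + (b + c)" by transfer (simp add: add.assoc)
  show "a + b = b + a" by transfer (simp add: add.commute)
  show "0 + a = a" by transfer simp
  show "- a + a = 0" by transfer simp
  show "a - b = a + - b" by transfer simp
  show "(a + b) * c = a * c + b * c" by transfer (simp add: distrib_right)
  show "a * (b + c) = a * b + a * c" by transfer (simp add: distrib_left)
  show "(0 :: vbase) \<noteq> 1"
  proof transfer
    have "aug (0 - 1 :: sps) \<noteq> 0" by (simp add: sps_defs)
    then show "\<not> rel_eq 0 1" using rel_ideal_aug unfolding rel_eq_def by blast
  qed
  show "r *\<^sub>C (a + b) = r *\<^sub>C a + r *\<^sub>C b" by transfer (simp add: scaleC_add_right)
  show "(r + s) *\<^sub>C a = r *\<^sub>C a + s *\<^sub>C a" by transfer (simp add: scaleC_add_left)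
  show "r *\<^sub>C s *\<^sub>C a = (r * s) *\<^sub>C a" by transfer (simp add: scaleC_scaleC)
  show "1 *\<^sub>C a = a" by transfer (simp add: scaleC_one)
  show "(r *\<^sub>C a) * b = r *\<^sub>C (a * b)" by transfer (simp add: scaleC_mult_left)
  show "a * (r *\<^sub>C b) = r *\<^sub>C (a * b)" by transfer (simp add: scaleC_mult_right)
  show "hcomp p (a + b) = hcomp p a + hcomp p b" by transfer (simp add: hcomp_add)
  show "hcomp p (r *\<^sub>C a) = r *\<^sub>C hcomp p a" by transfer (simp add: hcomp_scaleC)
  show "hcomp p (hcomp q a) = (if p = q then hcomp p a else 0)"
    by transfer (simp add: hcomp_hcomp)
  show "hcomp 0 a + hcomp 1 a = a" by transfer (simp add: hcomp_sum )
  show "hcomp 0 (1 :: vbase) = 1" by transfer (simp add: hcomp_one)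
  show "aug (a + b) = aug a + aug b" by transfer (rule aug_add)
  show "aug (a * b) = aug a * aug b" by transfer (rule aug_mult)
  show "aug (1 :: vbase) = 1" by transfer (rule aug_one)
  show "aug (r *\<^sub>C a) = r * aug a" by transfer (rule aug_scaleC)
  show "hcomp 1 a = a \<Longrightarrow> aug a = 0"
    using hom[of 1 a] by (auto simp: aug_vbase.abs_eq aug_odd)
  show "hcomp (p + q) (a * b) = a * b" "a * b = (if p * q = 1 then - (b * a) else b * a)"
    if ab: "hcomp p a = a" "hcomp q b = b"
  proof -
    obtain x y where "a = abs_vbase x" "hcomp p x = x" "b = abs_vbase y" "hcomp q y = y"
      using hom ab by metis
    then show "hcomp (p + q) (a * b) = a * b" "a * b = (if p * q = 1 then - (b * a) else b * a)"
      using hcomp_mult[of p x q y] supercomm[of p x q y]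
      by (auto simp: times_vbase.abs_eq hcomp_vbase.abs_eq uminus_vbase.abs_eq)
  qed
qed

end

lift_definition t1 :: vbase is T1 .
lift_definition t2 :: vbase is T2 .
lift_definition t3 :: vbase is T3 .
lift_definition th1 :: vbase is Th1 .
lift_definition th2 :: vbase is Th2 .

end

theory Submission
  imports Defs
begin

text \<open>
  Dually, coderivations and coalgebra automorphisms of \<open>S(W) \<otimes> B\<close> are derivations and substitutions
  of the algebra of power series in \<open>\<xi>, y, z\<close> over \<open>B\<close>. Here \<open>d_c\<close> is \<open>\<xi> v\<close> with the semisimple vector
  field \<open>v = y \<partial>_y + c z \<partial>_z\<close>, and the square of the universal family sends \<open>y\<close> to \<open>\<theta>^1 t^1 \<xi>\<close> and \<open>z\<close>
  to \<open>\<theta>^2 t^2 \<xi>\<close>, whence the relations.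

  For versality, suppose that a substitution \<open>g\<close> and values of the parameters intertwine the universal
  family \<open>D\<close> with a given deformation \<open>d\<close> modulo the \<open>n\<close>-th power of the maximal ideal. Modulo the next
  power, \<open>g D - d g\<close> is a cocycle up to \<open>D\<^sup>2\<close>; since \<open>v\<close> is diagonal, the cocycle equations decouple into
  weights, and for generic \<open>c\<close> every cocycle is a coboundary plus a first order change of the parameters,
  while the weight of \<open>D\<^sup>2\<close> forces the two relations to hold to the next order. Correcting \<open>g\<close> and the
  parameters yields sequences that converge in a formal base. If \<open>m\<^sup>2 = 0\<close>, the same first order
  computation shows that equivalent members of the family have equal parameters.
\<close>

text \<open>A substitution is determined by the images of \<xi>, y and z, and so is the defect
  \<open>g D - d g\<close>; hence infinitely many equations reduce to three series. The genericity
  of c says that a + c b takes the values 0, 1 and c only at the obvious exponents, so that the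
  eigenvalues of \<open>[d_c, -]\<close> vanish nowhere else.

  The monomials of the parameters have two origins. \<xi> \<partial>_y and \<xi> \<partial>_z, which
  carry \<open>t^1\<close> and \<open>t^2\<close>, would be coboundaries of translations, but
  coalgebra maps have no constant terms. The fields y \<partial>_y, z \<partial>_z and their
  products with \<xi> have weight 0. Of the two products, one direction is spent on rescaling \<xi>,
  so that only the single parameter \<open>t^3\<close> is left.

  At a finite stage the relations hold only modulo a power of the maximal ideal, and the
  approximating D need not square to zero. The relations are therefore part of the induction
  hypothesis and improve together with the substitution.\<close>

unbundle fps_syntax

section \<open>Graded algebras and graded ideals\<close>

lemma bit_double [simp]: "(p::bit) + p = 0" "p + (p + q) = q"
  by (cases p; cases q; simp)+

lemma ksign_simps [simp]: "ksign 0 = 1" "ksign 1 = - 1"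
  by (simp_all add: ksign_def)

lemma gsign_0 [simp]: "gsign 0 a = a"
  by (simp add: gsign_def)

lemma scaleC_zero_right [simp]: "r *\<^sub>C (0 :: 'a::supercomm_algebra) = 0"
  using scaleC_add_right[of r 0 "0::'a"] by simp

lemma scaleC_zero_left [simp]: "0 *\<^sub>C (a :: 'a::supercomm_algebra) = 0"
  using scaleC_add_left[of 0 0 a] by simp

lemma scaleC_minus_right: "r *\<^sub>C (- a :: 'a::supercomm_algebra) = - (r *\<^sub>C a)"
  by (metis add_eq_0_iff scaleC_add_right scaleC_zero_right)

lemma scaleC_minus_left: "(- r) *\<^sub>C (a :: 'a::supercomm_algebra) = - (r *\<^sub>C a)"
  by (metis add_eq_0_iff scaleC_add_left scaleC_zero_left)

lemma scaleC_diff_right: "r *\<^sub>C (a - b :: 'a::supercomm_algebra) = r *\<^sub>C a - r *\<^sub>C b"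
  using scaleC_add_right[of r a "- b"] by (simp add: scaleC_minus_right)

lemma scaleC_diff_left: "(r - s) *\<^sub>C (a :: 'a::supercomm_algebra) = r *\<^sub>C a - s *\<^sub>C a"
  using scaleC_add_left[of r "- s" a] by (simp add: scaleC_minus_left)

lemma scaleC_sum_right: "r *\<^sub>C (\<Sum>x\<in>A. f x :: 'a::supercomm_algebra) = (\<Sum>x\<in>A. r *\<^sub>C f x)"
  by (induction A rule: infinite_finite_induct) (auto simp: scaleC_add_right)

lemma scaleC_of_nat: "of_nat n *\<^sub>C (a :: 'a::supercomm_algebra) = of_nat n * a"
  by (induction n) (auto simp: scaleC_add_left scaleC_one algebra_simps)

lemma scaleC_cancel:
  assumes "r \<noteq> 0" shows "r *\<^sub>C (a :: 'a::supercomm_algebra) = r *\<^sub>C b \<longleftrightarrow> a = b"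
  by (metis assms left_inverse scaleC_one scaleC_scaleC)

lemma scaleC_eq_0_iff [simp]: "r *\<^sub>C (a :: 'a::supercomm_algebra) = 0 \<longleftrightarrow> r = 0 \<or> a = 0"
  using scaleC_cancel[of r a 0] by auto

lemma hcomp_zero [simp]: "hcomp p (0 :: 'a::supercomm_algebra) = 0"
  using hcomp_add[of p 0 "0::'a"] by simp

lemma hcomp_minus: "hcomp p (- a :: 'a::supercomm_algebra) = - hcomp p a"
  by (metis add_eq_0_iff hcomp_add hcomp_zero)

lemma hcomp_diff: "hcomp p (a - b :: 'a::supercomm_algebra) = hcomp p a - hcomp p b"
  using hcomp_add[of p a "- b"] by (simp add: hcomp_minus)

lemma hcomp_sum_set: "hcomp p (\<Sum>x\<in>A. f x :: 'a::supercomm_algebra) = (\<Sum>x\<in>A. hcomp p (f x))"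
  by (induction A rule: infinite_finite_induct) (auto simp: hcomp_add)

lemma hcomp_same [simp]: "hcomp p (hcomp p (a :: 'a::supercomm_algebra)) = hcomp p a"
  by (simp add: hcomp_hcomp)

lemma hcomp_parts: "hcomp p a + hcomp (p + 1) a = (a :: 'a::supercomm_algebra)"
  using hcomp_sum[of a] by (cases p) (simp_all add: add.commute)

lemma homogeneous_0 [simp]: "homogeneous p 0"
  by (simp add: homogeneous_def)

lemma homogeneous_1 [simp]: "homogeneous 0 1"
  by (simp add: homogeneous_def hcomp_one)

lemma homogeneous_hcomp [simp]: "homogeneous p (hcomp p a)"
  by (simp add: homogeneous_def)

lemma homogeneous_add: "homogeneous p a \<Longrightarrow> homogeneous p b \<Longrightarrow> homogeneous p (a + b)"
  by (simp add: homogeneous_def hcomp_add)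

lemma homogeneous_diff: "homogeneous p a \<Longrightarrow> homogeneous p b \<Longrightarrow> homogeneous p (a - b)"
  by (simp add: homogeneous_def hcomp_diff)

lemma homogeneous_sum: "(\<And>x. x \<in> A \<Longrightarrow> homogeneous p (f x)) \<Longrightarrow> homogeneous p (\<Sum>x\<in>A. f x)"
  by (simp add: homogeneous_def hcomp_sum_set)

lemma homogeneous_scaleC: "homogeneous p a \<Longrightarrow> homogeneous p (r *\<^sub>C a)"
  by (simp add: homogeneous_def hcomp_scaleC)

lemma homogeneous_mult: "homogeneous p a \<Longrightarrow> homogeneous q b \<Longrightarrow> homogeneous (p + q) (a * b)"
  unfolding homogeneous_def by (rule hcomp_mult)

lemma homogeneous_other: "homogeneous p a \<Longrightarrow> hcomp q a = (if q = p then a else 0)"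
  unfolding homogeneous_def by (metis hcomp_hcomp)

lemma hcomp_mult_parts:
  "hcomp p (x * y) = hcomp p x * hcomp 0 y + hcomp (p + 1) x * hcomp 1 (y :: 'a::supercomm_algebra)"
proof -
  have e: "x * y = hcomp p x * hcomp 0 y + hcomp (p + 1) x * hcomp 1 y
      + (hcomp p x * hcomp 1 y + hcomp (p + 1) x * hcomp 0 y)"
    by (subst (1) hcomp_parts[of p x, symmetric], subst (1) hcomp_sum[of y, symmetric])
      (simp add: algebra_simps)
  have "homogeneous p (hcomp p x * hcomp 0 y)" "homogeneous p (hcomp (p + 1) x * hcomp 1 y)"
    using homogeneous_mult[of p "hcomp p x" 0 "hcomp 0 y"]
      homogeneous_mult[of "p + 1" "hcomp (p + 1) x" 1 "hcomp 1 y"] by (cases p; simp)+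
  moreover have "homogeneous (p + 1) (hcomp p x * hcomp 1 y + hcomp (p + 1) x * hcomp 0 y)"
    using homogeneous_mult[of p "hcomp p x" 1 "hcomp 1 y"]
      homogeneous_mult[of "p + 1" "hcomp (p + 1) x" 0 "hcomp 0 y"]
    by (cases p) (simp_all add: homogeneous_add)
  ultimately show ?thesis
    by (subst e, subst hcomp_add, subst hcomp_add) (cases p; simp add: homogeneous_other)
qed

lemma gsign_add: "gsign p (a + b :: 'a::supercomm_algebra) = gsign p a + gsign p b"
  by (simp add: gsign_def hcomp_add)

lemma gsign_zero [simp]: "gsign p (0 :: 'a::supercomm_algebra) = 0"
  by (simp add: gsign_def)

lemma gsign_scaleC: "gsign p (r *\<^sub>C a) = r *\<^sub>C gsign p (a :: 'a::supercomm_algebra)"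
  by (simp add: gsign_def hcomp_scaleC scaleC_diff_right)

lemma gsign_homogeneous: "homogeneous q a \<Longrightarrow> gsign p a = ksign (p * q) * a"
  by (cases p; cases q) (auto simp: gsign_def homogeneous_other)

lemma gsign_even: "homogeneous 0 a \<Longrightarrow> gsign p a = a"
  by (simp add: gsign_homogeneous)

lemma gsign_one [simp]: "gsign p (1 :: 'a::supercomm_algebra) = 1"
  by (rule gsign_even) simp

lemma gsign_mult: "gsign p (a * b :: 'a::supercomm_algebra) = gsign p a * gsign p b"
proof (cases "p = 0")
  case False
  have "hcomp 0 (a * b) - hcomp 1 (a * b) = (hcomp 0 a - hcomp 1 a) * (hcomp 0 b - hcomp 1 b)"
    by (simp add: hcomp_mult_parts algebra_simps)
  then show ?thesis
    using False by (simp add: gsign_def)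
qed simp

lemma gsign_gsign: "gsign p (gsign q a) = gsign (p + q) (a :: 'a::supercomm_algebra)"
  by (cases p; cases q) (simp_all add: gsign_def hcomp_diff hcomp_hcomp hcomp_sum)

lemma gsign_twice [simp]: "gsign p (gsign p a) = (a :: 'a::supercomm_algebra)"
  by (simp add: gsign_gsign)

lemma hcomp_gsign: "hcomp q (gsign p a) = gsign p (hcomp q (a :: 'a::supercomm_algebra))"
  by (cases p; cases q) (simp_all add: gsign_def hcomp_diff hcomp_hcomp)

lemma homogeneous_gsign: "homogeneous q a \<Longrightarrow> homogeneous q (gsign p a)"
  by (simp add: homogeneous_def hcomp_gsign)

lemma homogeneous_commute:
  "homogeneous p a \<Longrightarrow> homogeneous q b \<Longrightarrow> a * b = ksign (p * q) * (b * a)"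
  using supercomm[of p a q b] unfolding homogeneous_def ksign_def by auto

lemma even_commute:
  assumes "homogeneous 0 (a :: 'a::supercomm_algebra)" shows "a * b = b * a"
proof -
  have "a * hcomp p b = hcomp p b * a" for p
    using homogeneous_commute[OF assms homogeneous_hcomp, of p b] by simp
  then show ?thesis
    by (metis distrib_left distrib_right hcomp_sum)
qed

lemma odd_commute:
  assumes "homogeneous 1 (a :: 'a::supercomm_algebra)" shows "a * b = gsign 1 b * a"
proof -
  have "a * hcomp 0 b = hcomp 0 b * a" "a * hcomp 1 b = - (hcomp 1 b * a)"
    using homogeneous_commute[OF assms homogeneous_hcomp, of 0 b]
      homogeneous_commute[OF assms homogeneous_hcomp, of 1 b] by simp_all
  then have "a * (hcomp 0 b + hcomp 1 b) = gsign 1 b * a"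
    by (simp add: gsign_def algebra_simps)
  then show ?thesis by (simp add: hcomp_sum)
qed

lemma homogeneous_move: 
  "homogeneous p (a :: 'a::supercomm_algebra) \<Longrightarrow> a * b = gsign p b * a"
  using even_commute[of a b] odd_commute[of a b] by (cases p) auto

lemma double_eq_0: "(a :: 'a::supercomm_algebra) + a = 0 \<Longrightarrow> a = 0"
  using scaleC_add_left[of 1 1 a] by (simp add: scaleC_one)

lemma odd_square:
  assumes "homogeneous 1 (a :: 'a::supercomm_algebra)" shows "a * a = 0"
proof (rule double_eq_0)
  have "a * a = ksign (1 * 1) * (a * a)" by (rule homogeneous_commute[OF assms assms])
  then have "a * a = - (a * a)" by (simp only: mult_1 ksign_simps mult_minus1)
  then show "a * a + a * a = 0" by (simp only: eq_neg_iff_add_eq_0)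
qed

text \<open>Products of series apply Koszul signs, that is \<open>gsign\<close>, to coefficients. An
  estimate saying that all coefficients lie in A survives this because A contains the homogeneous
  parts of its elements.\<close>

definition graded_ideal :: "'a::supercomm_algebra set \<Rightarrow> bool" where
  "graded_ideal A \<longleftrightarrow> is_ideal A \<and> (\<forall>a\<in>A. \<forall>p. hcomp p a \<in> A)"

lemma ideal_zero: "graded_ideal A \<Longrightarrow> 0 \<in> A"
  and ideal_add: "graded_ideal A \<Longrightarrow> x \<in> A \<Longrightarrow> y \<in> A \<Longrightarrow> x + y \<in> A"
  and ideal_left: "graded_ideal A \<Longrightarrow> x \<in> A \<Longrightarrow> r * x \<in> A"
  and ideal_right: "graded_ideal A \<Longrightarrow> x \<in> A \<Longrightarrow> x * r \<in> A"
  and ideal_hcomp: "graded_ideal A \<Longrightarrow> x \<in> A \<Longrightarrow> hcomp p x \<in> A"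
  by (auto simp: graded_ideal_def is_ideal_def)

lemma ideal_minus: "graded_ideal A \<Longrightarrow> x \<in> A \<Longrightarrow> - x \<in> A"
  using ideal_left[of A x "- 1"] by simp

lemma ideal_diff: "graded_ideal A \<Longrightarrow> x \<in> A \<Longrightarrow> y \<in> A \<Longrightarrow> x - y \<in> A"
  using ideal_add[of A x "- y"] ideal_minus by fastforce

lemma ideal_sum: "graded_ideal A \<Longrightarrow> (\<And>x. x \<in> S \<Longrightarrow> f x \<in> A) \<Longrightarrow> (\<Sum>x\<in>S. f x) \<in> A"
  by (induction S rule: infinite_finite_induct) (auto intro: ideal_zero ideal_add)

lemma ideal_scaleC: "graded_ideal A \<Longrightarrow> x \<in> A \<Longrightarrow> r *\<^sub>C x \<in> A"
  using ideal_left[of A x "r *\<^sub>C 1"] by (simp add: scaleC_mult_left)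

lemma ideal_scaleC_iff: "graded_ideal A \<Longrightarrow> r \<noteq> 0 \<Longrightarrow> r *\<^sub>C x \<in> A \<longleftrightarrow> x \<in> A"
  by (metis ideal_scaleC left_inverse scaleC_one scaleC_scaleC)

lemma ideal_gsign: "graded_ideal A \<Longrightarrow> x \<in> A \<Longrightarrow> gsign p x \<in> A"
  by (simp add: gsign_def ideal_hcomp ideal_diff)

lemma ideal_sub_swap: "graded_ideal A \<Longrightarrow> x - y \<in> A \<Longrightarrow> y - x \<in> A"
  using ideal_minus by fastforce

lemma ideal_trans: "graded_ideal A \<Longrightarrow> x - y \<in> A \<Longrightarrow> y - z \<in> A \<Longrightarrow> x - z \<in> A"
  using ideal_add by fastforce

lemma ideal_cong: "graded_ideal A \<Longrightarrow> x - y \<in> A \<Longrightarrow> x \<in> A \<longleftrightarrow> y \<in> A"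
  by (metis diff_add_cancel ideal_add ideal_sub_swap)

lemma graded_ideal_zero: "graded_ideal {0}"
  by (simp add: graded_ideal_def is_ideal_def)

lemma graded_ideal_UNIV: "graded_ideal UNIV"
  by (simp add: graded_ideal_def is_ideal_def)

text \<open>The elements of the generated ideal whose homogeneous parts stay inside it form an ideal
  that contains the generators.\<close>

lemma graded_ideal_gen:
  assumes "\<And>s p. s \<in> S \<Longrightarrow> hcomp p s \<in> ideal_gen S"
  shows "graded_ideal (ideal_gen S)"
proof -
  note I = is_ideal_ideal_gen[of S]
  let ?J = "{x \<in> ideal_gen S. \<forall>p. hcomp p x \<in> ideal_gen S}"
  have "is_ideal ?J"
    using I by (auto simp: is_ideal_def hcomp_add hcomp_mult_parts)
  moreover have "S \<subseteq> ?J" using assms gen_in_ideal_gen by blast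
  ultimately have "ideal_gen S \<subseteq> ?J" by (rule ideal_gen_minimal)
  then show ?thesis using I unfolding graded_ideal_def by blast
qed

subsection \<open>Powers of the augmentation ideal\<close>

lemma aug_zero [simp]: "aug (0 :: 'a::augmented_algebra) = 0"
  using aug_add[of 0 "0::'a"] by simp

lemma aug_minus: "aug (- a :: 'a::augmented_algebra) = - aug a"
  by (metis add_eq_0_iff aug_add aug_zero)

lemma aug_diff: "aug (a - b :: 'a::augmented_algebra) = aug a - aug b"
  using aug_add[of a "- b"] by (simp add: aug_minus)

lemma aug_homogeneous_1: "homogeneous 1 a \<Longrightarrow> aug a = 0"
  by (simp add: homogeneous_def aug_odd)

lemma aug_hcomp: "aug (hcomp p a) = (if p = 0 then aug a else 0)"
  using aug_add[of "hcomp 0 a" "hcomp 1 a"] aug_homogeneous_1[of "hcomp 1 a"]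
  by (cases p) (simp_all add: hcomp_sum)

lemma graded_ideal_aug: "graded_ideal aug_ideal"
  by (auto simp: graded_ideal_def is_ideal_def aug_ideal_def aug_add aug_mult aug_hcomp)

lemma aug_ideal_iff: "x \<in> aug_ideal \<longleftrightarrow> aug x = 0"
  by (simp add: aug_ideal_def)

lemma graded_ideal_aug_power: "graded_ideal (aug_power n :: 'a::augmented_algebra set)"
proof (induction n)
  case (Suc n)
  show ?case
    unfolding aug_power.simps
  proof (rule graded_ideal_gen)
    let ?S = "{x * y |x y :: 'a. x \<in> aug_ideal \<and> y \<in> aug_power n}"
    fix s p assume "s \<in> ?S"
    then obtain x y where s: "s = x * y" "x \<in> aug_ideal" "y \<in> aug_power n" by blast
    have "hcomp q x * hcomp r y \<in> ideal_gen ?S" for q r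
      by (rule gen_in_ideal_gen) (use s ideal_hcomp[OF graded_ideal_aug] ideal_hcomp[OF Suc] in blast)
    then show "hcomp p s \<in> ideal_gen ?S"
      unfolding s(1) hcomp_mult_parts using is_ideal_ideal_gen[of ?S] by (auto simp: is_ideal_def)
  qed
qed (simp add: graded_ideal_UNIV)

lemmas aug_power_zero = ideal_zero[OF graded_ideal_aug_power]
  and aug_power_add = ideal_add[OF graded_ideal_aug_power]
  and aug_power_diff = ideal_diff[OF graded_ideal_aug_power]

lemma aug_power_mult_left:
  "x \<in> aug_ideal \<Longrightarrow> y \<in> aug_power n \<Longrightarrow> x * y \<in> aug_power (Suc n)"
  by (auto intro: gen_in_ideal_gen)

text \<open>The powers are generated by products with the element of the augmentation ideal on the
  left. A homogeneous part of y moves past x at the cost of \<open>gsign\<close>, under which the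
  augmentation ideal is stable.\<close>

lemma aug_power_mult_right:
  fixes x y :: "'a::augmented_algebra"
  assumes "x \<in> aug_ideal" "y \<in> aug_power n" shows "y * x \<in> aug_power (Suc n)"
proof -
  have "hcomp p y * x \<in> aug_power (Suc n)" for p
    using assms homogeneous_move[of p "hcomp p y" x]
    by (metis aug_power_mult_left ideal_gsign ideal_hcomp graded_ideal_aug graded_ideal_aug_power
        homogeneous_hcomp)
  then show ?thesis
    by (metis aug_power_add distrib_right hcomp_sum)
qed

lemma aug_power_Suc_subset: "aug_power (Suc n) \<subseteq> (aug_power n :: 'a::augmented_algebra set)"
  unfolding aug_power.simps
  using graded_ideal_aug_power[of n, where 'a='a]
  by (intro ideal_gen_minimal) (auto simp: graded_ideal_def is_ideal_def)

lemma aug_power_antimono: "m \<le> n \<Longrightarrow> aug_power n \<subseteq> (aug_power m :: 'a::augmented_algebra set)"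
  by (rule lift_Suc_antimono_le[of aug_power, OF aug_power_Suc_subset])

lemma aug_power_1 [simp]: "aug_power (Suc 0) = aug_ideal"
proof
  show "aug_power (Suc 0) \<subseteq> (aug_ideal :: 'a set)"
    unfolding aug_power.simps using graded_ideal_aug
    by (intro ideal_gen_minimal) (auto simp: graded_ideal_def is_ideal_def)
  show "(aug_ideal :: 'a set) \<subseteq> aug_power (Suc 0)"
    using aug_power_mult_left[of _ 1 0] by auto
qed

lemma aug_power_mult_power:
  fixes x y :: "'a::augmented_algebra"
  shows "x \<in> aug_ideal \<Longrightarrow> x ^ n * y \<in> aug_power n"
  by (induction n) (auto simp: mult.assoc intro!: gen_in_ideal_gen)

declare aug_power.simps [simp del]

lemma aug_power_0 [simp]: "aug_power 0 = UNIV"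
  by (rule aug_power.simps)

subsection \<open>Complete bases\<close>

text \<open>The limit condition of \<open>formal_base\<close>, split off so that locality can be
  derived from it by inverting \<open>1 - u\<close>.\<close>

definition complete_base :: "'a::augmented_algebra itself \<Rightarrow> bool" where
  "complete_base _ \<longleftrightarrow> (\<forall>x :: nat \<Rightarrow> 'a. (\<forall>n. x (Suc n) - x n \<in> aug_power n) \<longrightarrow>
        (\<exists>!y. \<forall>n. y - x n \<in> aug_power n))"

lemma complete_base_limit:
  fixes x :: "nat \<Rightarrow> 'a::augmented_algebra"
  assumes "complete_base TYPE('a)" "\<And>n. x (Suc n) - x n \<in> aug_power n"
  shows "\<exists>y. \<forall>n. y - x n \<in> aug_power n"
  using assms unfolding complete_base_def by metis

lemma complete_base_separated:
  fixes x :: "'a::augmented_algebra"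
  assumes "complete_base TYPE('a)" "\<And>n. x \<in> aug_power n"
  shows "x = 0"
proof -
  have "\<exists>!y :: 'a. \<forall>n. y - 0 \<in> aug_power n"
    using assms(1)[unfolded complete_base_def, rule_format, of "\<lambda>_. 0"] by (simp add: aug_power_zero)
  then show ?thesis
    using assms(2) aug_power_zero[where 'a='a] by auto
qed

text \<open>Geometric series: its partial sums converge because \<open>u ^ n\<close> lies in the
  n-th power of the augmentation ideal, and separatedness turns the congruences into an
  equation.\<close>

lemma complete_base_unit:
  fixes u :: "'a::augmented_algebra"
  assumes c: "complete_base TYPE('a)" and u: "u \<in> aug_ideal"
  shows "\<exists>y. y * (1 - u) = 1"
proof -
  let ?x = "\<lambda>n. \<Sum>k<n. u ^ k"
  have "?x (Suc n) - ?x n \<in> aug_power n" for n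
    using aug_power_mult_power[OF u, of n 1] by simp
  then obtain y where y: "\<And>n. y - ?x n \<in> aug_power n"
    using complete_base_limit[OF c, of ?x] by blast
  have "y * (1 - u) - 1 \<in> aug_power n" for n
  proof -
    have "?x n * (1 - u) = 1 - u ^ n"
    proof (induction n)
      case (Suc n)
      have "?x (Suc n) * (1 - u) = ?x n * (1 - u) + (u ^ n - u ^ n * u)"
        by (simp add: distrib_right right_diff_distrib)
      then show ?case using Suc by (simp add: power_commutes)
    qed simp
    then have "y * (1 - u) - 1 = (y - ?x n) * (1 - u) - u ^ n * 1"
      by (simp add: algebra_simps)
    then show ?thesis
      using ideal_right[OF graded_ideal_aug_power y, of n "1 - u"] aug_power_mult_power[OF u, of n 1]
      by (metis aug_power_diff)
  qed
  then have "y * (1 - u) - 1 = 0" by (rule complete_base_separated[OF c])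
  then show ?thesis by auto
qed

text \<open>An element of non-zero augmentation is a scalar multiple of some \<open>1 - u\<close>
  with u in the augmentation ideal, so an ideal containing it is everything. Hence every proper
  ideal lies in \<open>aug_ideal\<close>.\<close>

lemma complete_base_local:
  assumes c: "complete_base TYPE('a::augmented_algebra)"
  shows "local_base TYPE('a)"
proof -
  have unit: "I = UNIV" if I: "is_ideal I" "a \<in> I" "aug a \<noteq> 0" for I and a :: 'a
  proof -
    define u where "u = 1 - (1 / aug a) *\<^sub>C a"
    have "u \<in> aug_ideal" using I(3) by (simp add: u_def aug_ideal_iff aug_diff aug_one aug_scaleC)
    then obtain y where "y * (1 - u) = 1" using complete_base_unit[OF c] by blast
    then have "((1 / aug a) *\<^sub>C y) * a = 1"
      by (simp add: u_def scaleC_mult_right scaleC_mult_left)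
    then have "1 \<in> I" using I by (metis is_ideal_def)
    then show "I = UNIV" using I(1) unfolding is_ideal_def by (metis UNIV_eq_I mult.right_neutral)
  qed
  have idm: "is_ideal (aug_ideal :: 'a set)"
    using graded_ideal_aug by (auto simp: graded_ideal_def)
  have pm: "aug_ideal \<noteq> (UNIV :: 'a set)"
    using aug_one[where 'a='a] by (metis UNIV_I aug_ideal_iff zero_neq_one)
  have "maximal_ideal (aug_ideal :: 'a set)"
    unfolding maximal_ideal_def using idm pm unit aug_ideal_iff by blast
  moreover have "M = aug_ideal" if M: "maximal_ideal M" for M :: "'a set"
    using M unit idm pm unfolding maximal_ideal_def
    by (metis aug_ideal_iff subsetI)
  ultimately show ?thesis unfolding local_base_def by blast
qed

lemma formal_base_iff_complete: "formal_base TYPE('a::augmented_algebra) \<longleftrightarrow> complete_base TYPE('a)"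
  using complete_base_local unfolding formal_base_def complete_base_def by blast

section \<open>Power series on W\<close>

declare split_paired_All [simp del] split_paired_Ex [simp del] add_bit_eq_xor [simp del]

instantiation fps :: (supercomm_algebra) supercomm_algebra
begin

definition scaleC_fps :: "complex \<Rightarrow> 'a fps \<Rightarrow> 'a fps" where
  "scaleC_fps r f = Abs_fps (\<lambda>n. r *\<^sub>C (f $ n))"

definition hcomp_fps :: "bit \<Rightarrow> 'a fps \<Rightarrow> 'a fps" where
  "hcomp_fps p f = Abs_fps (\<lambda>n. hcomp p (f $ n))"

instance
proof
  fix a b :: "'a fps" and r s :: complex and p q :: bit
  note [simp] = scaleC_fps_def hcomp_fps_def fps_eq_iff fps_mult_nth
  show "r *\<^sub>C (a + b) = r *\<^sub>C a + r *\<^sub>C b" by (simp add: scaleC_add_right)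
  show "(r + s) *\<^sub>C a = r *\<^sub>C a + s *\<^sub>C a" by (simp add: scaleC_add_left)
  show "r *\<^sub>C s *\<^sub>C a = (r * s) *\<^sub>C a" by (simp add: scaleC_scaleC)
  show "1 *\<^sub>C a = a" by (simp add: scaleC_one)
  show "(r *\<^sub>C a) * b = r *\<^sub>C (a * b)" by (simp add: scaleC_mult_left scaleC_sum_right)
  show "a * (r *\<^sub>C b) = r *\<^sub>C (a * b)" by (simp add: scaleC_mult_right scaleC_sum_right)
  show "hcomp p (a + b) = hcomp p a + hcomp p b" by (simp add: hcomp_add)
  show "hcomp p (r *\<^sub>C a) = r *\<^sub>C hcomp p a" by (simp add: hcomp_scaleC)
  show "hcomp p (hcomp q a) = (if p = q then hcomp p a else 0)" by (simp add: hcomp_hcomp)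
  show "hcomp 0 a + hcomp 1 a = a" by (simp add: hcomp_sum)
  show "hcomp 0 (1 :: 'a fps) = 1" by (simp add: hcomp_one)
  assume a: "hcomp p a = a" and b: "hcomp q b = b"
  have hp: "homogeneous p (a $ i)" "homogeneous q (b $ i)" for i
    using arg_cong[OF a, of "\<lambda>f. f $ i"] arg_cong[OF b, of "\<lambda>f. f $ i"]
    by (simp_all add: homogeneous_def)
  have "homogeneous (p + q) ((a * b) $ n)" for n
    unfolding fps_mult_nth by (intro homogeneous_sum homogeneous_mult hp)
  then show "hcomp (p + q) (a * b) = a * b"
    by (simp add: homogeneous_def del: fps_mult_nth)
  have "(a * b) $ n = ksign (p * q) * (b * a) $ n" for n
  proof -
    have "(a * b) $ n = (\<Sum>i=0..n. ksign (p * q) * (b $ (n - i) * a $ i))"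
      unfolding fps_mult_nth by (intro sum.cong refl homogeneous_commute hp)
    also have "\<dots> = ksign (p * q) * (\<Sum>i=0..n. b $ i * a $ (n - i))"
      unfolding sum_distrib_left
      by (rule sum.reindex_bij_witness[of _ "\<lambda>i. n - i" "\<lambda>i. n - i"]) auto
    finally show ?thesis by (simp only: fps_mult_nth)
  qed
  then show "a * b = (if p * q = 1 then - (b * a) else b * a)"
    unfolding fps_eq_iff ksign_def by auto
qed

end

lemma fps_nth_gsign: "gsign p f $ n = gsign p (f $ n)"
  by (simp add: gsign_def hcomp_fps_def)

text \<open>\<open>Ser f g\<close> is \<open>f + g \<xi>\<close>, where \<open>\<xi>\<close>, \<open>y\<close> (the outer variable) and \<open>z\<close> (the inner one) are
  the coordinates dual to \<open>w_1, w_2, w_3\<close>.\<close>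

datatype 'a ser = Ser (s0: "'a fps fps") (s1: "'a fps fps")

lemma ser_eq_iff: "F = G \<longleftrightarrow> s0 F = s0 G \<and> s1 F = s1 G"
  by (cases F; cases G) simp

instantiation ser :: (supercomm_algebra) supercomm_algebra
begin

definition "0 = Ser 0 0"
definition "1 = Ser 1 0"
definition "F + G = Ser (s0 F + s0 G) (s1 F + s1 G)"
definition "F - G = Ser (s0 F - s0 G) (s1 F - s1 G)"
definition "- F = Ser (- s0 F) (- s1 F)"
text \<open>Moving \<xi> past the coefficient \<open>s0 G\<close> produces \<open>gsign 1\<close>,
  and \<xi> \<xi> = 0 removes the product of the \<open>s1\<close> parts. As \<xi> is odd,
  \<open>hcomp\<close> shifts the parity of \<open>s1\<close> by one.\<close>

definition "F * G = Ser (s0 F * s0 G) (s0 F * s1 G + s1 F * gsign 1 (s0 G))"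
definition "r *\<^sub>C F = Ser (r *\<^sub>C s0 F) (r *\<^sub>C s1 F)"
definition "hcomp p F = Ser (hcomp p (s0 F)) (hcomp (p + 1) (s1 F))"

lemmas ser_defs = zero_ser_def one_ser_def plus_ser_def minus_ser_def uminus_ser_def
  times_ser_def scaleC_ser_def hcomp_ser_def

instance
proof
  fix a b c :: "'a ser" and r s :: complex and p q :: bit
  note [simp] = ser_defs ser_eq_iff gsign_mult gsign_add gsign_scaleC
  show "a * b * c = a * (b * c)" by (simp add: algebra_simps)
  show "1 * a = a" "a * 1 = a" "a + b + c = a + (b + c)" "a + b = b + a" "0 + a = a" "- a + a = 0"
    "a - b = a + - b" "(0 :: 'a ser) \<noteq> 1" by (simp_all add: algebra_simps)
  show "(a + b) * c = a * c + b * c" "a * (b + c) = a * b + a * c" by (simp_all add: algebra_simps)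
  show "r *\<^sub>C (a + b) = r *\<^sub>C a + r *\<^sub>C b"
    "(r + s) *\<^sub>C a = r *\<^sub>C a + s *\<^sub>C a"
    "r *\<^sub>C s *\<^sub>C a = (r * s) *\<^sub>C a" "1 *\<^sub>C a = a"
    by (simp_all add: scaleC_add_right scaleC_add_left scaleC_scaleC scaleC_one)
  show "(r *\<^sub>C a) * b = r *\<^sub>C (a * b)" "a * (r *\<^sub>C b) = r *\<^sub>C (a * b)"
    by (simp_all add: scaleC_mult_left scaleC_mult_right scaleC_add_right)
  show "hcomp p (a + b) = hcomp p a + hcomp p b" "hcomp p (r *\<^sub>C a) = r *\<^sub>C hcomp p a"
    "hcomp 0 (1 :: 'a ser) = 1"
    by (simp_all add: hcomp_add hcomp_scaleC hcomp_one)
  show "hcomp p (hcomp q a) = (if p = q then hcomp p a else 0)"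
    by (cases p; cases q) (simp_all add: hcomp_hcomp)
  show "hcomp 0 a + hcomp 1 a = a"
    using hcomp_sum[of "s0 a"] hcomp_sum[of "s1 a"] by (simp add: add.commute)
  assume a: "hcomp p a = a" and b: "hcomp q b = b"
  have h: "homogeneous p (s0 a)" "homogeneous (p + 1) (s1 a)"
    "homogeneous q (s0 b)" "homogeneous (q + 1) (s1 b)"
    using a b unfolding homogeneous_def by (simp_all only: ser_eq_iff hcomp_ser_def ser.sel)
  have "homogeneous (p + q) (s0 a * s0 b)" by (intro homogeneous_mult h)
  moreover have "homogeneous (p + q + 1) (s0 a * s1 b + s1 a * gsign 1 (s0 b))"
    using homogeneous_mult[OF h(1,4)] homogeneous_mult[OF h(2) homogeneous_gsign[OF h(3)], of 1]
    by (simp only: add_ac homogeneous_add)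
  ultimately show "hcomp (p + q) (a * b) = a * b"
    unfolding homogeneous_def by (simp only: ser_eq_iff hcomp_ser_def times_ser_def ser.sel)
  show "a * b = (if p * q = 1 then - (b * a) else b * a)"
    using homogeneous_commute[OF h(1,3)] homogeneous_commute[OF h(1,4)]
      homogeneous_commute[OF h(2,3)] gsign_homogeneous[OF h(1), of 1] gsign_homogeneous[OF h(3), of 1]
    by (cases p; cases q) (simp_all add: algebra_simps)
qed

end

text \<open>\<open>mi0\<close> also contains the index of the constant term.\<close>

definition mi0 :: "mi set" where
  "mi0 = {I. fst I \<le> 1}"

fun deg :: "mi \<Rightarrow> nat" where
  "deg (e, a, b) = e + a + b"

text \<open>Coefficients stand to the left of monomials. Exponents e > 1 of \<xi> give 0, so that
  most identities can be stated for all multi-indices.\<close>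

fun cf :: "mi \<Rightarrow> 'a::supercomm_algebra ser \<Rightarrow> 'a" where
  "cf (e, a, b) F = (if e = 0 then (s0 F) $ a $ b
     else if e = 1 then (s1 F) $ a $ b else 0)"

declare cf.simps [simp del] deg.simps [simp del] wpar.simps [simp del]

definition mk :: "(mi \<Rightarrow> 'a::supercomm_algebra) \<Rightarrow> 'a ser" where
  "mk h = Ser (Abs_fps (\<lambda>a. Abs_fps (\<lambda>b. h (0, a, b)))) (Abs_fps (\<lambda>a. Abs_fps (\<lambda>b. h (1, a, b))))"

definition cst :: "'a \<Rightarrow> 'a::supercomm_algebra ser" where
  "cst b = mk (\<lambda>I. if I = 0 then b else 0)"

definition mon :: "mi \<Rightarrow> 'a::supercomm_algebra ser" where
  "mon M = mk (\<lambda>I. if I = M then 1 else 0)"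

lemma zero_mi: "(0 :: mi) = (0, 0, 0)"
  by (simp add: zero_prod_def)

lemma mi0_iff: "(e, a, b) \<in> mi0 \<longleftrightarrow> e \<le> 1"
  by (simp add: mi0_def)

lemma zero_mi0 [simp]: "0 \<in> mi0"
  by (simp add: zero_mi mi0_iff)

lemma mis_iff: "(e, a, b) \<in> mis \<longleftrightarrow> e \<le> 1 \<and> (e, a, b) \<noteq> 0"
  by (simp add: mis_def zero_mi)

lemma mis_eq: "mis = mi0 - {0}"
  by (auto simp: mis_def mi0_def zero_mi)

lemma mis_mi0: "I \<in> mis \<Longrightarrow> I \<in> mi0"
  by (simp add: mis_eq)

lemma deg_add: "deg (I + J) = deg I + deg J"
  by (cases I; cases J) (simp add: deg.simps)

lemma deg_zero [simp]: "deg 0 = 0"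
  by (simp add: zero_mi deg.simps)

lemma deg_eq_0: "deg I = 0 \<longleftrightarrow> I = 0"
  by (cases I) (simp add: zero_mi deg.simps)

lemma deg_mis: "I \<in> mis \<Longrightarrow> deg I \<ge> 1"
  using deg_eq_0[of I] by (auto simp: mis_eq)

lemma wpar_add: "wpar (I + J) = wpar I + wpar J"
  by (cases I; cases J) (simp add: wpar.simps)

lemma wpar_zero [simp]: "wpar 0 = 0"
  by (simp add: zero_mi wpar.simps)

lemma mi0_add: "J + K \<in> mi0 \<Longrightarrow> J \<in> mi0 \<and> K \<in> mi0"
  by (cases J; cases K) (simp add: mi0_iff)

lemma mis_add: "J \<in> mis \<Longrightarrow> K \<in> mis \<Longrightarrow> J + K \<in> mis \<longleftrightarrow> wpar J * wpar K = 0"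
  by (cases J; cases K) (auto simp: le_Suc_eq zero_mi mis_iff wpar.simps)

lemma mis_add_mi0: "J \<in> mis \<Longrightarrow> K \<in> mis \<Longrightarrow> J + K \<in> mis \<longleftrightarrow> J + K \<in> mi0"
  by (cases J; cases K) (auto simp: zero_mi mis_iff mi0_iff)

lemma finite_deg [simp]: "finite {I. deg I \<le> n}"
proof -
  have "{I. deg I \<le> n} \<subseteq> {0..n} \<times> {0..n} \<times> {0..n}" by (auto simp: deg.simps)
  then show ?thesis by (rule finite_subset) simp
qed

definition mis_upto :: "nat \<Rightarrow> mi set" where
  "mis_upto n = {I \<in> mis. deg I \<le> n}"

lemma finite_mis_upto [simp]: "finite (mis_upto n)"
  by (rule finite_subset[OF _ finite_deg[of n]]) (auto simp: mis_upto_def)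

lemma cf_mk: "cf I (mk h) = (if I \<in> mi0 then h I else 0)"
  by (cases I) (auto simp: mk_def le_Suc_eq mi0_iff cf.simps)

lemma cf_not_mi0: "I \<notin> mi0 \<Longrightarrow> cf I F = 0"
  by (cases I) (auto simp: mi0_iff cf.simps)

lemma ser_eqI:
  assumes "\<And>I. I \<in> mi0 \<Longrightarrow> cf I F = cf I G" shows "F = G"
  using assms[of "(0, _, _)"] assms[of "(1, _, _)"] by (simp add: ser_eq_iff fps_eq_iff mi0_iff cf.simps)

lemma cf_add: "cf I (F + G) = cf I F + cf I G"
  by (cases I) (simp add: cf.simps ser_defs)

lemma cf_zero [simp]: "cf I 0 = 0"
  by (cases I) (simp add: cf.simps ser_defs)

lemma cf_minus: "cf I (- F) = - cf I F"
  by (cases I) (simp add: cf.simps ser_defs)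

lemma cf_diff: "cf I (F - G) = cf I F - cf I G"
  by (cases I) (simp add: cf.simps ser_defs)

lemma cf_scaleC: "cf I (r *\<^sub>C F) = r *\<^sub>C cf I F"
  by (cases I) (simp add: cf.simps ser_defs scaleC_fps_def)

lemma cf_sum: "cf I (\<Sum>x\<in>A. f x) = (\<Sum>x\<in>A. cf I (f x))"
  by (induction A rule: infinite_finite_induct) (auto simp: cf_add)

lemma cf_hcomp: "cf I (hcomp p F) = hcomp (p + wpar I) (cf I F)"
  by (cases I) (auto simp: cf.simps wpar.simps ser_defs hcomp_fps_def)

lemma cf_gsign: "cf I (gsign p F) = ksign (p * wpar I) * gsign p (cf I F)"
  by (cases p; cases "wpar I") (simp_all add: gsign_def cf_diff cf_hcomp)

lemma homogeneous_iff_cf: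
  "homogeneous p F \<longleftrightarrow> (\<forall>I\<in>mi0. homogeneous (p + wpar I) (cf I F))"
  unfolding homogeneous_def by (metis cf_hcomp ser_eqI)

lemma homogeneous_cf: "homogeneous p F \<Longrightarrow> homogeneous (p + wpar I) (cf I F)"
  using homogeneous_iff_cf[of p F] cf_not_mi0[of I F] by (cases "I \<in> mi0") auto

lemma homogeneous_mk: "(\<And>I. I \<in> mi0 \<Longrightarrow> homogeneous (p + wpar I) (h I)) \<Longrightarrow> homogeneous p (mk h)"
  by (simp add: homogeneous_iff_cf cf_mk)

section \<open>Products of series in terms of coefficients\<close>

definition splits :: "mi \<Rightarrow> (mi \<times> mi) set" where
  "splits I = {(P, Q). P + Q = I}"

lemma sum_splits:
  "(\<Sum>(P, Q)\<in>splits (e, a, b). g P Q)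
    = (\<Sum>k=0..e. \<Sum>i=0..a. \<Sum>j=0..b. g (k, i, j) (e - k, a - i, b - j))"
proof -
  have "(\<Sum>(P, Q)\<in>splits (e, a, b). g P Q)
    = (\<Sum>(k, i, j)\<in>{0..e} \<times> {0..a} \<times> {0..b}. g (k, i, j) (e - k, a - i, b - j))"
    by (rule sum.reindex_bij_witness[of _ "\<lambda>(k, i, j). ((k, i, j), (e - k, a - i, b - j))" fst])
      (auto simp: splits_def)
  then show ?thesis by (simp add: sum.cartesian_product)
qed

lemma finite_splits [simp]: "finite (splits I)"
proof -
  have "splits I \<subseteq> {P. deg P \<le> deg I} \<times> {P. deg P \<le> deg I}"
    by (auto simp: splits_def deg.simps)
  then show ?thesis by (rule finite_subset) simp
qed

text \<open>The sign comes from moving the monomial \<open>x^P\<close> past the coefficient of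
  \<open>x^Q\<close>.\<close>

lemma cf_mult:
  assumes "I \<in> mi0"
  shows "cf I (F * G) = (\<Sum>(P, Q)\<in>splits I. cf P F * gsign (wpar P) (cf Q G))"
proof -
  obtain e a b where I: "I = (e, a, b)" by (cases I)
  have "e = 0 \<or> e = 1" using assms I by (auto simp: mi0_iff)
  then show ?thesis
    unfolding I sum_splits
    by (auto simp: cf.simps wpar.simps times_ser_def fps_mult_nth fps_sum_nth fps_nth_gsign sum.distrib)
qed

lemma cf_one: "cf I 1 = (if I = 0 then 1 else 0)"
  by (cases I) (auto simp: cf.simps wpar.simps ser_defs zero_mi)

lemma mon_zero [simp]: "mon 0 = 1"
  by (rule ser_eqI) (simp add: cf_one mon_def cf_mk)

lemma cf_mon: "cf I (mon M) = (if I = M \<and> I \<in> mi0 then 1 else 0)"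
  by (simp add: mon_def cf_mk)

lemma cf_cst: "cf I (cst b) = (if I = 0 then b else 0)"
  by (simp add: cst_def cf_mk)

lemma cf_mult_mon: "J + K \<in> mi0 \<Longrightarrow> cf (J + K) (F * mon K) = cf J F"
  and cf_mult_mon_0: "I \<in> mi0 \<Longrightarrow> (\<And>J. I \<noteq> J + K) \<Longrightarrow> cf I (F * mon K) = 0"
  and cf_mon_mult: "J + K \<in> mi0 \<Longrightarrow> cf (J + K) (mon K * F) = gsign (wpar K) (cf J F)"
  and cf_mon_mult_0: "I \<in> mi0 \<Longrightarrow> (\<And>J. I \<noteq> J + K) \<Longrightarrow> cf I (mon K * F) = 0"
proof -
  have r: "(\<Sum>(P, Q)\<in>splits I. cf P F * gsign (wpar P) (cf Q (mon K)))
      = (\<Sum>(P, Q)\<in>{(P, Q). P + Q = I \<and> Q = K}. cf P F)" if "I \<in> mi0" for I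
    by (rule sum.mono_neutral_cong_right[OF finite_splits])
      (use that in \<open>auto simp: splits_def cf_mon dest: mi0_add split: if_splits\<close>)
  have l: "(\<Sum>(P, Q)\<in>splits I. cf P (mon K) * gsign (wpar P) (cf Q F))
      = (\<Sum>(P, Q)\<in>{(P, Q). P + Q = I \<and> P = K}. gsign (wpar K) (cf Q F))" if "I \<in> mi0" for I
    by (rule sum.mono_neutral_cong_right[OF finite_splits])
      (use that in \<open>auto simp: splits_def cf_mon dest: mi0_add split: if_splits\<close>)
  have s: "{(P, Q). P + Q = J + K \<and> Q = K} = {(J, K)}" "{(P, Q). P + Q = J + K \<and> P = K} = {(K, J)}"
    for J by (rule set_eqI, rename_tac x, case_tac x, simp, metis add.commute add_right_cancel)+
  have e: "{(P, Q). P + Q = I \<and> Q = K} = {}" "{(P, Q). P + Q = I \<and> P = K} = {}"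
    if "\<And>J. I \<noteq> J + K" for I
    by (rule equals0I, rename_tac x, case_tac x, simp, metis add.commute that)+
  show "J + K \<in> mi0 \<Longrightarrow> cf (J + K) (F * mon K) = cf J F"
    by (simp add: cf_mult r s)
  show "J + K \<in> mi0 \<Longrightarrow> cf (J + K) (mon K * F) = gsign (wpar K) (cf J F)"
    by (simp add: cf_mult l s)
  show "I \<in> mi0 \<Longrightarrow> (\<And>J. I \<noteq> J + K) \<Longrightarrow> cf I (F * mon K) = 0"
    by (simp add: cf_mult r e)
  show "I \<in> mi0 \<Longrightarrow> (\<And>J. I \<noteq> J + K) \<Longrightarrow> cf I (mon K * F) = 0"
    by (simp add: cf_mult l e)
qed

lemma cf_cst_mult: "cf I (cst b * F) = b * cf I F"
proof (cases "I \<in> mi0")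
  case True
  have "cf I (cst b * F) = (\<Sum>(P, Q)\<in>{(0 :: mi, I)}. b * cf Q F)"
    unfolding cf_mult[OF True]
    by (rule sum.mono_neutral_cong_right[OF finite_splits])
      (auto simp: splits_def cf_cst zero_mi wpar.simps split: if_splits)
  then show ?thesis by simp
qed (simp add: cf_not_mi0)

lemma mon_mult: "mon J * mon K = mon (J + K)"
proof (rule ser_eqI)
  fix I :: mi assume I: "I \<in> mi0"
  show "cf I (mon J * mon K) = cf I (mon (J + K) :: 'a ser)"
  proof (cases "\<exists>L. I = L + K")
    case True
    then obtain L where "I = L + K" by blast
    then show ?thesis using I mi0_add[of L K] by (simp add: cf_mult_mon cf_mon)
  next
    case False
    then have "cf I (mon J * mon K) = 0" using I by (intro cf_mult_mon_0) auto
    moreover have "I \<noteq> J + K" using False by blast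
    ultimately show ?thesis by (simp add: cf_mon)
  qed
qed

lemma mon_not_mi0: "M \<notin> mi0 \<Longrightarrow> mon M = 0"
  by (rule ser_eqI) (auto simp: cf_mon)

lemma homogeneous_mon: "homogeneous (wpar M) (mon M)"
  by (auto simp: homogeneous_iff_cf cf_mon)

lemma gsign_mon: "gsign p (mon M) = ksign (p * wpar M) * mon M"
  by (rule gsign_homogeneous[OF homogeneous_mon])

lemma gsign_cst: "gsign p (cst b) = cst (gsign p b)"
  by (rule ser_eqI) (simp add: cf_gsign cf_cst)

subsection \<open>Approximation by polynomials\<close>

text \<open>Two filtrations are in play: this one, by degree in the coordinates, serves for
  continuity of substitutions; the powers of the maximal ideal filter the coefficients and serve for
  the successive approximation.\<close>

definition agree_upto :: "nat \<Rightarrow> 'a::supercomm_algebra ser \<Rightarrow> 'a ser \<Rightarrow> bool" where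
  "agree_upto n F G \<longleftrightarrow> (\<forall>I. deg I \<le> n \<longrightarrow> cf I F = cf I G)"

lemma agree_upto_mult: "agree_upto n F F' \<Longrightarrow> agree_upto n G G' \<Longrightarrow> agree_upto n (F * G) (F' * G')"
  unfolding agree_upto_def
proof (intro allI impI)
  fix I assume h: "\<forall>I. deg I \<le> n \<longrightarrow> cf I F = cf I F'"
    "\<forall>I. deg I \<le> n \<longrightarrow> cf I G = cf I G'" "deg I \<le> n"
  have "cf P F * gsign (wpar P) (cf Q G) = cf P F' * gsign (wpar P) (cf Q G')"
    if "(P, Q) \<in> splits I" for P Q
    using that h by (auto simp: splits_def deg_add)
  then show "cf I (F * G) = cf I (F' * G')"
    by (cases "I \<in> mi0") (auto simp: cf_mult cf_not_mi0 intro!: sum.cong)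
qed

lemma agree_upto_refl: "agree_upto n F F"
  by (simp add: agree_upto_def)

lemma agree_upto_trans: "agree_upto n F G \<Longrightarrow> agree_upto n G H \<Longrightarrow> agree_upto n F H"
  by (simp add: agree_upto_def)

lemma agree_upto_sym: "agree_upto n F G \<Longrightarrow> agree_upto n G F"
  by (simp add: agree_upto_def)

lemma agree_upto_add: "agree_upto n F F' \<Longrightarrow> agree_upto n G G' \<Longrightarrow> agree_upto n (F + G) (F' + G')"
  by (simp add: agree_upto_def cf_add)

lemma agree_upto_gsign: "agree_upto n F G \<Longrightarrow> agree_upto n (gsign p F) (gsign p G)"
  by (simp add: agree_upto_def cf_gsign)

lemma agree_upto_all: "(\<And>n. agree_upto n F G) \<Longrightarrow> F = G"
  by (rule ser_eqI) (auto simp: agree_upto_def)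

lemma agree_upto_poly:
  assumes "cf 0 F = 0"
  shows "agree_upto n F (\<Sum>J\<in>mis_upto n. cst (cf J F) * mon J)"
  unfolding agree_upto_def
proof (intro allI impI)
  fix I assume I: "deg I \<le> n"
  have "cf I (\<Sum>J\<in>mis_upto n. cst (cf J F) * mon J)
      = (\<Sum>J\<in>mis_upto n. if J = I then if I \<in> mi0 then cf J F else 0 else 0)"
    unfolding cf_sum by (rule sum.cong) (auto simp: cf_cst_mult cf_mon)
  also have "\<dots> = cf I F"
    using I assms by (auto simp: mis_upto_def mis_eq cf_not_mi0)
  finally show "cf I F = cf I (\<Sum>J\<in>mis_upto n. cst (cf J F) * mon J)" by simp
qed

text \<open>Coefficients stand on the left, so left multiplication by an element of parity \<open>q\<close> is only
  linear up to the sign \<open>gsign q\<close>.\<close>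

definition lincont :: "bit \<Rightarrow> ('a::supercomm_algebra ser \<Rightarrow> 'a ser) \<Rightarrow> bool" where
  "lincont q \<phi> \<longleftrightarrow> (\<forall>F G. \<phi> (F + G) = \<phi> F + \<phi> G) \<and> (\<forall>b F. \<phi> (cst b * F) = cst (gsign q b) * \<phi> F)
     \<and> (\<forall>n F G. agree_upto n F G \<longrightarrow> agree_upto n (\<phi> F) (\<phi> G))"

text \<open>In degrees up to n the series F is a finite left combination of monomials, on which both
  maps agree; continuity yields agreement up to n for every n. This transfers identities from
  monomials to series without constant term.\<close>

lemma lincont_ext:
  assumes \<phi>: "lincont q \<phi>" and \<psi>: "lincont q \<psi>" and F: "cf 0 F = 0"
    and e: "\<And>J. J \<in> mis \<Longrightarrow> \<phi> (mon J) = \<psi> (mon J)"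
  shows "\<phi> F = \<psi> F"
proof (rule agree_upto_all)
  fix n
  let ?P = "\<Sum>J\<in>mis_upto n. cst (cf J F) * mon J"
  have s: "f (\<Sum>J\<in>S. cst (c J) * mon J) = (\<Sum>J\<in>S. cst (gsign q (c J)) * f (mon J))"
    if "lincont q f" "finite S" for f S c
  proof -
    have "f 0 = 0"
      using that(1) unfolding lincont_def by (metis add_cancel_right_right)
    with that(2,1) show ?thesis
      by (induction S) (simp_all add: lincont_def)
  qed
  have "\<phi> ?P = \<psi> ?P"
    using s[OF \<phi> finite_mis_upto] s[OF \<psi> finite_mis_upto] e
    by (auto simp: mis_upto_def intro!: sum.cong)
  moreover have "agree_upto n (\<phi> F) (\<phi> ?P)" "agree_upto n (\<psi> F) (\<psi> ?P)"
    using \<phi> \<psi> agree_upto_poly[OF F, of n] unfolding lincont_def by blast+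
  ultimately show "agree_upto n (\<phi> F) (\<psi> F)"
    by (metis agree_upto_sym agree_upto_trans)
qed

lemma lincont_id: "lincont 0 (\<lambda>F. F)"
  by (simp add: lincont_def)

lemma lincont_add: "lincont q f \<Longrightarrow> lincont q g \<Longrightarrow> lincont q (\<lambda>F. f F + g F)"
  by (simp add: lincont_def algebra_simps agree_upto_add)

lemma lincont_mult_right: "lincont q f \<Longrightarrow> lincont q (\<lambda>F. f F * G)"
  by (simp add: lincont_def algebra_simps agree_upto_mult agree_upto_refl)

lemma lincont_mult_left:
  assumes "lincont q f" "homogeneous p G" shows "lincont (p + q) (\<lambda>F. G * f F)"
proof -
  have "G * (cst (gsign q b) * H) = cst (gsign (p + q) b) * (G * H)" for b H
    using homogeneous_move[OF assms(2), of "cst (gsign q b)"]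
    by (simp add: gsign_cst gsign_gsign flip: mult.assoc)
  then show ?thesis
    using assms(1) by (simp add: lincont_def algebra_simps agree_upto_mult agree_upto_refl)
qed

lemma lincont_gsign: "lincont q f \<Longrightarrow> lincont (p + q) (\<lambda>F. gsign p (f F))"
  by (simp add: lincont_def gsign_add gsign_mult gsign_cst gsign_gsign agree_upto_gsign)

lemma lincont_comp: "lincont q f \<Longrightarrow> lincont p g \<Longrightarrow> lincont (p + q) (\<lambda>F. g (f F))"
  by (simp add: lincont_def gsign_gsign)

subsection \<open>Pullback along a family of rows\<close>

text \<open>Substitutes the series \<open>r K\<close> for the monomial \<open>x^K\<close>. Cutting
  off at the degree of I makes the sum finite for any r and loses nothing if r is triangular. The
  constant term of F is dropped, since the coalgebra has no component of degree 0; hence the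
  recurring hypothesis \<open>cf 0 F = 0\<close>.\<close>

definition pullback :: "(mi \<Rightarrow> 'a::supercomm_algebra ser) \<Rightarrow> 'a ser \<Rightarrow> 'a ser" where
  "pullback r F = mk (\<lambda>I. \<Sum>K\<in>mis_upto (deg I). cf K F * cf I (r K))"

definition triangular :: "(mi \<Rightarrow> 'a::supercomm_algebra ser) \<Rightarrow> bool" where
  "triangular r \<longleftrightarrow> (\<forall>K\<in>mis. \<forall>I. deg I < deg K \<longrightarrow> cf I (r K) = 0)"

lemma cf_pullback: "I \<in> mi0 \<Longrightarrow> cf I (pullback r F) = (\<Sum>K\<in>mis_upto (deg I). cf K F * cf I (r K))"
  by (simp add: pullback_def cf_mk)

lemma cf_0_pullback [simp]: "cf 0 (pullback r F) = 0"
  using deg_mis by (force simp: cf_pullback mis_upto_def intro: sum.neutral)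

lemma triangular_cf_0: "triangular r \<Longrightarrow> K \<in> mis \<Longrightarrow> cf 0 (r K) = 0"
  using deg_mis[of K] by (auto simp: triangular_def)

lemma lincont_pullback: "lincont 0 (pullback r)"
proof -
  have "pullback r (F + G) = pullback r F + pullback r G" for F G
    by (rule ser_eqI) (simp add: cf_pullback cf_add algebra_simps sum.distrib)
  moreover have "pullback r (cst b * F) = cst b * pullback r F" for b F
    by (rule ser_eqI) (simp add: cf_pullback cf_cst_mult algebra_simps sum_distrib_left)
  moreover have "agree_upto n (pullback r F) (pullback r G)" if "agree_upto n F G" for n F G
    using that unfolding agree_upto_def
    by (intro allI impI) (auto simp: pullback_def cf_mk mis_upto_def intro!: sum.cong)
  ultimately show ?thesis by (simp add: lincont_def)
qed

lemma pullback_add: "pullback r (F + G) = pullback r F + pullback r G"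
  and pullback_agree_upto: "agree_upto n F G \<Longrightarrow> agree_upto n (pullback r F) (pullback r G)"
  and pullback_cst_mult: "pullback r (cst b * F) = cst b * pullback r F"
  using lincont_pullback[of r] by (simp_all add: lincont_def)

lemma pullback_zero [simp]: "pullback r 0 = 0"
  using pullback_add[of r 0 0] by simp

lemma pullback_minus: "pullback r (- F) = - pullback r F"
  using pullback_add[of r F "- F"] by (simp add: eq_neg_iff_add_eq_0 add.commute)

lemma pullback_diff: "pullback r (F - G) = pullback r F - pullback r G"
  using pullback_add[of r F "- G"] by (simp add: pullback_minus)

lemma pullback_scaleC: "pullback r (a *\<^sub>C F) = a *\<^sub>C pullback r F"
  by (rule ser_eqI) (simp add: cf_pullback cf_scaleC scaleC_sum_right scaleC_mult_left)

lemma pullback_mon: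
  assumes "triangular r" "K \<in> mis" shows "pullback r (mon K) = r K"
proof (rule ser_eqI)
  fix I assume I: "I \<in> mi0"
  have "cf I (pullback r (mon K)) = (\<Sum>L\<in>mis_upto (deg I). if L = K then cf I (r K) else 0)"
    unfolding cf_pullback[OF I] by (rule sum.cong) (use assms(2) in \<open>auto simp: cf_mon mis_mi0\<close>)
  also have "\<dots> = cf I (r K)"
    using assms by (auto simp: mis_upto_def triangular_def)
  finally show "cf I (pullback r (mon K)) = cf I (r K)" .
qed

lemma pullback_cong: "(\<And>K. K \<in> mis \<Longrightarrow> r K = r' K) \<Longrightarrow> pullback r F = pullback r' F"
  by (rule ser_eqI) (auto simp: cf_pullback mis_upto_def)

lemma pullback_family_diff: "pullback (\<lambda>K. r K - r' K) F = pullback r F - pullback r' F"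
  by (rule ser_eqI) (simp add: cf_pullback cf_diff algebra_simps sum_subtractf)

lemma triangular_pullback:
  assumes "triangular r'" shows "triangular (\<lambda>M. pullback r (r' M))"
  unfolding triangular_def
proof (intro ballI allI impI)
  fix K I assume K: "K \<in> mis" "deg I < deg K"
  then have "agree_upto (deg I) (r' K) 0" using assms by (simp add: agree_upto_def triangular_def)
  then have "agree_upto (deg I) (pullback r (r' K)) 0" using pullback_agree_upto[of _ "r' K" 0 r] by simp
  then show "cf I (pullback r (r' K)) = 0" by (simp add: agree_upto_def)
qed

lemma pullback_pullback:
  assumes "triangular r" "triangular r'" "cf 0 F = 0"
  shows "pullback r (pullback r' F) = pullback (\<lambda>M. pullback r (r' M)) F"
  by (rule lincont_ext[where q = 0])
    (use assms lincont_pullback lincont_comp[OF lincont_pullback lincont_pullback] in \<open>auto simp: pullback_mon triangular_pullback\<close>)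

lemma homogeneous_pullback:
  assumes "\<And>M. M \<in> mis \<Longrightarrow> homogeneous (p + wpar M) (r M)" "homogeneous q F"
  shows "homogeneous (p + q) (pullback r F)"
  unfolding homogeneous_iff_cf
proof (intro ballI)
  fix I assume I: "I \<in> mi0"
  have "homogeneous (p + q + wpar I) (cf K F * cf I (r K))" if "K \<in> mis" for K
  proof -
    have "homogeneous ((q + wpar K) + (p + wpar K + wpar I)) (cf K F * cf I (r K))"
      by (intro homogeneous_mult homogeneous_cf assms that)
    also have "(q + wpar K) + (p + wpar K + wpar I) = p + q + wpar I"
      by (cases p; cases q; cases "wpar K"; cases "wpar I") simp_all
    finally show ?thesis .
  qed
  then show "homogeneous (p + q + wpar I) (cf I (pullback r F))"
    unfolding cf_pullback[OF I] mis_upto_def by (intro homogeneous_sum) blast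
qed

definition morphism_family :: "(mi \<Rightarrow> 'a::supercomm_algebra ser) \<Rightarrow> bool" where
  "morphism_family r \<longleftrightarrow> triangular r \<and> (\<forall>M\<in>mis. homogeneous (wpar M) (r M)) \<and>
     (\<forall>J\<in>mis. \<forall>K\<in>mis. r J * r K = (if J + K \<in> mis then r (J + K) else 0))"

text \<open>Matrix entries of a coderivation multiply from the right, so it dualizes to an odd
  derivation acting from the right: the sign arises from passing \<open>x^K\<close>, and left
  coefficients pass without a sign.\<close>

definition derivation_family :: "(mi \<Rightarrow> 'a::supercomm_algebra ser) \<Rightarrow> bool" where
  "derivation_family r \<longleftrightarrow> triangular r \<and> (\<forall>M\<in>mis. homogeneous (1 + wpar M) (r M)) \<and>
     (\<forall>J\<in>mis. \<forall>K\<in>mis. (if J + K \<in> mis then r (J + K) else 0)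
        = ksign (wpar K) * (r J * mon K) + mon J * r K)"

lemma pullback_mult_mon:
  assumes r: "morphism_family r" and F: "cf 0 F = 0" and K: "K \<in> mis"
  shows "pullback r (F * mon K) = pullback r F * r K"
proof (rule lincont_ext[where q = 0, OF _ _ F])
  show "lincont 0 (\<lambda>F. pullback r (F * mon K))" 
    using lincont_comp[OF lincont_mult_right[OF lincont_id] lincont_pullback] by simp
  show "lincont 0 (\<lambda>F. pullback r F * r K)" by (rule lincont_mult_right[OF lincont_pullback])
  fix J assume J: "J \<in> mis"
  have t: "triangular r" using r by (simp add: morphism_family_def)
  show "pullback r (mon J * mon K) = pullback r (mon J) * r K"
    using r J K unfolding mon_mult pullback_mon[OF t J]
    by (auto simp: morphism_family_def pullback_mon mis_add_mi0 mon_not_mi0)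
qed

text \<open>Moving \<open>mon K\<close> to the right of F and \<open>r K\<close> to the right of
  \<open>pullback r F\<close> costs the same sign, as a morphism family preserves parity. This
  reduces the claim to multiplication from the right.\<close>

lemma pullback_mon_mult:
  assumes r: "morphism_family r" and F: "cf 0 F = 0" "homogeneous q F" and K: "K \<in> mis"
  shows "pullback r (mon K * F) = r K * pullback r F"
proof -
  have h: "homogeneous q (pullback r F)"
    using homogeneous_pullback[of 0 r q F] F(2) r by (simp add: morphism_family_def)
  have k: "homogeneous (wpar K) (r K)" using r K by (simp add: morphism_family_def)
  have s: "pullback r (ksign p * G) = ksign p * pullback r G" for p G
    by (simp add: ksign_def pullback_minus)
  show ?thesis
    unfolding homogeneous_commute[OF homogeneous_mon F(2)] homogeneous_commute[OF k h] s
    by (simp add: pullback_mult_mon[OF r F(1) K])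
qed

text \<open>Extended from monomials one factor at a time: G is a monomial while F varies, then G
  varies. In the second extension F stands to the left of the coefficients of G, so that linearity
  holds only up to the parity of F.\<close>

lemma pullback_derivation:
  assumes r: "derivation_family r" and F: "cf 0 F = 0" "homogeneous p F" and G: "cf 0 G = 0"
  shows "pullback r (F * G) = F * pullback r G + pullback r F * gsign 1 G"
proof -
  have t: "triangular r" using r by (simp add: derivation_family_def)
  have step: "pullback r (F * mon K) = F * pullback r (mon K) + pullback r F * gsign 1 (mon K)"
    if F: "cf 0 F = 0" and K: "K \<in> mis" for F K
  proof (rule lincont_ext[where q = 0, OF _ _ F])
    show "lincont 0 (\<lambda>F. pullback r (F * mon K))" 
      using lincont_comp[OF lincont_mult_right[OF lincont_id] lincont_pullback] by simp
    show "lincont 0 (\<lambda>F. F * pullback r (mon K) + pullback r F * gsign 1 (mon K))"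
      by (intro lincont_add lincont_mult_right lincont_pullback lincont_id)
    fix J assume J: "J \<in> mis"
    have "pullback r (mon (J + K)) = (if J + K \<in> mis then r (J + K) else 0)"
      using J K by (auto simp: pullback_mon[OF t] mis_add_mi0 mon_not_mi0)
    also have "\<dots> = mon J * r K + r J * (ksign (wpar K) * mon K)"
      using r J K by (cases "wpar K") (simp_all add: derivation_family_def add.commute)
    finally show "pullback r (mon J * mon K) = mon J * pullback r (mon K) + pullback r (mon J) * gsign 1 (mon K)"
      by (simp add: mon_mult pullback_mon[OF t] J K gsign_mon)
  qed
  show ?thesis
  proof (rule lincont_ext[where q = p, OF _ _ G])
    show "lincont p (\<lambda>G. pullback r (F * G))"
      using lincont_comp[OF lincont_mult_left[OF lincont_id F(2)] lincont_pullback] by simp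
    have "homogeneous (1 + p) (pullback r F)"
      using r by (intro homogeneous_pullback F) (simp add: derivation_family_def)
    then have "lincont (1 + p + (1 + 0)) (\<lambda>G. pullback r F * gsign 1 G)"
      by (intro lincont_mult_left lincont_gsign lincont_id)
    moreover have "1 + p + (1 + 0) = p" by (cases p) simp_all
    ultimately have "lincont p (\<lambda>G. pullback r F * gsign 1 G)" by simp
    moreover have "lincont p (\<lambda>G. F * pullback r G)"
      using lincont_mult_left[OF lincont_pullback F(2)] by simp
    ultimately show "lincont p (\<lambda>G. F * pullback r G + pullback r F * gsign 1 G)"
      by (rule lincont_add[rotated])
  qed (rule step[OF F(1)])
qed

subsection \<open>Coefficients in an ideal\<close>

definition ser_ideal :: "'a::supercomm_algebra set \<Rightarrow> 'a ser set" where
  "ser_ideal A = {F. \<forall>I. cf I F \<in> A}"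

lemma ser_ideal_iff: "graded_ideal A \<Longrightarrow> F \<in> ser_ideal A \<longleftrightarrow> (\<forall>I\<in>mi0. cf I F \<in> A)"
proof -
  assume "graded_ideal A"
  then have "cf I F \<in> A" if "I \<notin> mi0" for I
    using that by (simp add: cf_not_mi0 ideal_zero)
  then show ?thesis by (auto simp: ser_ideal_def)
qed

lemma graded_ideal_ser:
  assumes A: "graded_ideal A" shows "graded_ideal (ser_ideal A)"
proof -
  note [simp] = ser_ideal_iff[OF A]
  have "F * G \<in> ser_ideal A \<and> G * F \<in> ser_ideal A" if "F \<in> ser_ideal A" for F G
  proof -
    have f: "cf I F \<in> A" for I using that by (simp add: ser_ideal_def)
    have "cf P F * gsign p (cf Q G) \<in> A" "cf P G * gsign p (cf Q F) \<in> A" for p P Q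
      by (intro ideal_right[OF A] f) (intro ideal_left[OF A] ideal_gsign[OF A] f)
    then show ?thesis
      by (auto simp: cf_mult intro!: ideal_sum[OF A])
  qed
  moreover have "F + G \<in> ser_ideal A" if "F \<in> ser_ideal A" "G \<in> ser_ideal A" for F G
    using that by (simp add: cf_add ideal_add[OF A])
  moreover have "hcomp p F \<in> ser_ideal A" if "F \<in> ser_ideal A" for F p
    using that by (simp add: cf_hcomp ideal_hcomp[OF A])
  ultimately show ?thesis
    by (auto simp: graded_ideal_def is_ideal_def ideal_zero[OF A])
qed

abbreviation ser_power :: "nat \<Rightarrow> 'a::augmented_algebra ser set" where
  "ser_power n \<equiv> ser_ideal (aug_power n)"

abbreviation ser_max :: "'a::augmented_algebra ser set" where
  "ser_max \<equiv> ser_ideal aug_ideal"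

lemmas graded_ideal_ser_power = graded_ideal_ser[OF graded_ideal_aug_power]
  and graded_ideal_ser_max = graded_ideal_ser[OF graded_ideal_aug]

lemma ser_power_mult:
  assumes "F \<in> ser_max" "G \<in> ser_power n"
  shows "F * G \<in> ser_power (Suc n)" "G * F \<in> ser_power (Suc n)"
proof -
  have f: "cf I F \<in> aug_ideal" "cf I G \<in> aug_power n" for I
    using assms by (auto simp: ser_ideal_def)
  have g: "gsign p (cf I F) \<in> aug_ideal" "gsign p (cf I G) \<in> aug_power n" for p I
    using f ideal_gsign[OF graded_ideal_aug] ideal_gsign[OF graded_ideal_aug_power] by blast+
  show "F * G \<in> ser_power (Suc n)" "G * F \<in> ser_power (Suc n)"
    unfolding ser_ideal_iff[OF graded_ideal_aug_power]
    by (auto simp: cf_mult intro!: ideal_sum[OF graded_ideal_aug_power]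
        intro: aug_power_mult_left[OF f(1) g(2)] aug_power_mult_right[OF g(1) f(2)])
qed

lemma pullback_ideal_arg: "graded_ideal A \<Longrightarrow> F \<in> ser_ideal A \<Longrightarrow> pullback r F \<in> ser_ideal A"
  unfolding ser_ideal_iff
  by (auto simp: cf_pullback mis_upto_def mis_mi0 intro!: ideal_sum ideal_right)

lemma pullback_ideal_family:
  "graded_ideal A \<Longrightarrow> (\<And>K. K \<in> mis \<Longrightarrow> r K \<in> ser_ideal A) \<Longrightarrow> pullback r F \<in> ser_ideal A"
  unfolding ser_ideal_iff
  by (auto simp: cf_pullback mis_upto_def intro!: ideal_sum ideal_left)

text \<open>Arguments in the maximal ideal and rows in its n-th power combine to one power more.
  Together with the mirrored \<open>pullback_power_arg\<close> this is the source of the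
  linearizations modulo the next power.\<close>

lemma pullback_power_family:
  assumes F: "F \<in> ser_max" and r: "\<And>K. K \<in> mis \<Longrightarrow> r K \<in> ser_power n"
  shows "pullback r F \<in> ser_power (Suc n)"
proof -
  have "cf I F \<in> aug_ideal" for I using F by (simp add: ser_ideal_def)
  moreover have "cf I (r K) \<in> aug_power n" if "K \<in> mis" for I K using r[OF that] by (simp add: ser_ideal_def)
  ultimately show ?thesis
    unfolding ser_ideal_iff[OF graded_ideal_aug_power]
    by (auto simp: cf_pullback mis_upto_def
        intro!: ideal_sum[OF graded_ideal_aug_power] aug_power_mult_left)
qed

lemma pullback_power_arg:
  assumes F: "F \<in> ser_power n" and r: "\<And>K. K \<in> mis \<Longrightarrow> r K \<in> ser_max"
  shows "pullback r F \<in> ser_power (Suc n)"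
proof -
  have "cf I F \<in> aug_power n" for I using F by (simp add: ser_ideal_def)
  moreover have "cf I (r K) \<in> aug_ideal" if "K \<in> mis" for I K using r[OF that] by (simp add: ser_ideal_def)
  ultimately show ?thesis
    unfolding ser_ideal_iff[OF graded_ideal_aug_power]
    by (auto simp: cf_pullback mis_upto_def
        intro!: ideal_sum[OF graded_ideal_aug_power] aug_power_mult_right)
qed

section \<open>Rows of coalgebra maps\<close>

text \<open>\<open>row T M\<close> is the pullback under \<open>T\<close> of the function \<open>x^M\<close>. The factor \<open>M!/I!\<close>
  passes from the basis \<open>w_M\<close> to the basis dual to the monomials \<open>x^M\<close>, which removes all binomial
  coefficients.\<close>

definition row :: "'a::supercomm_algebra smap \<Rightarrow> mi \<Rightarrow> 'a ser" where
  "row T M = mk (\<lambda>I. (of_nat (mfact M) / of_nat (mfact I)) *\<^sub>C T I M)"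

text \<open>Inverse to \<open>row\<close> on triangular families.\<close>

definition smap_of :: "(mi \<Rightarrow> 'a::supercomm_algebra ser) \<Rightarrow> 'a smap" where
  "smap_of r I M = (if I \<in> mis \<and> M \<in> mis
     then (of_nat (mfact I) / of_nat (mfact M)) *\<^sub>C cf I (r M) else 0)"

lemma mfact_nonzero [simp]: "mfact I \<noteq> 0"
  by (cases I) simp

lemma mbinom_mfact: "mbinom (P + Q) P * (mfact P * mfact Q) = mfact (P + Q)"
proof -
  have *: "(a + b choose a) * (fact a * fact b) = (fact (a + b) :: nat)" for a b
    using binomial_fact_lemma[of a "a + b"] by (simp add: algebra_simps)
  show ?thesis
    by (cases P; cases Q) (simp flip: *)
qed

lemma mbinom_eq:
  "of_nat (mbinom (P + Q) P) = (of_nat (mfact (P + Q)) / (of_nat (mfact P) * of_nat (mfact Q)) :: complex)"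
  by (simp add: field_simps flip: mbinom_mfact of_nat_mult)

lemma endos_support: "T \<in> endos \<Longrightarrow> I \<notin> mis \<or> M \<notin> mis \<Longrightarrow> T I M = 0"
  by (auto simp: endos_def)

lemma cf_row: "I \<in> mi0 \<Longrightarrow> cf I (row T M) = (of_nat (mfact M) / of_nat (mfact I)) *\<^sub>C T I M"
  by (simp add: row_def cf_mk)

lemma cf_0_row: "T \<in> endos \<Longrightarrow> cf 0 (row T M) = 0"
  by (simp add: cf_row endos_support[of T 0] mis_eq)

lemma row_smap_of: "M \<in> mis \<Longrightarrow> cf 0 (r M) = 0 \<Longrightarrow> row (smap_of r) M = r M"
  by (rule ser_eqI) (auto simp: cf_row smap_of_def mis_eq scaleC_scaleC scaleC_one)

lemma smap_eqI:
  assumes "T \<in> endos" "U \<in> endos" "\<And>M. M \<in> mis \<Longrightarrow> row T M = row U M"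
  shows "T = U"
proof (intro ext)
  fix I M
  show "T I M = U I M"
  proof (cases "I \<in> mis \<and> M \<in> mis")
    case True
    then have "cf I (row T M) = cf I (row U M)" using assms(3) by simp
    then show ?thesis using True by (simp add: cf_row mis_mi0 scaleC_cancel)
  qed (use assms in \<open>auto simp: endos_support\<close>)
qed

lemma smap_of_endos: "triangular r \<Longrightarrow> smap_of r \<in> endos"
proof -
  assume "triangular r"
  then have "{M. smap_of r I M \<noteq> 0} \<subseteq> {M. deg M \<le> deg I}" for I
    by (auto simp: smap_of_def triangular_def not_less[symmetric] split: if_splits)
  then have "finite {M. smap_of r I M \<noteq> 0}" for I
    by (rule finite_subset) simp
  moreover have "smap_of r I M \<noteq> 0 \<Longrightarrow> I \<in> mis \<and> M \<in> mis" for I M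
    by (simp add: smap_of_def split: if_splits)
  ultimately show ?thesis unfolding endos_def by blast
qed

lemma row_add: "row (T + U) M = row T M + row U M"
  by (rule ser_eqI) (simp add: cf_row cf_add scaleC_add_right)

lemma triangular_row: "T \<in> endos \<Longrightarrow> triangular (row T) \<Longrightarrow> T I M \<noteq> 0 \<Longrightarrow> M \<in> mis_upto (deg I)"
proof -
  assume T: "T \<in> endos" "triangular (row T)" and nz: "T I M \<noteq> 0"
  have m: "I \<in> mis" "M \<in> mis" using nz endos_support[OF T(1)] by blast+
  have "deg M \<le> deg I"
  proof (rule ccontr)
    assume "\<not> deg M \<le> deg I"
    then have "cf I (row T M) = 0" using T(2) m by (simp add: triangular_def)
    then show False using nz m by (simp add: cf_row mis_mi0)
  qed
  then show ?thesis using m by (simp add: mis_upto_def)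
qed

text \<open>Pulling functions back reverses composition. Triangularity of U restricts the
  intermediate indices to those that \<open>pullback\<close> keeps.\<close>

lemma row_comp:
  assumes T: "T \<in> endos" and U: "U \<in> endos" "triangular (row U)"
  shows "row (smap_comp T U) M = pullback (row U) (row T M)"
proof (rule ser_eqI)
  fix I assume I: "I \<in> mi0"
  have "smap_comp T U I M = (\<Sum>K\<in>mis_upto (deg I). T K M * U I K)"
    unfolding smap_comp_def
    by (rule sum.mono_neutral_left[OF finite_mis_upto]) (use triangular_row[OF U] in blast, simp)
  then have "cf I (row (smap_comp T U) M)
      = (\<Sum>K\<in>mis_upto (deg I). (of_nat (mfact M) / of_nat (mfact I)) *\<^sub>C (T K M * U I K))"
    by (simp add: cf_row I scaleC_sum_right)
  also have "\<dots> = cf I (pullback (row U) (row T M))"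
    unfolding cf_pullback[OF I]
    by (rule sum.cong)
      (auto simp: cf_row I mis_upto_def mis_mi0 scaleC_mult_left scaleC_mult_right scaleC_scaleC)
  finally show "cf I (row (smap_comp T U) M) = cf I (pullback (row U) (row T M))" .
qed

lemma row_id: "M \<in> mis \<Longrightarrow> row id_smap M = mon M"
  by (rule ser_eqI) (auto simp: cf_row id_smap_def cf_mon mis_eq scaleC_one)

lemma id_endos: "id_smap \<in> endos"
  by (auto simp: endos_def id_smap_def split: if_splits)

lemma has_parity_row:
  assumes "has_parity p T" shows "homogeneous (p + wpar M) (row T M)"
proof -
  have "homogeneous (p + wpar M + wpar I) (T I M)" for I
    using assms unfolding has_parity_def by (metis add.commute add.left_commute)
  then show ?thesis
    by (auto simp: homogeneous_iff_cf cf_row intro: homogeneous_scaleC)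
qed

lemma has_parity_smap_of:
  assumes "\<And>M. M \<in> mis \<Longrightarrow> homogeneous (p + wpar M) (r M)" shows "has_parity p (smap_of r)"
proof -
  have "homogeneous (p + wpar I + wpar M) (cf I (r M))" if "M \<in> mis" for I M
    using homogeneous_cf[OF assms[OF that], of I] by (metis add.commute add.left_commute)
  then show ?thesis
    by (auto simp: has_parity_def smap_of_def intro: homogeneous_scaleC)
qed

lemma has_parity_id: "has_parity 0 id_smap"
  by (auto simp: has_parity_def id_smap_def)

subsection \<open>The coproduct in terms of rows\<close>

text \<open>In the normalization of \<open>row\<close>, the binomial coefficient of the coproduct
  becomes I!/(J! K!). The same factor arises in \<open>before_comul_row\<close>, so it cancels in
  the axioms.\<close>

lemma comul_after_row:
  assumes T: "T \<in> endos" and I: "I \<in> mis" and JK: "J \<in> mis" "K \<in> mis"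
  shows "comul_after T I (J, K) = (of_nat (mfact I) / (of_nat (mfact J) * of_nat (mfact K)))
    *\<^sub>C cf I (if J + K \<in> mis then row T (J + K) else 0)"
proof -
  have fin: "finite {M. T I M \<noteq> 0}" using T by (simp add: endos_def)
  have "comul_after T I (J, K) = (\<Sum>M | T I M \<noteq> 0. if M = J + K
      then of_nat (if J + K \<in> mis then mbinom (J + K) J else 0) * T I (J + K) else 0)"
    unfolding comul_after_def by (rule sum.cong) (auto simp: comul_def JK)
  also have "\<dots> = of_nat (if J + K \<in> mis then mbinom (J + K) J else 0) * T I (J + K)"
    by (simp add: fin)
  also have "\<dots> = of_nat (if J + K \<in> mis then mbinom (J + K) J else 0) *\<^sub>C T I (J + K)"
    by (simp only: scaleC_of_nat)
  finally show ?thesis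
    by (simp add: cf_row I mis_mi0 scaleC_scaleC mbinom_eq)
qed

lemma ksign_mult: "ksign p * (ksign q * x) = ksign (p + q) * (x :: 'a::ring_1)"
  by (cases p; cases q) simp_all

lemma ksign_commute: "x * ksign p = ksign p * (x :: 'a::ring_1)"
  by (cases p) simp_all

lemma wpar_splits: "I \<in> mi0 \<Longrightarrow> (P, Q) \<in> splits I \<Longrightarrow> wpar P * wpar Q = 0"
proof -
  assume I: "I \<in> mi0" "(P, Q) \<in> splits I"
  obtain p p' p'' q q' q'' where [simp]: "P = (p, p', p'')" "Q = (q, q', q'')"
    by (cases P; cases Q)
  have "p = 0 \<or> q = 0" using I by (auto simp: splits_def mi0_iff)
  then show ?thesis by (auto simp: wpar.simps)
qed

text \<open>The signs in \<open>tensor\<close> that depend on the splitting of I are those of the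
  product of series in \<open>cf_mult\<close>. The remaining sign depends only on J, K and the
  parity of T.\<close>

lemma before_comul_row:
  assumes T: "T \<in> endos" "has_parity t T" and U: "U \<in> endos" "has_parity u U" and I: "I \<in> mis"
  shows "before_comul (tensor u T U) I (J, K)
    = (of_nat (mfact I) / (of_nat (mfact J) * of_nat (mfact K)))
      *\<^sub>C (ksign (wpar K * (t + wpar J)) * cf I (row T J * row U K))"
proof -
  have "before_comul (tensor u T U) I (J, K)
      = (\<Sum>PQ\<in>splits I. tensor u T U PQ (J, K) * of_nat (comul I PQ))"
    unfolding before_comul_def
    by (rule sum.mono_neutral_left[OF finite_splits]) (auto simp: comul_def splits_def split: if_splits)
  also have "\<dots> = (\<Sum>(P, Q)\<in>splits I.
      (of_nat (mfact I) / (of_nat (mfact J) * of_nat (mfact K)))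
      *\<^sub>C (ksign (wpar K * (t + wpar J)) * (cf P (row T J) * gsign (wpar P) (cf Q (row U K)))))"
  proof (rule sum.cong[OF refl], rename_tac x, case_tac x)
    fix x P Q assume x: "x \<in> splits I" "x = (P, Q)"
    then have PQ: "I = P + Q" by (simp add: splits_def)
    have m0: "P \<in> mi0" "Q \<in> mi0" using I PQ mi0_add mis_mi0 by blast+
    have pq: "wpar P * wpar Q = 0" using wpar_splits[of I P Q] I x mis_mi0 by blast
    show "tensor u T U x (J, K) * of_nat (comul I x) = (case x of (P, Q) \<Rightarrow>
      (of_nat (mfact I) / (of_nat (mfact J) * of_nat (mfact K)))
      *\<^sub>C (ksign (wpar K * (t + wpar J)) * (cf P (row T J) * gsign (wpar P) (cf Q (row U K)))))"
    proof (cases "P \<in> mis \<and> Q \<in> mis")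
      case True
      have hT: "homogeneous (t + wpar P + wpar J) (T P J)"
        and hU: "homogeneous (u + wpar Q + wpar K) (U Q K)"
        using T(2) U(2) by (auto simp: has_parity_def)
      have g: "gsign (wpar K) (T P J) = ksign (wpar K * (t + wpar P + wpar J)) * T P J"
        "gsign (wpar P) (U Q K) = ksign (wpar P * (u + wpar Q + wpar K)) * U Q K"
        by (intro gsign_homogeneous hT hU)+
      \<comment> \<open>The two exponents differ by \<open>wpar P * wpar Q\<close>, which is 0
        because \<xi> cannot occur in both P and Q.\<close>
      have b: "u * wpar P + wpar K * (t + wpar P + wpar J)
          = wpar K * (t + wpar J) + wpar P * (u + wpar Q + wpar K)"
        using pq by (cases "wpar P"; cases "wpar Q"; cases "wpar K"; cases u) 
          (simp_all add: add_ac)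
      have "tensor u T U x (J, K) * of_nat (comul I x)
          = of_nat (mbinom I P) *\<^sub>C (ksign (u * wpar P + wpar K * (t + wpar P + wpar J)) * (T P J * U Q K))"
        using True I PQ x unfolding scaleC_of_nat
        by (simp add: tensor_def comul_def g ksign_mult mult.assoc flip: mult_of_nat_commute)
      also have "\<dots> = of_nat (mbinom I P)
          *\<^sub>C (ksign (wpar K * (t + wpar J)) * (T P J * gsign (wpar P) (U Q K)))"
        unfolding b g(2) 
        by (simp add: ksign_commute[of "T P J"] ksign_mult flip: mult.assoc)
      finally show ?thesis
        by (simp add: x cf_row m0 PQ mbinom_eq gsign_scaleC scaleC_mult_left scaleC_mult_right
            scaleC_scaleC field_simps)
    next
      case False
      then have "T P J = 0 \<or> U Q K = 0" "comul I x = 0"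
        using endos_support[OF T(1), of P J] endos_support[OF U(1), of Q K] x by (auto simp: comul_def)
      then show ?thesis using m0 by (auto simp: x cf_row)
    qed
  qed
  also have "\<dots> = (of_nat (mfact I) / (of_nat (mfact J) * of_nat (mfact K)))
      *\<^sub>C (ksign (wpar K * (t + wpar J)) * cf I (row T J * row U K))"
    unfolding cf_mult[OF mis_mi0[OF I]] sum_distrib_left scaleC_sum_right
    by (rule sum.cong) auto
  finally show ?thesis .
qed

lemma cf_ksign_mult: "cf I (ksign p * F) = ksign p * cf I F"
  by (cases p) (simp_all add: cf_minus)

lemma ser_eq_mis:
  assumes "cf 0 F = 0" "cf 0 G = 0" "\<And>I. I \<in> mis \<Longrightarrow> cf I F = cf I G" shows "F = G"
  by (rule ser_eqI) (metis assms mis_eq DiffI singletonD)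

lemma cf_0_mult: "cf 0 (F * G) = cf 0 F * cf 0 G"
proof -
  have "splits 0 = {(0, 0)}" by (auto simp: splits_def zero_mi)
  then show ?thesis by (simp add: cf_mult)
qed

text \<open>Common to the axioms of morphisms and of coderivations: F is the side computed with
  \<open>tensor\<close>, and G the expression in products of rows that it amounts to once the
  factorials are cancelled.\<close>

lemma comul_eq_iff:
  assumes T: "T \<in> endos" and F: "\<And>I J K. I \<notin> mis \<or> J \<notin> mis \<or> K \<notin> mis \<Longrightarrow> F I (J, K) = 0"
    "\<And>I J K. I \<in> mis \<Longrightarrow> J \<in> mis \<Longrightarrow> K \<in> mis \<Longrightarrow> F I (J, K)
      = (of_nat (mfact I) / (of_nat (mfact J) * of_nat (mfact K))) *\<^sub>C cf I (G J K)"
    and G: "\<And>J K. J \<in> mis \<Longrightarrow> K \<in> mis \<Longrightarrow> cf 0 (G J K) = 0"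
  shows "comul_after T = F
    \<longleftrightarrow> (\<forall>J\<in>mis. \<forall>K\<in>mis. (if J + K \<in> mis then row T (J + K) else 0) = G J K)"
proof
  assume e: "comul_after T = F"
  show "\<forall>J\<in>mis. \<forall>K\<in>mis. (if J + K \<in> mis then row T (J + K) else 0) = G J K"
  proof (intro ballI)
    fix J K :: mi assume JK: "J \<in> mis" "K \<in> mis"
    show "(if J + K \<in> mis then row T (J + K) else 0) = G J K"
    proof (rule ser_eq_mis)
      fix I assume I: "I \<in> mis"
      show "cf I (if J + K \<in> mis then row T (J + K) else 0) = cf I (G J K)"
        using fun_cong[OF fun_cong[OF e], of I "(J, K)"]
        unfolding comul_after_row[OF T I JK] F(2)[OF I JK] by (simp add: scaleC_cancel)
    qed (use T G JK in \<open>auto simp: cf_0_row\<close>)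
  qed
next
  assume e: "\<forall>J\<in>mis. \<forall>K\<in>mis. (if J + K \<in> mis then row T (J + K) else 0) = G J K"
  show "comul_after T = F"
  proof (intro ext, rename_tac I JK, case_tac JK)
    fix I J K and JK :: "mi \<times> mi" assume JK: "JK = (J, K)"
    show "comul_after T I JK = F I JK"
    proof (cases "I \<in> mis \<and> J \<in> mis \<and> K \<in> mis")
      case True
      then show ?thesis using e comul_after_row[OF T, of I J K] F(2)[of I J K] by (simp add: JK)
    next
      case False
      then have "of_nat (comul M JK) * T I M = 0" for M
        using endos_support[OF T, of I M] by (cases "I \<in> mis") (auto simp: JK comul_def)
      then show ?thesis using False F(1)[of I J K] by (auto simp: comul_after_def JK)
    qed
  qed
qed

lemma before_comul_not_mis:
  assumes "T \<in> endos" "U \<in> endos" "I \<notin> mis \<or> J \<notin> mis \<or> K \<notin> mis"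
  shows "before_comul (tensor u T U) I (J, K) = 0"
proof -
  have "tensor u T U PQ (J, K) * of_nat (comul I PQ) = 0" for PQ
  proof -
    obtain P Q where "PQ = (P, Q)" by (rule prod.exhaust)
    then show ?thesis
      using assms(3) endos_support[OF assms(1), of P J] endos_support[OF assms(2), of Q K]
      by (auto simp: tensor_def comul_def)
  qed
  then show ?thesis by (simp add: before_comul_def)
qed

lemma before_comul_add: "before_comul (F + G) I JK = before_comul F I JK + before_comul G I JK"
  by (simp add: before_comul_def algebra_simps sum.distrib)

text \<open>Coalgebra maps dualize to algebra maps. The sign left over from
  \<open>before_comul_row\<close> is nontrivial only if J and K are both odd; then
  \<open>J + K\<close> is outside \<open>mis\<close>, the other side is 0, and the sign does not
  affect the equation.\<close>

lemma coalgebra_map_iff: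
  assumes g: "g \<in> endos" "has_parity 0 g"
  shows "comul_after g = before_comul (tensor 0 g g) \<longleftrightarrow>
    (\<forall>J\<in>mis. \<forall>K\<in>mis. row g J * row g K = (if J + K \<in> mis then row g (J + K) else 0))"
proof -
  have "comul_after g = before_comul (tensor 0 g g) \<longleftrightarrow> (\<forall>J\<in>mis. \<forall>K\<in>mis.
      (if J + K \<in> mis then row g (J + K) else 0) = ksign (wpar K * (0 + wpar J)) * (row g J * row g K))"
    by (rule comul_eq_iff[OF g(1)], erule before_comul_not_mis[OF g(1) g(1)])
      (simp_all add: before_comul_row[OF g g] cf_ksign_mult cf_0_mult cf_0_row[OF g(1)])
  also have "\<dots> \<longleftrightarrow>
    (\<forall>J\<in>mis. \<forall>K\<in>mis. row g J * row g K = (if J + K \<in> mis then row g (J + K) else 0))"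
  proof (intro ball_cong refl)
    fix J K :: mi assume JK: "J \<in> mis" "K \<in> mis"
    have n: "0 = - x \<longleftrightarrow> x = 0" for x :: "'a ser" by (metis neg_equal_0_iff_equal)
    show "((if J + K \<in> mis then row g (J + K) else 0) = ksign (wpar K * (0 + wpar J)) * (row g J * row g K))
      = (row g J * row g K = (if J + K \<in> mis then row g (J + K) else 0))"
      using mis_add[OF JK] by (cases "wpar J"; cases "wpar K") (simp_all add: n eq_commute[of "row g (J + K)"])
  qed
  finally show ?thesis .
qed

text \<open>Coderivations dualize to derivations. If J and K are both odd, the computed right side
  is the negative of the stated one; both equations then say that it vanishes.\<close>

lemma coderivation_iff:
  assumes T: "T \<in> endos" "has_parity 1 T"
  shows "comul_after T = before_comul (tensor 0 T id_smap + tensor 1 id_smap T) \<longleftrightarrow>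
    (\<forall>J\<in>mis. \<forall>K\<in>mis. (if J + K \<in> mis then row T (J + K) else 0)
        = ksign (wpar K) * (row T J * mon K) + mon J * row T K)"
proof -
  have "comul_after T = before_comul (tensor 0 T id_smap + tensor 1 id_smap T) \<longleftrightarrow> (\<forall>J\<in>mis. \<forall>K\<in>mis.
      (if J + K \<in> mis then row T (J + K) else 0) = ksign (wpar K * (1 + wpar J)) * (row T J * mon K)
        + ksign (wpar K * (0 + wpar J)) * (mon J * row T K))"
  proof (rule comul_eq_iff[OF T(1)])
    fix I J K
    show "before_comul (tensor 0 T id_smap + tensor 1 id_smap T) I (J, K) = 0"
      if "I \<notin> mis \<or> J \<notin> mis \<or> K \<notin> mis"
      unfolding before_comul_add before_comul_not_mis[OF T(1) id_endos that]
        before_comul_not_mis[OF id_endos T(1) that] by simp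
    assume JK: "J \<in> mis" "K \<in> mis"
    show "cf 0 (ksign (wpar K * (1 + wpar J)) * (row T J * mon K)
        + ksign (wpar K * (0 + wpar J)) * (mon J * row T K)) = 0"
      by (simp add: cf_add cf_ksign_mult cf_0_mult cf_0_row[OF T(1)])
    assume I: "I \<in> mis"
    show "before_comul (tensor 0 T id_smap + tensor 1 id_smap T) I (J, K)
      = (of_nat (mfact I) / (of_nat (mfact J) * of_nat (mfact K))) *\<^sub>C
        cf I (ksign (wpar K * (1 + wpar J)) * (row T J * mon K)
          + ksign (wpar K * (0 + wpar J)) * (mon J * row T K))"
      unfolding before_comul_add before_comul_row[OF T id_endos has_parity_id I]
        before_comul_row[OF id_endos has_parity_id T I] row_id[OF JK(1)] row_id[OF JK(2)]
      by (simp only: cf_add cf_ksign_mult scaleC_add_right)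
  qed
  also have "\<dots> \<longleftrightarrow> (\<forall>J\<in>mis. \<forall>K\<in>mis. (if J + K \<in> mis then row T (J + K) else 0)
        = ksign (wpar K) * (row T J * mon K) + mon J * row T K)"
  proof (intro ball_cong refl)
    fix J K :: mi assume JK: "J \<in> mis" "K \<in> mis"
    show "((if J + K \<in> mis then row T (J + K) else 0) = ksign (wpar K * (1 + wpar J)) * (row T J * mon K)
        + ksign (wpar K * (0 + wpar J)) * (mon J * row T K)) =
      ((if J + K \<in> mis then row T (J + K) else 0) = ksign (wpar K) * (row T J * mon K) + mon J * row T K)"
      using mis_add[OF JK] by (cases "wpar J"; cases "wpar K") (auto simp: eq_neg_iff_add_eq_0 algebra_simps)
  qed
  finally show ?thesis .
qed

text \<open>Every index arises from the three coordinates by sums that stay in \<open>mis\<close>.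
  Properties that pass through a product or Leibniz rule thus need a check on the coordinates
  only.\<close>

lemma mis_induct [consumes 1]:
  assumes "M \<in> mis" "P (1, 0, 0)" "P (0, 1, 0)" "P (0, 0, 1)"
    "\<And>J K. J \<in> mis \<Longrightarrow> K \<in> mis \<Longrightarrow> J + K \<in> mis \<Longrightarrow> P J \<Longrightarrow> P K \<Longrightarrow> P (J + K)"
  shows "P M"
proof -
  have z: "P (0, 0, Suc c)" for c
  proof (induction c)
    case (Suc c)
    then show ?case using assms(5)[of "(0, 0, 1)" "(0, 0, Suc c)"] assms(4) by (simp add: mis_iff zero_mi)
  qed (use assms(4) in simp)
  have yz: "P (0, Suc b, c)" for b c
  proof (induction b)
    case 0
    then show ?case using assms(5)[of "(0, 1, 0)" "(0, 0, c)"] assms(3) z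
      by (cases c) (simp_all add: mis_iff zero_mi)
  next
    case (Suc b)
    then show ?case using assms(5)[of "(0, 1, 0)" "(0, Suc b, c)"] assms(3) by (simp add: mis_iff zero_mi)
  qed
  have e: "P (0, b, c)" if "(0, b, c) \<in> mis" for b c
    using that z yz by (cases b; cases c) (auto simp: mis_iff zero_mi)
  obtain a b c where M: "M = (a, b, c)" by (cases M)
  consider "a = 0" | "M = (1, 0, 0)" | "a = 1" "(0, b, c) \<in> mis"
    using assms(1) unfolding M mis_iff zero_mi by (cases "a = 0"; cases "b = 0 \<and> c = 0") auto
  then show ?thesis
    using e assms(1,2) assms(5)[of "(1, 0, 0)" "(0, b, c)"]
    by cases (auto simp: M mis_iff zero_mi)
qed

lemma order_mult:
  assumes "\<And>I. deg I < m \<Longrightarrow> cf I F = 0"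
    "\<And>I. deg I < n \<Longrightarrow> cf I G = 0" "deg I < m + n"
  shows "cf I (F * G) = 0"
proof (cases "I \<in> mi0")
  case True
  have "cf P F * gsign (wpar P) (cf Q G) = 0" if "(P, Q) \<in> splits I" for P Q
  proof -
    have "deg I = deg P + deg Q" using that by (auto simp: splits_def deg_add)
    then show ?thesis using assms by (cases "deg P < m") auto
  qed
  then show ?thesis unfolding cf_mult[OF True] by (intro sum.neutral) auto
qed (rule cf_not_mi0)

lemma order_mon: "deg I < deg K \<Longrightarrow> cf I (mon K) = 0"
  by (auto simp: cf_mon)

lemma order_1: "cf 0 F = 0 \<Longrightarrow> deg I < 1 \<Longrightarrow> cf I F = 0"
  by (simp add: deg_eq_0)

lemma deg_units: "deg (1, 0, 0) = 1" "deg (0, 1, 0) = 1" "deg (0, 0, 1) = 1"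
  "deg (Suc 0, 0, 0) = 1" "deg (0, Suc 0, 0) = 1" "deg (0, 0, Suc 0) = 1"
  by (simp_all add: deg.simps)

text \<open>\<open>endos\<close> demands finiteness but no degree bound. The bound comes from the
  product structure: images of coordinates have no constant term, and orders of vanishing add under
  multiplication.\<close>

lemma triangular_induct:
  assumes "cf 0 (r (1, 0, 0)) = 0" "cf 0 (r (0, 1, 0)) = 0" "cf 0 (r (0, 0, 1)) = 0"
    and "\<And>J K I. J \<in> mis \<Longrightarrow> K \<in> mis \<Longrightarrow> J + K \<in> mis \<Longrightarrow> (\<And>I. deg I < deg J \<Longrightarrow> cf I (r J) = 0) \<Longrightarrow>
      (\<And>I. deg I < deg K \<Longrightarrow> cf I (r K) = 0) \<Longrightarrow> deg I < deg J + deg K \<Longrightarrow> cf I (r (J + K)) = 0"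
  shows "triangular r"
  unfolding triangular_def
proof
  fix M assume "M \<in> mis"
  then show "\<forall>I. deg I < deg M \<longrightarrow> cf I (r M) = 0"
  proof (induction rule: mis_induct)
    case (4 J K)
    show ?case unfolding deg_add by (intro allI impI assms(4)) (use 4 in auto)
  qed (use assms(1-3) order_1 in \<open>auto simp: deg_units\<close>)
qed

lemma morphism_family_row:
  assumes g: "g \<in> endos" "has_parity 0 g" "comul_after g = before_comul (tensor 0 g g)"
  shows "morphism_family (row g)"
proof -
  have m: "row g J * row g K = (if J + K \<in> mis then row g (J + K) else 0)"
    if "J \<in> mis" "K \<in> mis" for J K
    using that coalgebra_map_iff[OF g(1,2)] g(3) by blast
  have "triangular (row g)"
  proof (rule triangular_induct)
    fix J K I :: mi
    assume h: "J \<in> mis" "K \<in> mis" "J + K \<in> mis"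
      "\<And>I. deg I < deg J \<Longrightarrow> cf I (row g J) = 0"
      "\<And>I. deg I < deg K \<Longrightarrow> cf I (row g K) = 0" "deg I < deg J + deg K"
    have "cf I (row g J * row g K) = 0" by (rule order_mult[OF h(4-6)])
    then show "cf I (row g (J + K)) = 0" using m[OF h(1,2)] h(3) by simp
  qed (simp_all add: cf_0_row g)
  then show ?thesis
    using m has_parity_row[OF g(2)] by (simp add: morphism_family_def)
qed

lemma derivation_family_row:
  assumes T: "coderivation 1 T"
  shows "derivation_family (row T)"
proof -
  have e: "T \<in> endos" "has_parity 1 T" using T by (auto simp: coderivation_def)
  have m: "(if J + K \<in> mis then row T (J + K) else 0) = ksign (wpar K) * (row T J * mon K) + mon J * row T K"
    if "J \<in> mis" "K \<in> mis" for J K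
    using that coderivation_iff[OF e] T by (auto simp: coderivation_def)
  have "triangular (row T)"
  proof (rule triangular_induct)
    fix J K I :: mi
    assume h: "J \<in> mis" "K \<in> mis" "J + K \<in> mis"
      "\<And>I. deg I < deg J \<Longrightarrow> cf I (row T J) = 0"
      "\<And>I. deg I < deg K \<Longrightarrow> cf I (row T K) = 0" "deg I < deg J + deg K"
    have "cf I (row T J * mon K) = 0" "cf I (mon J * row T K) = 0"
      by (rule order_mult[OF h(4) order_mon h(6)] order_mult[OF order_mon h(5) h(6)]; assumption)+
    then show "cf I (row T (J + K)) = 0" using m[OF h(1,2)] h(3) by (simp add: cf_add cf_ksign_mult)
  qed (simp_all add: cf_0_row e)
  then show ?thesis
    using m has_parity_row[OF e(2)] by (simp add: derivation_family_def)
qed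

lemma coderivation_smap_of:
  assumes "derivation_family r" shows "coderivation 1 (smap_of r)"
proof -
  have t: "triangular r" using assms by (simp add: derivation_family_def)
  have r: "row (smap_of r) M = r M" if "M \<in> mis" for M
    using that triangular_cf_0[OF t that] by (rule row_smap_of)
  have e: "smap_of r \<in> endos" "has_parity 1 (smap_of r)"
    using assms by (auto intro!: smap_of_endos has_parity_smap_of simp: derivation_family_def)
  show ?thesis
    unfolding coderivation_def coderivation_iff[OF e] using e assms r unfolding derivation_family_def
    by (smt (verit))
qed

lemma coalgebra_map_smap_of:
  assumes "morphism_family r"
  shows "smap_of r \<in> endos" "has_parity 0 (smap_of r)"
    "comul_after (smap_of r) = before_comul (tensor 0 (smap_of r) (smap_of r))" (is ?goal1)
proof -
  have t: "triangular r" using assms by (simp add: morphism_family_def)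
  have r: "row (smap_of r) M = r M" if "M \<in> mis" for M
    using that triangular_cf_0[OF t that] by (rule row_smap_of)
  show e: "smap_of r \<in> endos" "has_parity 0 (smap_of r)"
    using assms by (auto intro!: smap_of_endos has_parity_smap_of simp: morphism_family_def)
  show ?goal1
    unfolding coalgebra_map_iff[OF e] using assms by (simp add: r morphism_family_def)
qed

section \<open>The universal family\<close>

fun idx :: "nat \<Rightarrow> mi \<Rightarrow> nat" where
  "idx j (a, b, c) = (if j = 1 then a else if j = 2 then b else c)"

declare idx.simps [simp del]

lemma unit_mi_eq [simp]: "unit_mi 1 = (1, 0, 0)" "unit_mi (Suc 0) = (1, 0, 0)"
  "unit_mi 2 = (0, 1, 0)" "unit_mi 3 = (0, 0, 1)"
  by (simp_all add: unit_mi_def)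

lemma atLeastAtMost_1_3: "{1..3} = {1, 2, 3 :: nat}"
  by auto

lemma unit_split:
  assumes j: "j \<in> {1..3}"
  shows "idx j M = 0 \<Longrightarrow> M \<noteq> unit_mi j + K"
    and "idx j M \<noteq> 0 \<Longrightarrow> M = unit_mi j + (M - unit_mi j)"
    and "mfact (unit_mi j + K) = idx j (unit_mi j + K) * mfact K" (is ?goal1)
    and "unit_mi j + K - unit_mi j = K"
proof -
  obtain m1 m2 m3 k1 k2 k3 where [simp]: "M = (m1, m2, m3)" "K = (k1, k2, k3)"
    by (cases M; cases K)
  have j: "j = 1 \<or> j = 2 \<or> j = 3" using j by auto
  then show "idx j M = 0 \<Longrightarrow> M \<noteq> unit_mi j + K"
    "idx j M \<noteq> 0 \<Longrightarrow> M = unit_mi j + (M - unit_mi j)"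
    "unit_mi j + K - unit_mi j = K"
    by (elim disjE; simp add: idx.simps)+
  show ?goal1
    using j by (elim disjE; simp add: idx.simps algebra_simps)
qed

lemma cst_mult: "cst a * cst b = cst (a * b)"
  by (rule ser_eqI) (simp add: cf_cst_mult cf_cst)

lemma cst_diff: "cst (a - b) = cst a - cst b"
  by (rule ser_eqI) (simp add: cf_diff cf_cst)

lemma cst_minus: "cst (- a) = - cst a"
  by (rule ser_eqI) (simp add: cf_minus cf_cst)

lemma cst_zero [simp]: "cst 0 = 0"
  by (rule ser_eqI) (simp add: cf_cst)

lemma cst_scaleC_one_mult: "cst (r *\<^sub>C 1) * F = r *\<^sub>C F"
  by (rule ser_eqI) (simp add: cf_cst_mult cf_scaleC scaleC_mult_left)

lemma mon_cst: "mon M * cst b = cst (gsign (wpar M) b) * mon M"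
  using homogeneous_move[OF homogeneous_mon, of M "cst b"] by (simp add: gsign_cst)

lemma homogeneous_cst: "homogeneous p b \<Longrightarrow> homogeneous p (cst b)"
  by (auto simp: homogeneous_iff_cf cf_cst)

lemma phi_support: "I' \<notin> mis \<or> M \<notin> mis \<Longrightarrow> phi I j a I' M = 0"
  by (auto simp: phi_def coder_def)

text \<open>Among the splittings of I' in \<open>coder\<close>, at most the one whose first part is
  I and whose second part is M with \<open>w_j\<close> removed contributes.\<close>

lemma phi_entry:
  assumes I: "I \<in> mis" "I' \<in> mis" "M \<in> mis" and j: "j \<in> {1..3}"
  shows "phi I j a I' M = (if \<exists>K. I' = I + K \<and> M = unit_mi j + K
    then of_nat (mbinom I' I * mfact I) * gsign (wpar (M - unit_mi j)) (gsign (wpar I) a) else 0)"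
proof -
  let ?t = "of_nat (mbinom I' I * mfact I) * gsign (wpar (M - unit_mi j)) (gsign (wpar I) a)"
  have g: "gsign p (of_nat n * x) = of_nat n * gsign p x" for p n and x :: 'a
    by (simp only: scaleC_of_nat[symmetric] gsign_scaleC)
  have fin: "finite {(J, K). J \<in> mis \<and> J + K = I'}"
    by (rule finite_subset[OF _ finite_splits[of I']]) (auto simp: splits_def)
  have "phi I j a I' M = (\<Sum>(J, K)\<in>{(J, K). J \<in> mis \<and> J + K = I'}.
      if J = I \<and> M = unit_mi j + K then ?t else 0)"
    unfolding phi_def coder_def using I(2,3)
  proof (simp, intro sum.cong refl, simp only: split_beta)
    fix x assume "x \<in> {(J, K). J \<in> mis \<and> J + K = I'}"
    have "(\<Sum>k\<in>{1..3}. if M = unit_mi k + snd x then of_nat (mbinom I' (fst x)) * gsign (wpar (snd x))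
        (if fst x = I \<and> k = j then of_nat (mfact I) * gsign (wpar I) a else 0) else 0)
      = (\<Sum>k\<in>{1..3}. if k = j then if fst x = I \<and> M = unit_mi j + snd x then ?t else 0 else 0)"
    proof (intro sum.cong refl)
      fix k
      show "(if M = unit_mi k + snd x then of_nat (mbinom I' (fst x)) * gsign (wpar (snd x))
          (if fst x = I \<and> k = j then of_nat (mfact I) * gsign (wpar I) a else 0) else 0)
        = (if k = j then if fst x = I \<and> M = unit_mi j + snd x then ?t else 0 else 0)"
      proof (cases "k = j \<and> fst x = I \<and> M = unit_mi j + snd x")
        case True
        then have "M - unit_mi j = snd x" using unit_split(4)[OF j] by metis
        then show ?thesis using True by (simp add: g mult.assoc)
      next
        case False
        then consider "k \<noteq> j" | "fst x \<noteq> I" | "k = j" "M \<noteq> unit_mi j + snd x" by blast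
        then show ?thesis by cases simp_all
      qed
    qed
    also have "\<dots> = (if fst x = I \<and> M = unit_mi j + snd x then ?t else 0)"
      using j by (subst sum.delta) simp_all
    finally show "(\<Sum>k\<in>{Suc 0..3}. if M = unit_mi k + snd x then of_nat (mbinom I' (fst x)) * gsign (wpar (snd x))
        (if fst x = I \<and> k = j then of_nat (mfact I) * gsign (wpar I) a else 0) else 0)
      = (if fst x = I \<and> M = unit_mi j + snd x then ?t else 0)" by simp
  qed
  also have "\<dots> = (if \<exists>K. I' = I + K \<and> M = unit_mi j + K then ?t else 0)"
  proof (cases "\<exists>K. I' = I + K \<and> M = unit_mi j + K")
    case True
    then obtain K where K: "I' = I + K" "M = unit_mi j + K" by blast
    have "(case x of (J, K) \<Rightarrow> if J = I \<and> M = unit_mi j + K then ?t else 0)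
        = (if x = (I, K) then ?t else 0)" for x
    proof -
      obtain J K' where "x = (J, K')" by (rule prod.exhaust)
      moreover have "M = unit_mi j + K' \<longleftrightarrow> K' = K" unfolding K(2) by (metis add_left_cancel)
      ultimately show ?thesis by (simp only: prod.case prod.inject)
    qed
    then have "(\<Sum>(J, K)\<in>{(J, K). J \<in> mis \<and> J + K = I'}. if J = I \<and> M = unit_mi j + K then ?t else 0)
        = (\<Sum>x\<in>{(J, K). J \<in> mis \<and> J + K = I'}. if x = (I, K) then ?t else 0)"
      by (intro sum.cong refl)
    also have "\<dots> = (if (I, K) \<in> {(J, K). J \<in> mis \<and> J + K = I'} then ?t else 0)"
      by (rule sum.delta[OF fin])
    also have "(if (I, K) \<in> {(J, K). J \<in> mis \<and> J + K = I'} then ?t else 0) = ?t"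
      by (rule if_P) (use K(1) I(1) in blast)
    finally show ?thesis by (simp only: if_P[OF True])
  next
    case False
    have "(case x of (J, K) \<Rightarrow> if J = I \<and> M = unit_mi j + K then ?t else 0) = 0"
      if "x \<in> {(J, K). J \<in> mis \<and> J + K = I'}" for x
    proof -
      obtain J K where x: "x = (J, K)" by (rule prod.exhaust)
      then have "\<not> (J = I \<and> M = unit_mi j + K)" using False that by blast
      then show ?thesis by (simp only: x prod.case if_False)
    qed
    then show ?thesis unfolding if_not_P[OF False] by (intro sum.neutral) blast
  qed
  finally show ?thesis .
qed

text \<open>Up to a Koszul sign \<open>phi I j a\<close> dualizes to the vector field a x^I
  \<partial>_j: \<open>idx j M\<close> and \<open>M - unit_mi j\<close> are the derivative of
  \<open>x^M\<close>, and the factor I! in \<open>phi\<close> cancels against the normalization of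
  \<open>row\<close>.\<close>

lemma row_phi:
  assumes I: "I \<in> mis" and M: "M \<in> mis" and j: "j \<in> {1..3}"
  shows "row (phi I j a) M
    = of_nat (idx j M) * (mon (M - unit_mi j) * (cst (gsign (wpar I) a) * mon I))"
proof (rule ser_eq_mis)
  let ?K = "M - unit_mi j" and ?b = "gsign (wpar I) a"
  have e: "mon ?K * (cst ?b * mon I) = cst (gsign (wpar ?K) ?b) * mon (I + ?K)"
    by (simp add: mon_cst mon_mult add.commute flip: mult.assoc) (simp add: mult.assoc mon_mult add.commute)
  have n: "cf L (of_nat n * F) = of_nat n *\<^sub>C cf L F" for L n and F :: "'a ser"
    by (simp only: scaleC_of_nat[symmetric] cf_scaleC)
  show "cf 0 (row (phi I j a) M) = 0"
    using phi_support[of 0] by (simp add: cf_row mis_eq)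
  have "0 \<noteq> I + ?K" using I by (cases I; cases ?K) (auto simp: mis_iff zero_mi)
  then show "cf 0 (of_nat (idx j M) * (mon ?K * (cst ?b * mon I))) = 0"
    by (simp add: n e cf_cst_mult cf_mon)
  fix I' assume I': "I' \<in> mis"
  show "cf I' (row (phi I j a) M) = cf I' (of_nat (idx j M) * (mon ?K * (cst ?b * mon I)))"
  proof (cases "\<exists>K. I' = I + K \<and> M = unit_mi j + K")
    case True
    then obtain K where K: "I' = I + K" "M = unit_mi j + K" by blast
    have K': "?K = K" unfolding K(2) by (rule unit_split(4)[OF j])
    have "of_nat (mfact M) / of_nat (mfact I') * of_nat (mbinom I' I * mfact I) = (of_nat (idx j M) :: complex)"
      unfolding K unit_split(3)[OF j] by (simp add: mbinom_eq)
    then have "(of_nat (mfact M) / of_nat (mfact I')) *\<^sub>C of_nat (mbinom I' I * mfact I) *\<^sub>C x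
        = of_nat (idx j M) *\<^sub>C x" for x :: 'a
      unfolding scaleC_scaleC by simp
    then show ?thesis
      using True I' unfolding cf_row[OF mis_mi0[OF I']] phi_entry[OF I I' M j] n e[unfolded K'] K' scaleC_of_nat[symmetric]
      by (simp add: cf_cst_mult cf_mon cf_scaleC K(1) mis_mi0)
  next
    case False
    then have "idx j M = 0 \<or> I' \<noteq> I + ?K"
      using unit_split(2)[OF j, of M] by blast
    then show ?thesis
      using False unfolding cf_row[OF mis_mi0[OF I']] phi_entry[OF I I' M j] n e
      by (auto simp: cf_cst_mult cf_mon)
  qed
qed

definition universal ::
    "complex \<Rightarrow> 'a \<Rightarrow> 'a \<Rightarrow> 'a \<Rightarrow> 'a \<Rightarrow> 'a \<Rightarrow> 'a::supercomm_algebra smap" where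
  "universal c u1 u2 u3 e1 e2 = phi (1,1,0) 2 1 + phi (1,0,1) 3 (c *\<^sub>C 1) + phi (1,0,0) 2 u1
    + phi (1,0,0) 3 u2 + phi (0,1,0) 2 e1 + phi (0,0,1) 3 e2 + phi (1,0,1) 3 u3"

text \<open>The universal family acts on functions by \<open>\<xi> \<mapsto> 0\<close>, \<open>y \<mapsto> lam2\<close>, \<open>z \<mapsto> lam3\<close>.\<close>

definition lam2 :: "'a \<Rightarrow> 'a \<Rightarrow> 'a::supercomm_algebra ser" where
  "lam2 u1 e1 = mon (1,1,0) + cst u1 * mon (1,0,0) + cst e1 * mon (0,1,0)"

definition lam3 :: "complex \<Rightarrow> 'a \<Rightarrow> 'a \<Rightarrow> 'a \<Rightarrow> 'a::supercomm_algebra ser" where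
  "lam3 c u2 u3 e2 = c *\<^sub>C mon (1,0,1) + cst u2 * mon (1,0,0) + cst u3 * mon (1,0,1)
    + cst e2 * mon (0,0,1)"

text \<open>The right derivation with \<xi> \<mapsto> 0, y \<mapsto> a, z \<mapsto> b, evaluated on
  \<open>x^M\<close> by the Leibniz rule.\<close>

definition drow :: "'a::supercomm_algebra ser \<Rightarrow> 'a ser \<Rightarrow> mi \<Rightarrow> 'a ser" where
  "drow a b M = of_nat (idx 2 M) * (mon (M - unit_mi 2) * a) + of_nat (idx 3 M) * (mon (M - unit_mi 3) * b)"

lemma row_universal:
  assumes "M \<in> mis" "homogeneous 0 u1" "homogeneous 0 u2" "homogeneous 0 u3"
  shows "row (universal c u1 u2 u3 e1 e2) M = drow (lam2 u1 e1) (lam3 c u2 u3 e2) M"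
proof -
  have u: "(1,1,0) \<in> mis" "(1,0,1) \<in> mis" "(1,0,0) \<in> mis" "(0,1,0) \<in> mis" "(0,0,1) \<in> mis"
    by (auto simp: mis_iff zero_mi)
  have h: "homogeneous 0 (c *\<^sub>C (1 :: 'a))" by (rule homogeneous_scaleC) simp
  have [simp]: "wpar (0, b, c) = 0" for b c by (simp add: wpar.simps)
  show ?thesis
    unfolding universal_def row_add
    by (simp only: row_phi[OF u(1) assms(1)] row_phi[OF u(2) assms(1)] row_phi[OF u(3) assms(1)]
        row_phi[OF u(4) assms(1)] row_phi[OF u(5) assms(1)] atLeastAtMost_1_3 insert_iff simp_thms
        gsign_even[OF assms(2)] gsign_even[OF assms(3)] gsign_even[OF assms(4)] gsign_even[OF h])
      (simp add: drow_def lam2_def lam3_def cst_scaleC_one_mult algebra_simps cst_def[of 1] mon_def[of 0, symmetric])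
qed

lemma smap_of_eq:
  assumes "\<And>I M. I \<notin> mis \<or> M \<notin> mis \<Longrightarrow> T I M = 0"
    "\<And>M. M \<in> mis \<Longrightarrow> row T M = r M"
  shows "T = smap_of r"
proof (intro ext)
  fix I M
  show "T I M = smap_of r I M"
  proof (cases "I \<in> mis \<and> M \<in> mis")
    case True
    then show ?thesis
      by (simp add: smap_of_def assms(2)[symmetric] cf_row mis_mi0 scaleC_scaleC scaleC_one)
  qed (use assms(1) in \<open>auto simp: smap_of_def\<close>)
qed

lemma universal_eq_smap_of:
  assumes "homogeneous 0 u1" "homogeneous 0 u2" "homogeneous 0 u3"
  shows "universal c u1 u2 u3 e1 e2 = smap_of (drow (lam2 u1 e1) (lam3 c u2 u3 e2))"
  by (rule smap_of_eq) (simp add: universal_def phi_support, rule row_universal[OF _ assms])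

lemma mon_000 [simp]: "mon (0, 0, 0) = 1"
  using mon_zero unfolding zero_mi .

lemma drow_units:
  "drow a b (1, 0, 0) = 0" "drow a b (0, 1, 0) = a" "drow a b (0, 0, 1) = b"
  "drow a b (1, 1, 0) = mon (1, 0, 0) * a" "drow a b (1, 0, 1) = mon (1, 0, 0) * b"
  by (simp_all add: drow_def idx.simps zero_prod_def)

lemma idx_add: "idx j (J + K) = idx j J + idx j K"
  by (cases J; cases K) (simp add: idx.simps)

lemma add_unit_diff:
  assumes "j \<in> {1..3}" "idx j K \<noteq> 0"
  shows "J + (K - unit_mi j) = J + K - unit_mi j" "(K - unit_mi j) + J = J + K - unit_mi j"
  using unit_split(2)[OF assms] unit_split(4)[OF assms(1), of "J + (K - unit_mi j)"]
  by (metis add.commute add.left_commute)+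

lemma derivation_family_drow:
  assumes a: "homogeneous 1 a" "cf 0 a = 0" and b: "homogeneous 1 b" "cf 0 b = 0"
  shows "derivation_family (drow a b)"
proof -
  let ?t = "\<lambda>j u M. of_nat (idx j M) * (mon (M - unit_mi j) * u) :: 'a ser"
  have der: "?t j u (J + K) = ksign (wpar K) * (?t j u J * mon K) + mon J * ?t j u K"
    if j: "j \<in> {2, 3}" and u: "homogeneous 1 u" for j u J K
  proof -
    have j': "j \<in> {1..3}" using j by auto
    have c: "u * mon K = ksign (wpar K) * (mon K * u)"
      using homogeneous_commute[OF u homogeneous_mon, of K] by simp
    have "ksign (wpar K) * (?t j u J * mon K) = of_nat (idx j J) * (mon (J - unit_mi j) * mon K * u)"
      unfolding mult.assoc c by (cases "wpar K") simp_all
    also have "\<dots> = of_nat (idx j J) * (mon (J + K - unit_mi j) * u)"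
      using add_unit_diff(2)[OF j', of J K] 
      by (cases "idx j J = 0") (simp_all add: mon_mult add.commute)
    finally have 1: "ksign (wpar K) * (?t j u J * mon K) = of_nat (idx j J) * (mon (J + K - unit_mi j) * u)" .
    have "mon J * ?t j u K = of_nat (idx j K) * (mon J * mon (K - unit_mi j) * u)"
      by (metis mult.assoc mult_of_nat_commute)
    also have "\<dots> = of_nat (idx j K) * (mon (J + K - unit_mi j) * u)"
      using add_unit_diff(1)[OF j', of K J] by (cases "idx j K = 0") (simp_all add: mon_mult)
    finally show ?thesis unfolding 1 by (simp add: idx_add algebra_simps)
  qed
  have d: "drow a b (J + K) = ksign (wpar K) * (drow a b J * mon K) + mon J * drow a b K" for J K
    using der[of 2 a J K, OF _ a(1)] der[of 3 b J K, OF _ b(1)] unfolding drow_def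
    by (simp add: distrib_left distrib_right add_ac del: unit_mi_eq)
  have z: "drow a b (J + K) = 0" if "J \<in> mis" "K \<in> mis" "J + K \<notin> mis" for J K
  proof -
    have "J + K \<notin> mi0" using that mis_add_mi0 by blast
    then have n: "J + K - unit_mi j \<notin> mi0" if "j \<in> {2, 3}" for j
      using that by (cases "J + K") (auto simp: mi0_iff)
    show ?thesis unfolding drow_def
      using n[of 2] n[of 3] by (simp add: mon_not_mi0 del: unit_mi_eq)
  qed
  have tri: "triangular (drow a b)"
  proof (rule triangular_induct)
    fix J K I :: mi
    assume h: "J \<in> mis" "K \<in> mis" "J + K \<in> mis"
      "\<And>I. deg I < deg J \<Longrightarrow> cf I (drow a b J) = 0"
      "\<And>I. deg I < deg K \<Longrightarrow> cf I (drow a b K) = 0" "deg I < deg J + deg K"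
    have "cf I (drow a b J * mon K) = 0" "cf I (mon J * drow a b K) = 0"
      by (rule order_mult[OF h(4) order_mon h(6)] order_mult[OF order_mon h(5) h(6)]; assumption)+
    then show "cf I (drow a b (J + K)) = 0" by (simp add: d cf_add cf_ksign_mult)
  qed (simp_all add: drow_units[simplified] a b)
  have par: "homogeneous (1 + wpar M) (drow a b M)" for M
  proof -
    have "homogeneous (1 + wpar M) (?t j u M)" if "j \<in> {2, 3}" "homogeneous 1 u" for j u
    proof (cases "idx j M = 0")
      case False
      have "wpar (M - unit_mi j) = wpar M" using that by (cases M) (auto simp: wpar.simps)
      then have "homogeneous (wpar M + 1) (mon (M - unit_mi j) * u)"
        using homogeneous_mult[OF homogeneous_mon that(2)] by metis
      then show ?thesis
        unfolding scaleC_of_nat[symmetric] by (simp add: homogeneous_scaleC add.commute)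
    qed simp
    from this[of 2 a] this[of 3 b] show ?thesis
      unfolding drow_def using a(1) b(1) by (intro homogeneous_add) simp_all
  qed
  show ?thesis
    unfolding derivation_family_def
  proof (intro conjI ballI tri par)
    fix J K :: mi assume "J \<in> mis" "K \<in> mis"
    then show "(if J + K \<in> mis then drow a b (J + K) else 0)
        = ksign (wpar K) * (drow a b J * mon K) + mon J * drow a b K"
      unfolding d[symmetric] using z by simp
  qed
qed

lemma homogeneous_lam2:
  assumes "homogeneous 0 u1" "homogeneous 1 e1" shows "homogeneous 1 (lam2 u1 e1)" "cf 0 (lam2 u1 e1) = 0"
proof -
  show "homogeneous 1 (lam2 u1 e1)"
    using homogeneous_mult[OF homogeneous_cst[OF assms(1)] homogeneous_mon[of "(1,0,0)"]]
      homogeneous_mult[OF homogeneous_cst[OF assms(2)] homogeneous_mon[of "(0,1,0)"]]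
      homogeneous_mon[of "(1,1,0)"]
    unfolding lam2_def by (intro homogeneous_add) (simp_all add: wpar.simps)
qed (simp add: lam2_def cf_add cf_cst_mult cf_mon zero_mi)

lemma homogeneous_lam3:
  assumes "homogeneous 0 u2" "homogeneous 0 u3" "homogeneous 1 e2"
  shows "homogeneous 1 (lam3 c u2 u3 e2)" "cf 0 (lam3 c u2 u3 e2) = 0"
proof -
  show "homogeneous 1 (lam3 c u2 u3 e2)"
    using homogeneous_mult[OF homogeneous_cst[OF assms(1)] homogeneous_mon[of "(1,0,0)"]]
      homogeneous_mult[OF homogeneous_cst[OF assms(2)] homogeneous_mon[of "(1,0,1)"]]
      homogeneous_mult[OF homogeneous_cst[OF assms(3)] homogeneous_mon[of "(0,0,1)"]]
      homogeneous_scaleC[OF homogeneous_mon[of "(1,0,1)"], of c]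
    unfolding lam3_def by (intro homogeneous_add) (simp_all add: wpar.simps)
qed (simp add: lam3_def cf_add cf_cst_mult cf_mon cf_scaleC zero_mi)

subsection \<open>The square of the universal family\<close>

lemma unit_mis: "(1,0,0) \<in> mis" "(0,1,0) \<in> mis" "(0,0,1) \<in> mis" "(1,1,0) \<in> mis"
  "(1,0,1) \<in> mis"
  by (auto simp: mis_iff zero_mi)

lemma xi_mult_xi: "mon (1,0,0) * (cst a * mon (1,b,c)) = 0"
  by (simp add: mon_cst mult.assoc[symmetric]) (simp add: mult.assoc mon_mult mon_not_mi0 mi0_iff)

text \<open>The square of an odd derivation is an even derivation: the two mixed terms
  \<open>r J * r K\<close> carry opposite signs. Hence it is controlled by its values on the
  coordinates.\<close>

lemma derivation_family_square:
  assumes r: "derivation_family r" and JK: "J \<in> mis" "K \<in> mis" "J + K \<in> mis"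
  shows "pullback r (r (J + K)) = mon J * pullback r (r K) + pullback r (r J) * mon K"
proof -
  have t: "triangular r" using r by (simp add: derivation_family_def)
  have h: "homogeneous (1 + wpar M) (r M)" if "M \<in> mis" for M
    using r that by (auto simp: derivation_family_def)
  have c: "cf 0 (r M) = 0" "cf 0 (mon M) = 0" if "M \<in> mis" for M
    using triangular_cf_0[OF t that] that by (auto simp: cf_mon mis_eq)
  have k: "pullback r (ksign p * F) = ksign p * pullback r F" for p F
    by (cases p) (simp_all add: pullback_minus)
  have "r (J + K) = ksign (wpar K) * (r J * mon K) + mon J * r K"
    using r JK unfolding derivation_family_def by metis
  then have "pullback r (r (J + K)) = ksign (wpar K) * (r J * r K + pullback r (r J) * gsign 1 (mon K))
      + (mon J * pullback r (r K) + r J * gsign 1 (r K))"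
    using pullback_derivation[OF r c(1)[OF JK(1)] h[OF JK(1)] c(2)[OF JK(2)]]
      pullback_derivation[OF r c(2)[OF JK(1)] homogeneous_mon c(1)[OF JK(2)]]
    by (simp add: pullback_add k pullback_mon[OF t] JK)
  also have "gsign 1 (r K) = ksign (1 + wpar K) * r K"
    using gsign_homogeneous[OF h[OF JK(2)], of 1] by simp
  finally show ?thesis
    by (cases "wpar K") (simp_all add: gsign_mon algebra_simps)
qed

lemma square_ideal:
  assumes r: "derivation_family r" and A: "graded_ideal A"
    and "pullback r (r (1,0,0)) \<in> ser_ideal A" "pullback r (r (0,1,0)) \<in> ser_ideal A"
      "pullback r (r (0,0,1)) \<in> ser_ideal A"
    and M: "M \<in> mis"
  shows "pullback r (r M) \<in> ser_ideal A"
  using M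
proof (induction rule: mis_induct)
  case (4 J K)
  then show ?case
    unfolding derivation_family_square[OF r 4(1-3)]
    by (intro ideal_add ideal_left ideal_right graded_ideal_ser A)
qed (use assms in auto)

text \<open>The terms in \<xi> y and \<xi> z cancel because \<xi> passes the odd parameters with a
  sign; the others vanish by \<xi> \<xi> = 0 and since odd parameters square to 0. Only the products
  behind the relations of the base survive.\<close>

lemma universal_square:
  fixes c :: complex and u1 u2 u3 e1 e2 :: "'a::supercomm_algebra"
  assumes t: "homogeneous 0 u1" "homogeneous 0 u2" "homogeneous 0 u3" and e: "homogeneous 1 e1"
    "homogeneous 1 e2"
  defines "D \<equiv> drow (lam2 u1 e1) (lam3 c u2 u3 e2)"
  shows "pullback D (D (1,0,0)) = 0" "pullback D (D (0,1,0)) = cst (e1 * u1) * mon (1,0,0)" (is ?goal1)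
    "pullback D (D (0,0,1)) = cst (e2 * u2) * mon (1,0,0)" (is ?goal2)
proof -
  have "derivation_family D"
    unfolding D_def using homogeneous_lam2[OF t(1) e(1)] homogeneous_lam3[OF t(2,3) e(2)]
    by (intro derivation_family_drow) auto
  then have tri: "triangular D" by (simp add: derivation_family_def)
  have D: "D (1,0,0) = 0" "D (0,1,0) = lam2 u1 e1" "D (0,0,1) = lam3 c u2 u3 e2"
    "D (1,1,0) = mon (1,0,0) * lam2 u1 e1" "D (1,0,1) = mon (1,0,0) * lam3 c u2 u3 e2"
    unfolding D_def by (rule drow_units)+
  note opm = pullback_mon[OF tri unit_mis(1)] pullback_mon[OF tri unit_mis(2)] pullback_mon[OF tri unit_mis(3)]
    pullback_mon[OF tri unit_mis(4)] pullback_mon[OF tri unit_mis(5)]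
  show "pullback D (D (1,0,0)) = 0" unfolding D by simp
  have neg: "gsign 1 e1 = - e1" "gsign 1 e2 = - e2" 
    using gsign_homogeneous[OF e(1), of 1] gsign_homogeneous[OF e(2), of 1] by simp_all
  have w: "wpar (1,0,0) = 1" by (simp add: wpar.simps)
  have xe: "mon (1,0,0) * (cst e1 * F) = - (cst e1 * (mon (1,0,0) * F))"
    "mon (1,0,0) * (cst e2 * F) = - (cst e2 * (mon (1,0,0) * F))" for F
    by (simp_all only: mult.assoc[symmetric] mon_cst w neg cst_minus mult_minus_left)
  have xx: "mon (1,0,0) * mon (1,b,c) = 0" for b c
    by (simp add: mon_mult mon_not_mi0 mi0_iff)
  have sq: "e1 * e1 = 0" "e2 * e2 = 0" by (intro odd_square e)+
  have "pullback D (D (0,1,0)) = mon (1,0,0) * lam2 u1 e1 + cst e1 * lam2 u1 e1"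
    unfolding D(2) unfolding lam2_def[of u1 e1, unfolded] pullback_add pullback_cst_mult opm D by (simp add: lam2_def)
  also have "\<dots> = cst (e1 * u1) * mon (1,0,0)"
    unfolding lam2_def distrib_left xi_mult_xi xx xe
    by (simp add: mult.assoc[symmetric] cst_mult sq) (simp add: mult.assoc mon_mult)
  finally show ?goal1 .
  have te: "e2 * u3 = u3 * e2" using even_commute[OF t(3)] by simp
  have "pullback D (D (0,0,1)) = c *\<^sub>C (mon (1,0,0) * lam3 c u2 u3 e2) + cst u3 * (mon (1,0,0) * lam3 c u2 u3 e2)
      + cst e2 * lam3 c u2 u3 e2"
    unfolding D(3) unfolding lam3_def[of c u2 u3 e2, unfolded] pullback_add pullback_cst_mult pullback_scaleC opm D by (simp add: lam3_def)
  also have "mon (1,0,0) * lam3 c u2 u3 e2 = - (cst e2 * mon (1,0,1))"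
    unfolding lam3_def distrib_left xi_mult_xi xx xe scaleC_mult_right by (simp add: mon_mult)
  also have "c *\<^sub>C - (cst e2 * mon (1,0,1)) + cst u3 * - (cst e2 * mon (1,0,1)) + cst e2 * lam3 c u2 u3 e2
      = cst (e2 * u2) * mon (1,0,0)"
    unfolding lam3_def distrib_left 
    by (simp add: scaleC_mult_right scaleC_minus_right mult.assoc[symmetric] cst_mult sq te)
  finally show ?goal2 .
qed

section \<open>Approximate equivalences\<close>

definition gam :: "'a::supercomm_algebra ser \<Rightarrow> 'a ser \<Rightarrow> 'a ser \<Rightarrow> mi \<Rightarrow> 'a ser" where
  "gam a b c M = a ^ idx 1 M * b ^ idx 2 M * c ^ idx 3 M"

lemma gam_units:
  "gam a b c (1, 0, 0) = a" "gam a b c (0, 1, 0) = b" "gam a b c (0, 0, 1) = c"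
  "gam a b c (1, 1, 0) = a * b" "gam a b c (1, 0, 1) = a * c"
  by (simp_all add: gam_def idx.simps)

lemma even_central:
  assumes "homogeneous 0 (b :: 'a::supercomm_algebra)" shows "b ^ n * x = x * b ^ n"
proof -
  have "homogeneous 0 (b ^ n)"
  proof (induction n)
    case (Suc n)
    then show ?case using homogeneous_mult[OF assms Suc] by simp
  qed simp
  then show ?thesis by (rule even_commute)
qed

text \<open>Powers of the even series are central and can be collected. If \<open>J + K\<close> is
  outside \<open>mis\<close>, the odd series a occurs twice, and its square is 0.\<close>

lemma gam_mult:
  assumes a: "homogeneous 1 a" and b: "homogeneous 0 b" and c: "homogeneous 0 c"
    and JK: "J \<in> mis" "K \<in> mis"
  shows "gam a b c J * gam a b c K = (if J + K \<in> mis then gam a b c (J + K) else 0)"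
proof -
  obtain j1 j2 j3 k1 k2 k3 where [simp]: "J = (j1, j2, j3)" "K = (k1, k2, k3)"
    by (cases J; cases K)
  note cc = even_central[OF c] and bb = even_central[OF b]
  have "gam a b c J * gam a b c K = a ^ j1 * b ^ j2 * (c ^ j3 * (a ^ k1 * b ^ k2)) * c ^ k3"
    by (simp add: gam_def idx.simps mult.assoc)
  also have "\<dots> = a ^ j1 * (b ^ j2 * a ^ k1) * b ^ k2 * (c ^ j3 * c ^ k3)"
    unfolding cc[of j3 "a ^ k1 * b ^ k2"] by (simp only: mult.assoc)
  also have "\<dots> = a ^ j1 * a ^ k1 * (b ^ j2 * b ^ k2) * (c ^ j3 * c ^ k3)"
    unfolding bb[of j2 "a ^ k1"] by (simp only: mult.assoc)
  also have "\<dots> = a ^ (j1 + k1) * b ^ (j2 + k2) * c ^ (j3 + k3)"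
    by (simp only: power_add)
  finally have e: "gam a b c J * gam a b c K = a ^ (j1 + k1) * b ^ (j2 + k2) * c ^ (j3 + k3)" .
  show ?thesis
  proof (cases "J + K \<in> mis")
    case False
    then have "j1 + k1 = 2" using JK by (auto simp: mis_iff zero_mi)
    then show ?thesis using False odd_square[OF a] unfolding e by (simp add: power2_eq_square)
  next
    case True
    have "gam a b c (J + K) = a ^ (j1 + k1) * b ^ (j2 + k2) * c ^ (j3 + k3)"
      by (simp add: gam_def idx.simps)
    then show ?thesis using True unfolding e by simp
  qed
qed

lemma morphism_family_gam:
  assumes a: "homogeneous 1 a" "cf 0 a = 0" and b: "homogeneous 0 b" "cf 0 b = 0"
    and c: "homogeneous 0 c" "cf 0 c = 0"
  shows "morphism_family (gam a b c)"
proof -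
  note m = gam_mult[OF a(1) b(1) c(1)]
  have "homogeneous (wpar M) (gam a b c M)" if "M \<in> mis" for M
    using that
  proof (induction rule: mis_induct)
    case (4 J K)
    then show ?case using m[of J K] homogeneous_mult[of "wpar J" "gam a b c J" "wpar K" "gam a b c K"]
      by (simp add: wpar_add)
  qed (use a b c in \<open>simp_all add: gam_units[simplified] wpar.simps\<close>)
  moreover have "triangular (gam a b c)"
  proof (rule triangular_induct)
    fix J K I :: mi
    assume h: "J \<in> mis" "K \<in> mis" "J + K \<in> mis"
      "\<And>I. deg I < deg J \<Longrightarrow> cf I (gam a b c J) = 0"
      "\<And>I. deg I < deg K \<Longrightarrow> cf I (gam a b c K) = 0" "deg I < deg J + deg K"
    show "cf I (gam a b c (J + K)) = 0"
      using order_mult[OF h(4-6)] m[OF h(1,2)] h(3) by simp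
  qed (use a b c in \<open>simp_all add: gam_units[simplified]\<close>)
  ultimately show ?thesis using m by (simp add: morphism_family_def)
qed

lemma morphism_family_eq_gam:
  assumes r: "morphism_family r" and M: "M \<in> mis"
  shows "r M = gam (r (1,0,0)) (r (0,1,0)) (r (0,0,1)) M"
  using M
proof (induction rule: mis_induct)
  case (4 J K)
  have h: "homogeneous 1 (r (1,0,0))" "homogeneous 0 (r (0,1,0))" "homogeneous 0 (r (0,0,1))"
    using r unit_mis unfolding morphism_family_def by (force simp: wpar.simps)+
  have "r (J + K) = r J * r K" using r 4(1-3) unfolding morphism_family_def by metis
  then show ?case using 4 gam_mult[OF h 4(1,2)] by simp
qed (simp_all add: gam_units[simplified])

lemma ideal_mult_cong:
  assumes A: "graded_ideal A" and "x - x' \<in> A" "y - y' \<in> A" shows "x * y - x' * y' \<in> A"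
proof -
  have "x * y - x' * y' = (x - x') * y + x' * (y - y')" by (simp add: algebra_simps)
  then show ?thesis using assms by (simp add: ideal_add ideal_left ideal_right)
qed

lemma gam_cong:
  assumes A: "graded_ideal A" and "a - a' \<in> A" "b - b' \<in> A" "c - c' \<in> A"
  shows "gam a b c M - gam a' b' c' M \<in> A"
proof -
  have "x ^ n - x' ^ n \<in> A" if "x - x' \<in> A" for x x' n
    by (induction n) (simp_all add: ideal_zero[OF A] ideal_mult_cong[OF A that])
  then show ?thesis using assms unfolding gam_def by (intro ideal_mult_cong) auto
qed

lemma gam_mon: "M \<in> mis \<Longrightarrow> gam (mon (1,0,0)) (mon (0,1,0)) (mon (0,0,1)) M = mon M"
proof (induction rule: mis_induct)
  case (4 J K)
  have h: "homogeneous 1 (mon (1,0,0) :: 'a ser)" "homogeneous 0 (mon (0,1,0) :: 'a ser)" 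
     "homogeneous 0 (mon (0,0,1) :: 'a ser)"
    using homogeneous_mon[of "(1,0,0)"] homogeneous_mon[of "(0,1,0)"] homogeneous_mon[of "(0,0,1)"]
    by (simp_all add: wpar.simps)
  show ?case using gam_mult[OF h 4(1,2)] 4 by (simp add: mon_mult)
qed (simp_all add: gam_units[simplified])

lemma drow_cong:
  assumes A: "graded_ideal A" and "a - a' \<in> A" "b - b' \<in> A"
  shows "drow a b M - drow a' b' M \<in> A"
proof -
  have "drow a b M - drow a' b' M = of_nat (idx 2 M) * (mon (M - unit_mi 2) * (a - a'))
      + of_nat (idx 3 M) * (mon (M - unit_mi 3) * (b - b'))"
    by (simp add: drow_def algebra_simps)
  then show ?thesis using assms by (simp add: ideal_add ideal_left)
qed

lemma cst_ideal: "graded_ideal A \<Longrightarrow> b \<in> A \<Longrightarrow> cst b \<in> ser_ideal A"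
  by (simp add: ser_ideal_def cf_cst ideal_zero)

section \<open>The rows of d_c, their weights, and gauges\<close>

definition vrow :: "complex \<Rightarrow> mi \<Rightarrow> 'a::supercomm_algebra ser" where
  "vrow c = drow (mon (1,1,0)) (c *\<^sub>C mon (1,0,1))"

lemma lam2_0: "lam2 0 0 = mon (1,1,0)"
  by (simp add: lam2_def)

lemma lam3_0: "lam3 c 0 0 0 = c *\<^sub>C mon (1,0,1)"
  by (simp add: lam3_def)

lemma lam_diff:
  "lam2 t e - lam2 t' e' = cst (t - t') * mon (1,0,0) + cst (e - e') * mon (0,1,0)"
  "lam3 c t u e - lam3 c t' u' e' = cst (t - t') * mon (1,0,0) + cst (u - u') * mon (1,0,1)
    + cst (e - e') * mon (0,0,1)"
  by (simp_all add: lam2_def lam3_def cst_diff algebra_simps)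

lemma lam_ideal:
  assumes A: "graded_ideal A"
  shows "t - t' \<in> A \<Longrightarrow> e - e' \<in> A \<Longrightarrow> lam2 t e - lam2 t' e' \<in> ser_ideal A"
    "t - t' \<in> A \<Longrightarrow> u - u' \<in> A \<Longrightarrow> e - e' \<in> A \<Longrightarrow> lam3 c t u e - lam3 c t' u' e' \<in> ser_ideal A"
  unfolding lam_diff
  by (intro ideal_add[OF graded_ideal_ser[OF A]] ideal_right[OF graded_ideal_ser[OF A]] cst_ideal[OF A]; assumption)+

lemma vrow_units:
  "vrow c (1, 0, 0) = 0" "vrow c (0, 1, 0) = mon (1, 1, 0)" "vrow c (0, 0, 1) = c *\<^sub>C mon (1, 0, 1)"
  by (simp_all only: vrow_def drow_units)

lemma vrow_eq:
  assumes "M \<in> mi0"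
  shows "vrow c M = ((of_nat (idx 2 M) + c * of_nat (idx 3 M)) *\<^sub>C mon (M + (1, 0, 0))
    :: 'a::supercomm_algebra ser)"
proof -
  have "of_nat (idx 2 M) * (mon (M - unit_mi 2) * mon (1,1,0)) = of_nat (idx 2 M) *\<^sub>C (mon (M + (1,0,0)) :: 'a ser)"
    unfolding scaleC_of_nat mon_mult
    by (cases M, rename_tac p q r, case_tac q) (simp_all add: idx.simps)
  moreover have "of_nat (idx 3 M) * (mon (M - unit_mi 3) * c *\<^sub>C mon (1,0,1))
      = (c * of_nat (idx 3 M)) *\<^sub>C (mon (M + (1,0,0)) :: 'a ser)"
  proof -
    have "of_nat (idx 3 M) * (mon (M - unit_mi 3) * c *\<^sub>C mon (1,0,1))
        = c *\<^sub>C (of_nat (idx 3 M) * (mon (M - unit_mi 3 + (1,0,1)) :: 'a ser))"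
      by (simp only: scaleC_mult_right mon_mult)
    also have "of_nat (idx 3 M) * mon (M - unit_mi 3 + (1,0,1)) = of_nat (idx 3 M) *\<^sub>C (mon (M + (1,0,0)) :: 'a ser)"
      unfolding scaleC_of_nat
      by (cases M, rename_tac p q r, case_tac r) (simp_all add: idx.simps)
    finally show ?thesis by (simp only: scaleC_scaleC)
  qed
  ultimately show ?thesis by (simp only: vrow_def drow_def scaleC_add_left)
qed

text \<open>Pullback along the rows of d_c sends f + g \<xi> to v(f) \<xi>, up to placing
  coefficients on the left, and v acts on y^a z^b by its weight a + c b. This turns the equations
  below into scalar ones, one for each exponent.\<close>

lemma cf_pullback_vrow:
  fixes F :: "'a::supercomm_algebra ser"
  shows "cf (0, a, b) (pullback (vrow c) F) = 0"
  "cf (1, a, b) (pullback (vrow c) F) = (of_nat a + c * of_nat b) *\<^sub>C cf (0, a, b) F" (is ?goal1)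
proof -
  have v: "cf I (vrow c K) = (if I = K + (1,0,0) then (of_nat (idx 2 K) + c * of_nat (idx 3 K)) *\<^sub>C (1 :: 'a) else 0)"
    if "K \<in> mis" "I \<in> mi0" for I K
    using that by (simp add: vrow_eq mis_mi0 cf_scaleC cf_mon)
  have "cf (0, a, b) (pullback (vrow c) F) = (\<Sum>K\<in>mis_upto (deg (0, a, b)). 0)"
    unfolding cf_pullback[of "(0, a, b)", simplified mi0_iff, simplified]
  proof (rule sum.cong[OF refl])
    fix K assume "K \<in> mis_upto (deg (0, a, b))"
    moreover have "(0, a, b) \<noteq> K + (1,0,0)" by (cases K) simp
    ultimately show "cf K F * cf (0, a, b) (vrow c K) = 0"
      by (simp add: v mis_upto_def mi0_iff)
  qed
  then show "cf (0, a, b) (pullback (vrow c) F) = 0" by simp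
  have m: "(1, a, b) \<in> mi0" by (simp add: mi0_iff)
  have "cf (1, a, b) (pullback (vrow c) F) = (\<Sum>K\<in>mis_upto (deg (1, a, b)).
      if K = (0, a, b) then (of_nat a + c * of_nat b) *\<^sub>C cf (0, a, b) F else 0)"
    unfolding cf_pullback[OF m]
  proof (rule sum.cong[OF refl])
    fix K assume K: "K \<in> mis_upto (deg (1, a, b))"
    have e: "(1, a, b) = K + (1,0,0) \<longleftrightarrow> K = (0, a, b)" by (cases K) auto
    have k: "K \<in> mis" using K by (simp add: mis_upto_def)
    have "cf (1, a, b) (vrow c K) = (if K = (0, a, b) then (of_nat a + c * of_nat b) *\<^sub>C (1 :: 'a) else 0)"
      unfolding v[OF k m] e by (simp add: idx.simps)
    then show "cf K F * cf (1, a, b) (vrow c K)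
        = (if K = (0, a, b) then (of_nat a + c * of_nat b) *\<^sub>C cf (0, a, b) F else 0)"
      by (simp only: scaleC_mult_right mult_1_right mult_zero_right if_distrib[of "\<lambda>x. cf K F * x"] cong: if_cong)
  qed
  also have "\<dots> = (of_nat a + c * of_nat b) *\<^sub>C cf (0, a, b) F"
  proof (cases "a = 0 \<and> b = 0")
    case False
    then have "(0, a, b) \<in> mis_upto (deg (1, a, b))" by (simp add: mis_upto_def mis_iff zero_mi deg.simps)
    then show ?thesis by simp
  qed simp
  finally show ?goal1 .
qed

lemma cf_mult_yz:
  "e \<le> 1 \<Longrightarrow> cf (e, Suc a, b) (F * mon (0,1,0)) = cf (e, a, b) F"
  "e \<le> 1 \<Longrightarrow> cf (e, 0, b) (F * mon (0,1,0)) = 0"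
  "e \<le> 1 \<Longrightarrow> cf (e, a, Suc b) (F * mon (0,0,1)) = cf (e, a, b) F"
  "e \<le> 1 \<Longrightarrow> cf (e, a, 0) (F * mon (0,0,1)) = 0"
  "cf (0, a, b) (mon (1,0,0) * F) = 0"
  "cf (1, a, b) (mon (1,0,0) * F) = gsign 1 (cf (0, a, b) F)"
proof -
  assume e: "e \<le> 1"
  show "cf (e, Suc a, b) (F * mon (0,1,0)) = cf (e, a, b) F"
    using cf_mult_mon[of "(e, a, b)" "(0,1,0)" F] e by (simp add: mi0_iff)
  show "cf (e, 0, b) (F * mon (0,1,0)) = 0"
    by (rule cf_mult_mon_0) (use e in \<open>auto simp: mi0_iff\<close>)
  show "cf (e, a, Suc b) (F * mon (0,0,1)) = cf (e, a, b) F"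
    using cf_mult_mon[of "(e, a, b)" "(0,0,1)" F] e by (simp add: mi0_iff)
  show "cf (e, a, 0) (F * mon (0,0,1)) = 0"
    by (rule cf_mult_mon_0) (use e in \<open>auto simp: mi0_iff\<close>)
next
  show "cf (0, a, b) (mon (1,0,0) * F) = 0"
    by (rule cf_mon_mult_0) (auto simp: mi0_iff)
  show "cf (1, a, b) (mon (1,0,0) * F) = gsign 1 (cf (0, a, b) F)"
    using cf_mon_mult[of "(0, a, b)" "(1,0,0)" F] by (simp add: mi0_iff wpar.simps)
qed

text \<open>A gauge \<open>\<sigma>\<close> consists of the images of the coordinates under a coalgebra automorphism
  and of values for the parameters of the universal family.\<close>

record 'a gauge =
  ga :: "'a ser"
  gb :: "'a ser"
  gc :: "'a ser"
  pa :: 'a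
  pb :: 'a
  pc :: 'a
  qa :: 'a
  qb :: 'a

definition admissible :: "'a::augmented_algebra gauge \<Rightarrow> bool" where
  "admissible \<sigma> \<longleftrightarrow> homogeneous 1 (ga \<sigma>) \<and> homogeneous 0 (gb \<sigma>) \<and> homogeneous 0 (gc \<sigma>)
    \<and> cf 0 (ga \<sigma>) = 0 \<and> cf 0 (gb \<sigma>) = 0 \<and> cf 0 (gc \<sigma>) = 0
    \<and> ga \<sigma> - mon (1,0,0) \<in> ser_max \<and> gb \<sigma> - mon (0,1,0) \<in> ser_max \<and> gc \<sigma> - mon (0,0,1) \<in> ser_max
    \<and> homogeneous 0 (pa \<sigma>) \<and> homogeneous 0 (pb \<sigma>) \<and> homogeneous 0 (pc \<sigma>)
    \<and> homogeneous 1 (qa \<sigma>) \<and> homogeneous 1 (qb \<sigma>)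
    \<and> aug (pa \<sigma>) = 0 \<and> aug (pb \<sigma>) = 0 \<and> aug (pc \<sigma>) = 0"

definition mrow :: "'a::augmented_algebra gauge \<Rightarrow> mi \<Rightarrow> 'a ser" where
  "mrow \<sigma> = gam (ga \<sigma>) (gb \<sigma>) (gc \<sigma>)"

definition urow :: "complex \<Rightarrow> 'a::augmented_algebra gauge \<Rightarrow> mi \<Rightarrow> 'a ser" where
  "urow c \<sigma> = drow (lam2 (pa \<sigma>) (qa \<sigma>)) (lam3 c (pb \<sigma>) (pc \<sigma>) (qb \<sigma>))"

definition gauge_close :: "nat \<Rightarrow> 'a::augmented_algebra gauge \<Rightarrow> 'a gauge \<Rightarrow> bool" where
  "gauge_close n \<sigma> \<tau> \<longleftrightarrow> ga \<sigma> - ga \<tau> \<in> ser_power n \<and> gb \<sigma> - gb \<tau> \<in> ser_power n \<and> gc \<sigma> - gc \<tau> \<in> ser_power n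
    \<and> pa \<sigma> - pa \<tau> \<in> aug_power n \<and> pb \<sigma> - pb \<tau> \<in> aug_power n \<and> pc \<sigma> - pc \<tau> \<in> aug_power n
    \<and> qa \<sigma> - qa \<tau> \<in> aug_power n \<and> qb \<sigma> - qb \<tau> \<in> aug_power n"

lemma morphism_family_mrow: "admissible \<sigma> \<Longrightarrow> morphism_family (mrow \<sigma>)"
  unfolding mrow_def admissible_def by (intro morphism_family_gam) auto

lemma derivation_family_urow: "admissible \<sigma> \<Longrightarrow> derivation_family (urow c \<sigma>)"
  unfolding urow_def admissible_def
  by (intro derivation_family_drow homogeneous_lam2 homogeneous_lam3) auto

lemma mrow_close: "gauge_close n \<sigma> \<tau> \<Longrightarrow> mrow \<sigma> M - mrow \<tau> M \<in> ser_power n"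
  unfolding mrow_def gauge_close_def by (intro gam_cong graded_ideal_ser_power) auto

lemma urow_close: "gauge_close n \<sigma> \<tau> \<Longrightarrow> urow c \<sigma> M - urow c \<tau> M \<in> ser_power n"
  unfolding urow_def gauge_close_def
  by (intro drow_cong graded_ideal_ser_power lam_ideal graded_ideal_aug_power) auto

lemma mrow_max: "admissible \<sigma> \<Longrightarrow> M \<in> mis \<Longrightarrow> mrow \<sigma> M - mon M \<in> ser_max"
proof -
  assume "admissible \<sigma>" and M: "M \<in> mis"
  then have "gam (ga \<sigma>) (gb \<sigma>) (gc \<sigma>) M - gam (mon (1,0,0)) (mon (0,1,0)) (mon (0,0,1)) M \<in> ser_max"
    unfolding admissible_def by (intro gam_cong graded_ideal_ser_max) auto
  then show ?thesis by (simp only: gam_mon[OF M] mrow_def)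
qed

lemma urow_max: "admissible \<sigma> \<Longrightarrow> urow c \<sigma> M - vrow c M \<in> ser_max"
  unfolding urow_def vrow_def admissible_def lam2_0[symmetric] lam3_0[symmetric]
  by (intro drow_cong graded_ideal_ser_max lam_ideal graded_ideal_aug)
    (auto simp: aug_ideal_iff aug_homogeneous_1)

section \<open>The defect of a gauge and its cocycle equations\<close>

locale coderivation_rows =
  fixes c :: complex and d :: "mi \<Rightarrow> 'a::augmented_algebra ser"
  assumes der: "derivation_family d"
    and square: "M \<in> mis \<Longrightarrow> pullback d (d M) = 0"
    and reduction: "M \<in> mis \<Longrightarrow> d M - vrow c M \<in> ser_max"
begin

text \<open>\<open>defect \<sigma> M\<close> is the \<open>M\<close>-th row of \<open>g D - d g\<close>, with \<open>g\<close> and \<open>D\<close> given by \<open>\<sigma>\<close>.\<close>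

definition defect :: "'a gauge \<Rightarrow> mi \<Rightarrow> 'a ser" where
  "defect \<sigma> M = pullback (urow c \<sigma>) (mrow \<sigma> M) - pullback (mrow \<sigma>) (d M)"

lemma tri_d: "triangular d" and par_d: "M \<in> mis \<Longrightarrow> homogeneous (1 + wpar M) (d M)"
  using der by (auto simp: derivation_family_def)

lemma cf_0_d: "M \<in> mis \<Longrightarrow> cf 0 (d M) = 0"
  by (rule triangular_cf_0[OF tri_d])

lemma mrow_facts:
  assumes "admissible \<sigma>"
  shows "triangular (mrow \<sigma>)" "M \<in> mis \<Longrightarrow> homogeneous (wpar M) (mrow \<sigma> M)"
    "M \<in> mis \<Longrightarrow> cf 0 (mrow \<sigma> M) = 0"
    "J \<in> mis \<Longrightarrow> K \<in> mis \<Longrightarrow> J + K \<in> mis \<Longrightarrow> mrow \<sigma> (J + K) = mrow \<sigma> J * mrow \<sigma> K"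
proof -
  note m = morphism_family_mrow[OF assms]
  show t: "triangular (mrow \<sigma>)" using m by (simp add: morphism_family_def)
  show "M \<in> mis \<Longrightarrow> homogeneous (wpar M) (mrow \<sigma> M)"
    "M \<in> mis \<Longrightarrow> cf 0 (mrow \<sigma> M) = 0"
    using m triangular_cf_0[OF t] by (auto simp: morphism_family_def)
  show "J \<in> mis \<Longrightarrow> K \<in> mis \<Longrightarrow> J + K \<in> mis \<Longrightarrow> mrow \<sigma> (J + K) = mrow \<sigma> J * mrow \<sigma> K"
    using m unfolding morphism_family_def by metis
qed

text \<open>Since g is multiplicative while D and d are derivations, \<open>g D - d g\<close> is a
  derivation along g. Its three values on the coordinates determine it.\<close>

lemma defect_add:
  assumes \<sigma>: "admissible \<sigma>" and JK: "J \<in> mis" "K \<in> mis" "J + K \<in> mis"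
  shows "defect \<sigma> (J + K) = mrow \<sigma> J * defect \<sigma> K + ksign (wpar K) * (defect \<sigma> J * mrow \<sigma> K)"
proof -
  let ?D = "urow c \<sigma>" and ?g = "mrow \<sigma>"
  note m = morphism_family_mrow[OF \<sigma>] and g = mrow_facts[OF \<sigma>]
  have k: "pullback r (ksign p * F) = ksign p * pullback r F" for r p and F :: "'a ser"
    by (cases p) (simp_all add: pullback_minus)
  have 1: "pullback ?D (?g (J + K)) = ?g J * pullback ?D (?g K) + pullback ?D (?g J) * (ksign (wpar K) * ?g K)"
    unfolding g(4)[OF JK]
    using pullback_derivation[OF derivation_family_urow[OF \<sigma>] g(3)[OF JK(1)] g(2)[OF JK(1)] g(3)[OF JK(2)]]
      gsign_homogeneous[OF g(2)[OF JK(2)], of 1] by simp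
  have "d (J + K) = ksign (wpar K) * (d J * mon K) + mon J * d K"
    using der JK unfolding derivation_family_def by metis
  then have 2: "pullback ?g (d (J + K)) = ksign (wpar K) * (pullback ?g (d J) * ?g K) + ?g J * pullback ?g (d K)"
    by (simp add: pullback_add k pullback_mult_mon[OF m cf_0_d[OF JK(1)] JK(2)]
        pullback_mon_mult[OF m cf_0_d[OF JK(2)] par_d[OF JK(2)] JK(1)])
  show ?thesis
    unfolding defect_def 1 2 by (cases "wpar K") (simp_all add: algebra_simps)
qed

lemma defect_ideal:
  assumes \<sigma>: "admissible \<sigma>" and A: "graded_ideal A" and M: "M \<in> mis"
    and "defect \<sigma> (1,0,0) \<in> ser_ideal A" "defect \<sigma> (0,1,0) \<in> ser_ideal A"
      "defect \<sigma> (0,0,1) \<in> ser_ideal A"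
  shows "defect \<sigma> M \<in> ser_ideal A"
  using M
proof (induction rule: mis_induct)
  case (4 J K)
  then show ?case
    unfolding defect_add[OF \<sigma> 4(1-3)]
    by (intro ideal_add ideal_left ideal_right graded_ideal_ser A)
qed (use assms in auto)

text \<open>In terms of maps: (g D - d g) D + d (g D - d g) = g D^2, as d^2 = 0. The term on the
  right stays because the relations between the parameters are not assumed here.\<close>

lemma defect_closed:
  assumes \<sigma>: "admissible \<sigma>" and M: "M \<in> mis"
  shows "pullback (defect \<sigma>) (d M) + pullback (urow c \<sigma>) (defect \<sigma> M) = pullback (urow c \<sigma>) (pullback (urow c \<sigma>) (mrow \<sigma> M))"
proof -
  let ?D = "urow c \<sigma>" and ?g = "mrow \<sigma>"
  have tD: "triangular ?D" using derivation_family_urow[OF \<sigma>] by (simp add: derivation_family_def)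
  note tg = mrow_facts(1)[OF \<sigma>] and c0 = cf_0_d[OF M]
  have "pullback (defect \<sigma>) (d M) = pullback (\<lambda>M. pullback ?D (?g M)) (d M) - pullback (\<lambda>M. pullback ?g (d M)) (d M)"
    unfolding defect_def[abs_def] by (rule pullback_family_diff)
  also have "\<dots> = pullback ?D (pullback ?g (d M)) - pullback ?g (pullback d (d M))"
    by (simp only: pullback_pullback[OF tD tg c0] pullback_pullback[OF tg tri_d c0])
  finally show ?thesis
    by (simp add: square[OF M] defect_def pullback_diff)
qed

end

lemma mult_approx:
  assumes a: "a \<in> ser_power n" and g: "g - m \<in> ser_max"
  shows "a * g - a * m \<in> ser_power (Suc n)" "g * a - m * a \<in> ser_power (Suc n)"
  using ser_power_mult[OF g a] by (simp_all only: right_diff_distrib left_diff_distrib)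

lemma pullback_family_approx:
  assumes "F - G \<in> ser_max" "\<And>K. K \<in> mis \<Longrightarrow> r K \<in> ser_power n"
  shows "pullback r F - pullback r G \<in> ser_power (Suc n)"
  using pullback_power_family[OF assms] by (simp only: pullback_diff)

lemma pullback_arg_approx:
  assumes "F \<in> ser_power n" "\<And>K. K \<in> mis \<Longrightarrow> r K - r' K \<in> ser_max"
  shows "pullback r F - pullback r' F \<in> ser_power (Suc n)"
  using pullback_power_arg[OF assms(1), of "\<lambda>K. r K - r' K"] assms(2) by (simp only: pullback_family_diff)

lemma triangular_diff: "triangular r \<Longrightarrow> triangular r' \<Longrightarrow> triangular (\<lambda>M. r M - r' M)"
  by (simp add: triangular_def cf_diff)

lemma ideal_eq_mod:
  assumes "graded_ideal A" "x - a \<in> A" "y - b \<in> A" shows "x + y - (a + b) \<in> A"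
    "x - y - (a - b) \<in> A"
  using ideal_add[OF assms] ideal_diff[OF assms] by (simp_all add: algebra_simps)

lemma aug_power_cf: "F \<in> ser_power n \<Longrightarrow> cf I F \<in> aug_power n"
  by (simp add: ser_ideal_def)

context coderivation_rows
begin

lemma urow_facts:
  assumes "admissible \<sigma>"
  shows "triangular (urow c \<sigma>)" "M \<in> mis \<Longrightarrow> homogeneous (1 + wpar M) (urow c \<sigma> M)"
    "M \<in> mis \<Longrightarrow> pullback (urow c \<sigma>) (mon M) = urow c \<sigma> M"
  using derivation_family_urow[OF assms, of c] pullback_mon[of "urow c \<sigma>" M] by (auto simp: derivation_family_def)

lemma triangular_defect:
  assumes "admissible \<sigma>" shows "triangular (defect \<sigma>)"
  unfolding defect_def[abs_def]
  by (intro triangular_diff triangular_pullback mrow_facts(1) assms tri_d)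

lemma homogeneous_defect:
  assumes \<sigma>: "admissible \<sigma>" and M: "M \<in> mis" shows "homogeneous (1 + wpar M) (defect \<sigma> M)"
proof -
  have "homogeneous (0 + (1 + wpar M)) (pullback (mrow \<sigma>) (d M))"
    by (rule homogeneous_pullback[OF _ par_d[OF M]]) (simp add: mrow_facts(2)[OF \<sigma>])
  then show ?thesis
    unfolding defect_def using homogeneous_pullback[OF urow_facts(2)[OF \<sigma>] mrow_facts(2)[OF \<sigma> M]]
    by (intro homogeneous_diff) simp_all
qed

lemma urow_square:
  assumes \<sigma>: "admissible \<sigma>" and q: "qa \<sigma> * pa \<sigma> \<in> A"
    "qb \<sigma> * pb \<sigma> \<in> A" and A: "graded_ideal A"
    and M: "M \<in> mis"
  shows "pullback (urow c \<sigma>) (urow c \<sigma> M) \<in> ser_ideal A"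
proof -
  have h: "homogeneous 0 (pa \<sigma>)" "homogeneous 0 (pb \<sigma>)" "homogeneous 0 (pc \<sigma>)"
    "homogeneous 1 (qa \<sigma>)"
    "homogeneous 1 (qb \<sigma>)" using \<sigma> by (auto simp: admissible_def)
  show ?thesis
    by (rule square_ideal[OF derivation_family_urow[OF \<sigma>] A _ _ _ M])
      (use universal_square[OF h, of c] ideal_zero[OF graded_ideal_ser[OF A]] q in
        \<open>simp_all add: urow_def cst_ideal[OF A] ideal_right[OF graded_ideal_ser[OF A]]\<close>)
qed

text \<open>As the defect lies in the n-th power, d and D may be replaced by d_c at the cost of the
  next power. The relations modulo the n-th power put D^2 there as well, so that g may be replaced
  by the identity in g D^2.\<close>

lemma closed_mod:
  assumes \<sigma>: "admissible \<sigma>" and M: "M \<in> mis"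
    and R: "\<forall>K\<in>mis. defect \<sigma> K \<in> ser_power n"
    and q: "qa \<sigma> * pa \<sigma> \<in> aug_power n" "qb \<sigma> * pb \<sigma> \<in> aug_power n"
  shows "pullback (defect \<sigma>) (vrow c M) + pullback (vrow c) (defect \<sigma> M) - pullback (urow c \<sigma>) (urow c \<sigma> M)
    \<in> ser_power (Suc n)"
proof -
  let ?D = "urow c \<sigma>" and ?g = "mrow \<sigma>"
  have 1: "pullback (defect \<sigma>) (d M) - pullback (defect \<sigma>) (vrow c M) \<in> ser_power (Suc n)"
    by (rule pullback_family_approx[OF reduction[OF M] bspec[OF R]])
  have 2: "pullback ?D (defect \<sigma> M) - pullback (vrow c) (defect \<sigma> M) \<in> ser_power (Suc n)"
    by (rule pullback_arg_approx[OF bspec[OF R M] urow_max[OF \<sigma>]])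
  have sq: "pullback (\<lambda>K. pullback ?D (?D K)) F = pullback ?D (pullback ?D F)" if "cf 0 F = 0" for F
    by (rule pullback_pullback[symmetric, OF urow_facts(1)[OF \<sigma>] urow_facts(1)[OF \<sigma>] that])
  have c0: "cf 0 (mon M :: 'a ser) = 0" using M by (simp add: cf_mon mis_eq)
  have 3: "pullback ?D (pullback ?D (?g M)) - pullback ?D (?D M) \<in> ser_power (Suc n)"
    using pullback_family_approx[OF mrow_max[OF \<sigma> M], of "\<lambda>K. pullback ?D (?D K)" n]
      urow_square[OF \<sigma> q graded_ideal_aug_power]
    unfolding sq[OF c0] sq[OF mrow_facts(3)[OF \<sigma> M]] urow_facts(3)[OF \<sigma> M] by blast
  have "pullback (defect \<sigma>) (d M) + pullback ?D (defect \<sigma> M) - pullback ?D (pullback ?D (?g M))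
      - (pullback (defect \<sigma>) (vrow c M) + pullback (vrow c) (defect \<sigma> M) - pullback ?D (?D M)) \<in> ser_power (Suc n)"
    by (rule ideal_eq_mod(2)[OF graded_ideal_ser_power ideal_eq_mod(1)[OF graded_ideal_ser_power 1 2] 3])
  then show ?thesis
    unfolding defect_closed[OF \<sigma> M] using ideal_minus[OF graded_ideal_ser_power] by fastforce
qed

lemma defect_product:
  assumes \<sigma>: "admissible \<sigma>" and R: "\<forall>K\<in>mis. defect \<sigma> K \<in> ser_power n"
  shows "defect \<sigma> (1,1,0) - (mon (1,0,0) * defect \<sigma> (0,1,0) + defect \<sigma> (1,0,0) * mon (0,1,0)) \<in> ser_power (Suc n)" (is ?goal1)
    "defect \<sigma> (1,0,1) - (mon (1,0,0) * defect \<sigma> (0,0,1) + defect \<sigma> (1,0,0) * mon (0,0,1)) \<in> ser_power (Suc n)"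
proof -
  have "defect \<sigma> ((1,0,0) + K) - (mon (1,0,0) * defect \<sigma> K + defect \<sigma> (1,0,0) * mon K) \<in> ser_power (Suc n)"
    if K: "K \<in> mis" "(1,0,0) + K \<in> mis" "wpar K = 0" for K
  proof -
    have e: "defect \<sigma> ((1,0,0) + K) = mrow \<sigma> (1,0,0) * defect \<sigma> K + defect \<sigma> (1,0,0) * mrow \<sigma> K"
      using defect_add[OF \<sigma> unit_mis(1) K(1,2)] K(3) by simp
    show ?thesis
      unfolding e
      by (rule ideal_eq_mod(1)[OF graded_ideal_ser_power mult_approx(2)[OF bspec[OF R K(1)] mrow_max[OF \<sigma> unit_mis(1)]]
            mult_approx(1)[OF bspec[OF R unit_mis(1)] mrow_max[OF \<sigma> K(1)]]])
  qed
  from this[of "(0,1,0)"] this[of "(0,0,1)"]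
  show ?goal1
    "defect \<sigma> (1,0,1) - (mon (1,0,0) * defect \<sigma> (0,0,1) + defect \<sigma> (1,0,0) * mon (0,0,1)) \<in> ser_power (Suc n)"
    using unit_mis by (simp_all add: wpar.simps)
qed

lemma closed_units:
  assumes \<sigma>: "admissible \<sigma>" and R: "\<forall>K\<in>mis. defect \<sigma> K \<in> ser_power n"
    and q: "qa \<sigma> * pa \<sigma> \<in> aug_power n" "qb \<sigma> * pb \<sigma> \<in> aug_power n"
  shows "pullback (vrow c) (defect \<sigma> (1,0,0)) \<in> ser_power (Suc n)" (is ?goal1)
    "mon (1,0,0) * defect \<sigma> (0,1,0) + defect \<sigma> (1,0,0) * mon (0,1,0) + pullback (vrow c) (defect \<sigma> (0,1,0))
      - cst (qa \<sigma> * pa \<sigma>) * mon (1,0,0) \<in> ser_power (Suc n)" (is ?goal2)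
    "c *\<^sub>C (mon (1,0,0) * defect \<sigma> (0,0,1) + defect \<sigma> (1,0,0) * mon (0,0,1)) + pullback (vrow c) (defect \<sigma> (0,0,1))
      - cst (qb \<sigma> * pb \<sigma>) * mon (1,0,0) \<in> ser_power (Suc n)" (is ?goal3)
proof -
  have h: "homogeneous 0 (pa \<sigma>)" "homogeneous 0 (pb \<sigma>)" "homogeneous 0 (pc \<sigma>)"
    "homogeneous 1 (qa \<sigma>)"
    "homogeneous 1 (qb \<sigma>)" using \<sigma> by (auto simp: admissible_def)
  note S = universal_square[OF h, of c, folded urow_def]
  note C = closed_mod[OF \<sigma> _ R q]
  have sub: "x + y - z \<in> B \<Longrightarrow> x - x' \<in> B \<Longrightarrow> x' + y - z \<in> B" if "graded_ideal B" for B and x y z x' :: "'a ser"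
    using ideal_diff[OF that, of "x + y - z" "x - x'"] by (simp add: algebra_simps)
  note sub = sub[OF graded_ideal_ser_power]
  show ?goal1
    using C[OF unit_mis(1)] unfolding S vrow_units pullback_zero by simp
  have o: "pullback (defect \<sigma>) (mon (1,1,0)) = defect \<sigma> (1,1,0)"
    "pullback (defect \<sigma>) (mon (1,0,1)) = defect \<sigma> (1,0,1)"
    by (intro pullback_mon triangular_defect[OF \<sigma>] unit_mis)+
  show ?goal2
    using C[OF unit_mis(2)] unfolding S vrow_units o by (rule sub[OF _ defect_product(1)[OF \<sigma> R]])
  show ?goal3
    using C[OF unit_mis(3)] unfolding S vrow_units o pullback_scaleC
    by (rule sub, unfold scaleC_diff_right[symmetric])
      (rule ideal_scaleC[OF graded_ideal_ser_power defect_product(2)[OF \<sigma> R]])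
qed

text \<open>The cocycle equations sorted by weight. In the second and third, the defect contributes
  nothing at a = b = 0 for lack of constant terms, so that the obstruction stands alone; where a
  weight is 0, the equation constrains the defect at \<xi> instead.\<close>

lemma closed_coefficients:
  assumes \<sigma>: "admissible \<sigma>" and R: "\<forall>K\<in>mis. defect \<sigma> K \<in> ser_power n"
    and q: "qa \<sigma> * pa \<sigma> \<in> aug_power n" "qb \<sigma> * pb \<sigma> \<in> aug_power n"
  shows "(of_nat a + c * of_nat b) *\<^sub>C cf (0,a,b) (defect \<sigma> (1,0,0)) \<in> aug_power (Suc n)" (is ?goal1)
    "(of_nat a + c * of_nat b - 1) *\<^sub>C cf (0,a,b) (defect \<sigma> (0,1,0)) + cf (1,a,b) (defect \<sigma> (1,0,0) * mon (0,1,0))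
      - (if a = 0 \<and> b = 0 then qa \<sigma> * pa \<sigma> else 0) \<in> aug_power (Suc n)" (is ?goal2)
    "(of_nat a + c * of_nat b - c) *\<^sub>C cf (0,a,b) (defect \<sigma> (0,0,1))
      + c *\<^sub>C cf (1,a,b) (defect \<sigma> (1,0,0) * mon (0,0,1))
      - (if a = 0 \<and> b = 0 then qb \<sigma> * pb \<sigma> else 0) \<in> aug_power (Suc n)" (is ?goal3)
proof -
  note C = closed_units[OF \<sigma> R q, THEN aug_power_cf, of "(1,a,b)"]
  have g: "gsign 1 (cf (0,a,b) (defect \<sigma> K)) = - cf (0,a,b) (defect \<sigma> K)" if "K \<in> mis"
    "wpar K = 0" for K
    using gsign_homogeneous[OF homogeneous_cf[OF homogeneous_defect[OF \<sigma> that(1)]], of 1 "(0,a,b)"] that(2)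
    by (simp add: wpar.simps)
  have g': "gsign 1 (cf (0,a,b) (defect \<sigma> (0,1,0))) = - cf (0,a,b) (defect \<sigma> (0,1,0))"
    "gsign 1 (cf (0,a,b) (defect \<sigma> (0,0,1))) = - cf (0,a,b) (defect \<sigma> (0,0,1))"
    using g[OF unit_mis(2)] g[OF unit_mis(3)] by (simp_all add: wpar.simps)
  have z: "cf (1,a,b) (cst x * mon (1,0,0)) = (if a = 0 \<and> b = 0 then x else 0)" for x :: 'a
    by (simp add: cf_cst_mult cf_mon mi0_iff)
  show ?goal1
    using C(1) unfolding cf_pullback_vrow .
  show ?goal2
    using C(2) unfolding cf_add cf_diff cf_pullback_vrow z cf_mult_yz(6) g' scaleC_diff_left scaleC_one
    by (simp add: algebra_simps)
  show ?goal3
    using C(3) unfolding cf_add cf_diff cf_pullback_vrow z cf_mult_yz(6) g' scaleC_diff_left cf_scaleC scaleC_add_right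
      scaleC_minus_right
    by (simp add: algebra_simps)
qed

section \<open>First order variation of the defect\<close>

lemma variation_mod:
  assumes \<sigma>: "admissible \<sigma>" and \<tau>: "admissible \<tau>" and n: "gauge_close n \<tau> \<sigma>" and M: "M \<in> mis"
  shows "defect \<tau> M - defect \<sigma> M - (urow c \<tau> M - urow c \<sigma> M + pullback (vrow c) (mrow \<tau> M - mrow \<sigma> M)
      - (pullback (mrow \<tau>) (vrow c M) - pullback (mrow \<sigma>) (vrow c M))) \<in> ser_power (Suc n)"
proof -
  let ?u = "\<lambda>K. urow c \<tau> K - urow c \<sigma> K" and ?m = "\<lambda>K. mrow \<tau> K - mrow \<sigma> K"
  have 1: "pullback ?u (mrow \<tau> M) - pullback ?u (mon M) \<in> ser_power (Suc n)"
    by (rule pullback_family_approx[OF mrow_max[OF \<tau> M] urow_close[OF n]])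
  have 2: "pullback (urow c \<sigma>) (?m M) - pullback (vrow c) (?m M) \<in> ser_power (Suc n)"
    by (rule pullback_arg_approx[OF mrow_close[OF n] urow_max[OF \<sigma>]])
  have 3: "pullback ?m (d M) - pullback ?m (vrow c M) \<in> ser_power (Suc n)"
    by (rule pullback_family_approx[OF reduction[OF M] mrow_close[OF n]])
  have "pullback ?u (mrow \<tau> M) + pullback (urow c \<sigma>) (?m M) - pullback ?m (d M)
      - (pullback ?u (mon M) + pullback (vrow c) (?m M) - pullback ?m (vrow c M)) \<in> ser_power (Suc n)"
    by (rule ideal_eq_mod(2)[OF graded_ideal_ser_power ideal_eq_mod(1)[OF graded_ideal_ser_power 1 2] 3])
  \<comment> \<open>The difference of the defects splits exactly into the change of D, the change of
    g before D, and the change of g after d. Each piece is linear in a quantity of order n, whence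
    the linearization above.\<close>
  moreover have "pullback ?u (mrow \<tau> M) + pullback (urow c \<sigma>) (?m M) - pullback ?m (d M) = defect \<tau> M - defect \<sigma> M"
    by (simp add: pullback_family_diff pullback_diff defect_def)
  moreover have "pullback ?u (mon M) = ?u M"
    by (simp only: pullback_family_diff urow_facts(3)[OF \<sigma> M] urow_facts(3)[OF \<tau> M])
  ultimately show ?thesis by (simp only: pullback_family_diff)
qed

lemma mrow_product:
  assumes \<sigma>: "admissible \<sigma>" and \<tau>: "admissible \<tau>" and n: "gauge_close n \<tau> \<sigma>"
  shows "mrow \<tau> (1,1,0) - mrow \<sigma> (1,1,0)
      - (mon (1,0,0) * (gb \<tau> - gb \<sigma>) + (ga \<tau> - ga \<sigma>) * mon (0,1,0)) \<in> ser_power (Suc n)" (is ?goal1)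
    "mrow \<tau> (1,0,1) - mrow \<sigma> (1,0,1)
      - (mon (1,0,0) * (gc \<tau> - gc \<sigma>) + (ga \<tau> - ga \<sigma>) * mon (0,0,1)) \<in> ser_power (Suc n)" (is ?goal2)
proof -
  have s: "ga \<sigma> - mon (1,0,0) \<in> ser_max" "gb \<tau> - mon (0,1,0) \<in> ser_max"
    "gc \<tau> - mon (0,0,1) \<in> ser_max"
    using \<sigma> \<tau> by (simp_all only: admissible_def)
  have d: "ga \<tau> - ga \<sigma> \<in> ser_power n" "gb \<tau> - gb \<sigma> \<in> ser_power n"
    "gc \<tau> - gc \<sigma> \<in> ser_power n"
    using n by (simp_all only: gauge_close_def)
  show ?goal1
    using ideal_eq_mod(1)[OF graded_ideal_ser_power mult_approx(2)[OF d(2) s(1)] mult_approx(1)[OF d(1) s(2)]]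
    unfolding mrow_def gam_units by (simp add: algebra_simps)
  show ?goal2
    using ideal_eq_mod(1)[OF graded_ideal_ser_power mult_approx(2)[OF d(3) s(1)] mult_approx(1)[OF d(1) s(3)]]
    unfolding mrow_def gam_units by (simp add: algebra_simps)
qed

lemma variation_units:
  assumes \<sigma>: "admissible \<sigma>" and \<tau>: "admissible \<tau>" and n: "gauge_close n \<tau> \<sigma>"
  shows "defect \<tau> (1,0,0) - defect \<sigma> (1,0,0) - pullback (vrow c) (ga \<tau> - ga \<sigma>) \<in> ser_power (Suc n)" (is ?goal1)
    "defect \<tau> (0,1,0) - defect \<sigma> (0,1,0) - (cst (pa \<tau> - pa \<sigma>) * mon (1,0,0) + cst (qa \<tau> - qa \<sigma>) * mon (0,1,0)
      + pullback (vrow c) (gb \<tau> - gb \<sigma>) - (mon (1,0,0) * (gb \<tau> - gb \<sigma>) + (ga \<tau> - ga \<sigma>) * mon (0,1,0)))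
      \<in> ser_power (Suc n)" (is ?goal2)
    "defect \<tau> (0,0,1) - defect \<sigma> (0,0,1) - (cst (pb \<tau> - pb \<sigma>) * mon (1,0,0) + cst (pc \<tau> - pc \<sigma>) * mon (1,0,1)
      + cst (qb \<tau> - qb \<sigma>) * mon (0,0,1)
      + pullback (vrow c) (gc \<tau> - gc \<sigma>) - c *\<^sub>C (mon (1,0,0) * (gc \<tau> - gc \<sigma>) + (ga \<tau> - ga \<sigma>) * mon (0,0,1)))
      \<in> ser_power (Suc n)" (is ?goal3)
proof -
  note V = variation_mod[OF \<sigma> \<tau> n]
  have m: "mrow \<rho> (1,0,0) = ga \<rho>" "mrow \<rho> (0,1,0) = gb \<rho>"
    "mrow \<rho> (0,0,1) = gc \<rho>" for \<rho> :: "'a gauge"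
    by (simp_all only: mrow_def gam_units)
  have u: "urow c \<rho> (1,0,0) = 0" "urow c \<rho> (0,1,0) = lam2 (pa \<rho>) (qa \<rho>)"
    "urow c \<rho> (0,0,1) = lam3 c (pb \<rho>) (pc \<rho>) (qb \<rho>)" for \<rho> :: "'a gauge"
    by (simp_all only: urow_def drow_units)
  have o: "pullback (mrow \<rho>) (mon (1,1,0)) = mrow \<rho> (1,1,0)"
    "pullback (mrow \<rho>) (mon (1,0,1)) = mrow \<rho> (1,0,1)"
    if "admissible \<rho>" for \<rho>
    by (intro pullback_mon mrow_facts(1) that unit_mis)+
  have sub: "x - (y - z) \<in> B \<Longrightarrow> z - z' \<in> B \<Longrightarrow> x - (y - z') \<in> B" if "graded_ideal B" for B and x y z z' :: "'a ser"
    using ideal_diff[OF that, of "x - (y - z)" "z - z'"] by (simp add: algebra_simps)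
  note sub = sub[OF graded_ideal_ser_power]
  show ?goal1
    using V[OF unit_mis(1)] unfolding m u vrow_units pullback_zero by simp
  show ?goal2
    using V[OF unit_mis(2)] unfolding m u vrow_units o[OF \<sigma>] o[OF \<tau>] lam_diff
    by (rule sub[OF _ mrow_product(1)[OF \<sigma> \<tau> n]])
  show ?goal3
    using V[OF unit_mis(3)] unfolding m u vrow_units pullback_scaleC o[OF \<sigma>] o[OF \<tau>] lam_diff
    by (rule sub, unfold scaleC_diff_right[symmetric])
      (rule ideal_scaleC[OF graded_ideal_ser_power mrow_product(2)[OF \<sigma> \<tau> n]])
qed

text \<open>Read forwards, these congruences show which change of coordinates and parameters removes
  a given error. Read with both defects zero, they show that the parameters cannot differ to first
  order.\<close>

lemma variation_coefficients:
  assumes \<sigma>: "admissible \<sigma>" and \<tau>: "admissible \<tau>" and n: "gauge_close n \<tau> \<sigma>"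
  defines "x1 \<equiv> ga \<tau> - ga \<sigma>" and "x2 \<equiv> gb \<tau> - gb \<sigma>" and "x3 \<equiv> gc \<tau> - gc \<sigma>"
  shows "cf (0,a,b) (defect \<tau> (1,0,0)) - cf (0,a,b) (defect \<sigma> (1,0,0)) \<in> aug_power (Suc n)" (is ?goal1)
    "cf (1,a,b) (defect \<tau> (1,0,0)) - cf (1,a,b) (defect \<sigma> (1,0,0))
      - (of_nat a + c * of_nat b) *\<^sub>C cf (0,a,b) x1 \<in> aug_power (Suc n)" (is ?goal2)
    "cf (0,a,b) (defect \<tau> (0,1,0)) - cf (0,a,b) (defect \<sigma> (0,1,0))
      - ((if a = 1 \<and> b = 0 then qa \<tau> - qa \<sigma> else 0) - cf (0,a,b) (x1 * mon (0,1,0))) \<in> aug_power (Suc n)" (is ?goal3)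
    "cf (1,a,b) (defect \<tau> (0,1,0)) - cf (1,a,b) (defect \<sigma> (0,1,0))
      - ((if a = 0 \<and> b = 0 then pa \<tau> - pa \<sigma> else 0) + (of_nat a + c * of_nat b - 1) *\<^sub>C cf (0,a,b) x2
        - cf (1,a,b) (x1 * mon (0,1,0))) \<in> aug_power (Suc n)" (is ?goal4)
    "cf (0,a,b) (defect \<tau> (0,0,1)) - cf (0,a,b) (defect \<sigma> (0,0,1))
      - ((if a = 0 \<and> b = 1 then qb \<tau> - qb \<sigma> else 0) - c *\<^sub>C cf (0,a,b) (x1 * mon (0,0,1))) \<in> aug_power (Suc n)" (is ?goal5)
    "cf (1,a,b) (defect \<tau> (0,0,1)) - cf (1,a,b) (defect \<sigma> (0,0,1))
      - ((if a = 0 \<and> b = 0 then pb \<tau> - pb \<sigma> else 0) + (if a = 0 \<and> b = 1 then pc \<tau> - pc \<sigma> else 0)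
        + (of_nat a + c * of_nat b - c) *\<^sub>C cf (0,a,b) x3 - c *\<^sub>C cf (1,a,b) (x1 * mon (0,0,1)))
      \<in> aug_power (Suc n)" (is ?goal6)
proof -
  note V = variation_units[OF \<sigma> \<tau> n, THEN aug_power_cf, folded x1_def x2_def x3_def]
  have "homogeneous 0 x2" "homogeneous 0 x3"
    using \<sigma> \<tau> by (simp_all add: x2_def x3_def admissible_def homogeneous_diff)
  from this[THEN homogeneous_cf, of "(0,a,b)"] have g: "gsign 1 (cf (0,a,b) x2) = cf (0,a,b) x2"
    "gsign 1 (cf (0,a,b) x3) = cf (0,a,b) x3"
    by (simp_all add: wpar.simps gsign_even)
  have z: "cf (1,a,b) (cst x * mon (1,0,0)) = (if a = 0 \<and> b = 0 then x else 0)"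
    "cf (1,a,b) (cst x * mon (1,0,1)) = (if a = 0 \<and> b = 1 then x else 0)"
    "cf (1,a,b) (cst x * mon (0,a',b')) = 0" "cf (0,a,b) (cst x * mon (1,a',b')) = 0"
    "cf (0,a,b) (cst x * mon (0,1,0)) = (if a = 1 \<and> b = 0 then x else 0)"
    "cf (0,a,b) (cst x * mon (0,0,1)) = (if a = 0 \<and> b = 1 then x else 0)" for x :: 'a and a' b'
    by (simp_all add: cf_cst_mult cf_mon mi0_iff)
  note simps = cf_add cf_diff cf_pullback_vrow z cf_mult_yz(5,6) g scaleC_diff_left cf_scaleC scaleC_add_right scaleC_one
    add_0_left add_0_right diff_0_right scaleC_zero_right
  show ?goal1
    using V(1)[of "(0,a,b)"] unfolding simps .
  show ?goal2
    using V(1)[of "(1,a,b)"] unfolding simps .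
  show ?goal3
    using V(2)[of "(0,a,b)"] unfolding simps .
  show ?goal4
    using V(2)[of "(1,a,b)"] unfolding simps by (simp add: algebra_simps)
  show ?goal5
    using V(3)[of "(0,a,b)"] unfolding simps .
  show ?goal6
    using V(3)[of "(1,a,b)"] unfolding simps by (simp add: algebra_simps)
qed

end

lemma aug_power_aug:
  assumes "x \<in> aug_power n" "n \<ge> 1" shows "x \<in> aug_ideal"
  using assms aug_power_antimono[of 1 n] by auto

lemma ser_power_ser_max:
  assumes "F \<in> ser_power n" "n \<ge> 1" shows "F \<in> ser_max"
  using assms aug_power_aug[OF _ assms(2)] by (auto simp: ser_ideal_def)

section \<open>Correction of a gauge to the next order\<close>

locale generic_rows = coderivation_rows +
  assumes generic: "of_nat a + c * of_nat b = 0 \<Longrightarrow> a = 0 \<and> b = 0"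
    "of_nat a + c * of_nat b = 1 \<Longrightarrow> a = 1 \<and> b = 0"
    "of_nat a + c * of_nat b = c \<Longrightarrow> a = 0 \<and> b = 1"
begin

definition good :: "nat \<Rightarrow> 'a gauge \<Rightarrow> bool" where
  "good n \<sigma> \<longleftrightarrow> admissible \<sigma> \<and> (\<forall>M\<in>mis. defect \<sigma> M \<in> ser_power n)
     \<and> qa \<sigma> * pa \<sigma> \<in> aug_power n \<and> qb \<sigma> * pb \<sigma> \<in> aug_power n"

lemma ser_mi0_cases:
  assumes "\<And>a b. cf (0,a,b) F \<in> A" "\<And>a b. cf (1,a,b) F \<in> A" "graded_ideal A"
  shows "F \<in> ser_ideal A"
  unfolding ser_ideal_iff[OF assms(3)]
proof
  fix I :: mi assume "I \<in> mi0"
  moreover obtain e a b where "I = (e, a, b)" by (cases I)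
  ultimately have "I = (0, a, b) \<or> I = (1, a, b)" by (auto simp: mi0_iff)
  then show "cf I F \<in> A" using assms(1,2) by auto
qed

text \<open>The corrections have coefficients in the n-th power, so only their linear effect matters
  modulo the next one. Errors that no correction can reach are of higher order already, by the
  cocycle equations. The condition on n puts the corrections into the maximal ideal and keeps the
  gauge admissible.\<close>

lemma good_step:
  assumes g: "good n \<sigma>" and n: "n \<ge> 1"
  shows "\<exists>\<tau>. good (Suc n) \<tau> \<and> gauge_close n \<tau> \<sigma>"
proof -
  have \<sigma>: "admissible \<sigma>" and R: "\<forall>M\<in>mis. defect \<sigma> M \<in> ser_power n"
    and q: "qa \<sigma> * pa \<sigma> \<in> aug_power n" "qb \<sigma> * pb \<sigma> \<in> aug_power n"
    using g by (auto simp: good_def)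
  note G = graded_ideal_aug_power[where 'a = 'a]
  define r1 where "r1 I = cf I (defect \<sigma> (1,0,0))" for I
  define r2 where "r2 I = cf I (defect \<sigma> (0,1,0))" for I
  define r3 where "r3 I = cf I (defect \<sigma> (0,0,1))" for I
  have rn: "r1 I \<in> aug_power n" "r2 I \<in> aug_power n" "r3 I \<in> aug_power n" for I
    unfolding r1_def r2_def r3_def by (intro aug_power_cf bspec[OF R] unit_mis)+
  have r0: "r1 0 = 0" "r2 0 = 0" "r3 0 = 0"
    unfolding r1_def r2_def r3_def
    by (intro triangular_cf_0[OF triangular_defect[OF \<sigma>]] unit_mis)+
  have rp: "homogeneous (wpar I) (r1 I)" "homogeneous (1 + wpar I) (r2 I)"
    "homogeneous (1 + wpar I) (r3 I)" for I
    unfolding r1_def r2_def r3_def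
    using homogeneous_cf[OF homogeneous_defect[OF \<sigma> unit_mis(1)], of I]
      homogeneous_cf[OF homogeneous_defect[OF \<sigma> unit_mis(2)], of I]
      homogeneous_cf[OF homogeneous_defect[OF \<sigma> unit_mis(3)], of I]
    by (simp_all add: wpar.simps)
  \<comment> \<open>\<open>[d_c, -]\<close> multiplies coefficients by the weights \<open>a + c b\<close>, \<open>a + c b - 1\<close>, \<open>a + c b - c\<close>. Errors
    of non-zero weight are divided away; the remaining ones are absorbed by the parameters, except
    that the multiple of \<open>\<xi> y \<partial>_y\<close> is removed by rescaling \<open>\<xi>\<close>.\<close>
  define x1 where "x1 = mk (\<lambda>(e, a, b). if e = 0
      then if a = 0 \<and> b = 0 then 0 else (- 1 / (of_nat a + c * of_nat b)) *\<^sub>C r1 (1,a,b)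
      else if a = 0 \<and> b = 0 then r2 (1,1,0) else 0)"
  define x2 where "x2 = mk (\<lambda>(e, a, b). if e = 0 \<and> \<not> (a = 0 \<and> b = 0) \<and> \<not> (a = 1 \<and> b = 0)
      then (- 1 / (of_nat a + c * of_nat b - 1)) *\<^sub>C r2 (1,a,b) else 0)"
  define x3 where "x3 = mk (\<lambda>(e, a, b). if e = 0 \<and> \<not> (a = 0 \<and> b = 0) \<and> \<not> (a = 0 \<and> b = 1)
      then (- 1 / (of_nat a + c * of_nat b - c)) *\<^sub>C r3 (1,a,b) else 0)"
  have cx1: "cf (0,a,b) x1 = (if a = 0 \<and> b = 0 then 0 else (- 1 / (of_nat a + c * of_nat b)) *\<^sub>C r1 (1,a,b))"
    "cf (1,a,b) x1 = (if a = 0 \<and> b = 0 then r2 (1,1,0) else 0)" for a b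
    by (simp_all add: x1_def cf_mk mi0_iff)
  have cx2: "cf (0,a,b) x2 = (if \<not> (a = 0 \<and> b = 0) \<and> \<not> (a = 1 \<and> b = 0)
      then (- 1 / (of_nat a + c * of_nat b - 1)) *\<^sub>C r2 (1,a,b) else 0)" "cf (1,a,b) x2 = 0" for a b
    by (simp_all add: x2_def cf_mk mi0_iff)
  have cx3: "cf (0,a,b) x3 = (if \<not> (a = 0 \<and> b = 0) \<and> \<not> (a = 0 \<and> b = 1)
      then (- 1 / (of_nat a + c * of_nat b - c)) *\<^sub>C r3 (1,a,b) else 0)" "cf (1,a,b) x3 = 0" for a b
    by (simp_all add: x3_def cf_mk mi0_iff)
  have xn: "x1 \<in> ser_power n" "x2 \<in> ser_power n" "x3 \<in> ser_power n"
    by (rule ser_mi0_cases[OF _ _ G]; simp only: cx1 cx2 cx3; simp add: ideal_zero[OF G] ideal_scaleC[OF G] rn)+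
  have xp: "homogeneous 1 x1" "homogeneous 0 x2" "homogeneous 0 x3"
    unfolding x1_def x2_def x3_def using rp(1)[of "(1,_,_)"] rp(2)[of "(1,_,_)"] rp(3)[of "(1,_,_)"]
    by (intro homogeneous_mk; clarsimp simp: mi0_iff wpar.simps le_Suc_eq homogeneous_scaleC)+
  have x0: "cf 0 x1 = 0" "cf 0 x2 = 0" "cf 0 x3 = 0"
    unfolding zero_mi cx1 cx2 cx3 by simp_all
  \<comment> \<open>The rescaling of \<xi> in \<open>x1\<close> acts on all of d_c, hence also on
    the term c \<xi> z; the last summand of \<open>pc\<close> compensates for this.\<close>
  define \<tau> where "\<tau> = \<lparr>ga = ga \<sigma> + x1, gb = gb \<sigma> + x2, gc = gc \<sigma> + x3,
    pa = pa \<sigma> - r2 (1,0,0), pb = pb \<sigma> - r3 (1,0,0), pc = pc \<sigma> - r3 (1,0,1) + c *\<^sub>C r2 (1,1,0),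
    qa = qa \<sigma> - r2 (0,1,0), qb = qb \<sigma> - r3 (0,0,1)\<rparr>"
  have \<tau>s: "ga \<tau> = ga \<sigma> + x1" "gb \<tau> = gb \<sigma> + x2" "gc \<tau> = gc \<sigma> + x3"
    "pa \<tau> = pa \<sigma> - r2 (1,0,0)" "pb \<tau> = pb \<sigma> - r3 (1,0,0)"
    "pc \<tau> = pc \<sigma> - r3 (1,0,1) + c *\<^sub>C r2 (1,1,0)"
    "qa \<tau> = qa \<sigma> - r2 (0,1,0)" "qb \<tau> = qb \<sigma> - r3 (0,0,1)"
    by (simp_all add: \<tau>_def)
  have close: "gauge_close n \<tau> \<sigma>"
    unfolding gauge_close_def \<tau>s
    using xn rn ideal_minus[OF G rn(2), of _] ideal_minus[OF G rn(3)]
      ideal_diff[OF G ideal_scaleC[OF G rn(2)] rn(3), of c "(1,1,0)" "(1,0,1)"]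
    by simp
  have rm: "aug (r2 I) = 0" "aug (r3 I) = 0" for I
    using aug_power_aug[OF rn(2) n, of I] aug_power_aug[OF rn(3) n, of I] by (simp_all add: aug_ideal_iff)
  have "homogeneous 0 (r2 (1,a,b))" "homogeneous 0 (r3 (1,a,b))" "homogeneous 1 (r2 (0,a,b))"
    "homogeneous 1 (r3 (0,a,b))" for a b
    using rp(2)[of "(1,a,b)"] rp(3)[of "(1,a,b)"] rp(2)[of "(0,a,b)"] rp(3)[of "(0,a,b)"] by (simp_all add: wpar.simps)
  note hr = this
  have xm: "x1 \<in> ser_max" "x2 \<in> ser_max" "x3 \<in> ser_max"
    by (intro ser_power_ser_max[OF _ n] xn)+
  have sm: "F - m \<in> ser_max \<Longrightarrow> x \<in> ser_max \<Longrightarrow> F + x - m \<in> ser_max" for F m x :: "'a ser"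
    using ideal_add[OF graded_ideal_ser_max, of "F - m" x] by (simp add: algebra_simps)
  have \<tau>: "admissible \<tau>"
    using \<sigma> unfolding admissible_def \<tau>s
    by (intro conjI homogeneous_add homogeneous_diff homogeneous_scaleC xp hr sm xm)
      (auto simp: cf_add x0 aug_diff aug_add aug_scaleC rm)
  note C = closed_coefficients[OF \<sigma> R q, folded r1_def r2_def r3_def]
  note V = variation_coefficients[OF \<sigma> \<tau> close, folded r1_def r2_def r3_def, unfolded \<tau>s add_diff_cancel_left']
  let ?A = "aug_power (Suc n) :: 'a set"
  have S: "s *\<^sub>C x \<in> ?A \<Longrightarrow> s \<noteq> 0 \<Longrightarrow> x \<in> ?A" for s x
    using ideal_scaleC_iff[OF G] by blast
  have sub: "x \<in> ?A" if "x - y - z \<in> ?A" "y + z \<in> ?A" for x y z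
    using ideal_add[OF G that] by simp
  have Y: "cf (1, 0, b) (F * mon (0,1,0)) = 0" "cf (1, Suc a, b) (F * mon (0,1,0)) = cf (1, a, b) F"
    "cf (1, a, 0) (F * mon (0,0,1)) = 0" "cf (1, a, Suc b) (F * mon (0,0,1)) = cf (1, a, b) F"
    "cf (0, 0, b) (F * mon (0,1,0)) = 0" "cf (0, Suc a, b) (F * mon (0,1,0)) = cf (0, a, b) F"
    "cf (0, a, 0) (F * mon (0,0,1)) = 0" "cf (0, a, Suc b) (F * mon (0,0,1)) = cf (0, a, b) F"
    for F :: "'a ser" and a b
    by (rule cf_mult_yz; simp)+
  note Y' = Y[unfolded One_nat_def] and cx1' = cx1[unfolded One_nat_def]
  have N: "w *\<^sub>C (- 1 / w) *\<^sub>C x = - x" if "w \<noteq> 0" for w and x :: 'a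
    using that by (simp add: scaleC_scaleC scaleC_minus_left scaleC_minus_right scaleC_one)
  have k1: "r1 (0,a,b) \<in> ?A" for a b
  proof (cases "a = 0 \<and> b = 0")
    case False
    then show ?thesis using S[OF C(1)] generic(1) by blast
  qed (use r0 ideal_zero[OF G] in \<open>simp add: zero_mi\<close>)
  \<comment> \<open>At exponent 0 the cocycle equation consists of the obstruction alone, so the
    relation holds to the next order even before the correction.\<close>
  have ka: "qa \<sigma> * pa \<sigma> \<in> ?A"
    using C(2)[of 0 0] r0(2) ideal_minus[OF G] unfolding Y zero_mi by fastforce
  have kb: "qb \<sigma> * pb \<sigma> \<in> ?A"
    using C(3)[of 0 0] r0(3) ideal_minus[OF G] unfolding Y zero_mi by fastforce
  have k2: "(of_nat a + c * of_nat b - 1) *\<^sub>C r2 (0,a,b) + cf (1,a,b) (defect \<sigma> (1,0,0) * mon (0,1,0)) \<in> ?A" for a b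
    using C(2)[of a b] ideal_add[OF G C(2)[of a b] ka] by (cases "a = 0 \<and> b = 0") auto
  have k3: "(of_nat a + c * of_nat b - c) *\<^sub>C r3 (0,a,b) + c *\<^sub>C cf (1,a,b) (defect \<sigma> (1,0,0) * mon (0,0,1)) \<in> ?A" for a b
    using C(3)[of a b] ideal_add[OF G C(3)[of a b] kb] by (cases "a = 0 \<and> b = 0") auto
  \<comment> \<open>The multiple of \<xi> in the defect at \<xi> has weight 0 and cannot be divided
    away. In the equation for y at exponent (1,0) the term of y itself has weight 0, and what is
    left says that this multiple is already of higher order.\<close>
  have k4: "r1 (1,0,0) \<in> ?A"
  proof -
    have "cf (1, Suc 0, 0) (defect \<sigma> (1,0,0) * mon (0,1,0)) = r1 (1,0,0)"
      unfolding Y r1_def by (rule refl)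
    then show ?thesis using k2[of "Suc 0" 0] by simp
  qed
  have D1: "defect \<tau> (1,0,0) \<in> ser_power (Suc n)"
  proof (rule ser_mi0_cases[OF _ _ G])
    fix a b
    show "cf (0,a,b) (defect \<tau> (1,0,0)) \<in> ?A"
      using V(1)[of a b] k1[of a b] ideal_cong[OF G] by blast
    have "r1 (1,a,b) + (of_nat a + c * of_nat b) *\<^sub>C cf (0,a,b) x1 \<in> ?A"
    proof (cases "a = 0 \<and> b = 0")
      case False
      then have w: "of_nat a + c * of_nat b \<noteq> 0" using generic(1) by blast
      show ?thesis unfolding cx1 if_not_P[OF False] N[OF w] by (simp add: ideal_zero[OF G])
    qed (use k4 in \<open>simp\<close>)
    then show "cf (1,a,b) (defect \<tau> (1,0,0)) \<in> ?A" by (rule sub[OF V(2)])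
  qed
  have D2: "defect \<tau> (0,1,0) \<in> ser_power (Suc n)"
  proof (rule ser_mi0_cases[OF _ _ G])
    fix a b
    \<comment> \<open>Among the \<xi>-free errors at y only the multiple of y is absorbed by a
      parameter. The others are of higher order by \<open>k2\<close> if a = 0, and otherwise they
      are removed by the choice of \<open>x1\<close> made for \<xi>, since \<open>k2\<close> ties
      them to the error there.\<close>
    have "r2 (0,a,b) + ((if a = 1 \<and> b = 0 then qa \<sigma> - r2 (0,1,0) - qa \<sigma> else 0) - cf (0,a,b) (x1 * mon (0,1,0))) \<in> ?A"
    proof (cases a)
      case 0
      have "r2 (0,0,b) \<in> ?A"
      proof (cases "b = 0")
        case False
        then have "of_nat 0 + c * of_nat b - 1 \<noteq> 0" using generic(2)[of 0 b] by auto
        then show ?thesis using k2[of 0 b] S unfolding Y by simp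
      qed (use r0 ideal_zero[OF G] in \<open>simp add: zero_mi\<close>)
      then show ?thesis using 0 by (simp add: Y')
    next
      case (Suc a')
      show ?thesis
      proof (cases "a' = 0 \<and> b = 0")
        case True
        then show ?thesis using Suc by (simp add: Y' cx1' ideal_zero[OF G])
      next
        case False
        let ?w = "of_nat a' + c * of_nat b"
        have w: "?w \<noteq> 0" using False generic(1) by blast
        have "(1 / ?w) *\<^sub>C (?w *\<^sub>C r2 (0,Suc a',b) + r1 (1,a',b)) \<in> ?A"
          using k2[of "Suc a'" b] unfolding Y r1_def[symmetric] by (intro ideal_scaleC[OF G]) simp
        then have "r2 (0,Suc a',b) + (1 / ?w) *\<^sub>C r1 (1,a',b) \<in> ?A"
          using w by (simp add: scaleC_add_right scaleC_scaleC scaleC_one)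
        then show ?thesis
          using Suc False by (auto simp: Y' cx1' scaleC_minus_left)
      qed
    qed
    then show "cf (0,a,b) (defect \<tau> (0,1,0)) \<in> ?A" by (rule sub[OF V(3)])
    have "r2 (1,a,b) + ((if a = 0 \<and> b = 0 then pa \<sigma> - r2 (1,0,0) - pa \<sigma> else 0)
      + (of_nat a + c * of_nat b - 1) *\<^sub>C cf (0,a,b) x2 - cf (1,a,b) (x1 * mon (0,1,0))) = 0"
    proof -
      consider "a = 0 \<and> b = 0" | "a = 1 \<and> b = 0" | "\<not> (a = 0 \<and> b = 0)"
        "\<not> (a = 1 \<and> b = 0)" by blast
      then show ?thesis
      proof cases
        case 1
        then show ?thesis by (simp add: cx2 Y')
      next
        case 2
        then show ?thesis using Y(2)[of 0 0 x1] cx1(2)[of 0 0] by (simp add: cx2)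
      next
        case 3
        have "cf (1,a,b) (x1 * mon (0,1,0)) = 0"
          using 3 by (cases a) (auto simp: Y' cx1')
        moreover have w: "of_nat a + c * of_nat b - 1 \<noteq> 0" using 3 generic(2)[of a b] by auto
        ultimately show ?thesis
          unfolding cx2 if_not_P[OF 3(1)] if_P[OF conjI[OF 3]] N[OF w] by simp
      qed
    qed
    then show "cf (1,a,b) (defect \<tau> (0,1,0)) \<in> ?A"
      by (intro sub[OF V(4)]) (simp only: ideal_zero[OF G])
  qed
  have D3: "defect \<tau> (0,0,1) \<in> ser_power (Suc n)"
  proof (rule ser_mi0_cases[OF _ _ G])
    fix a b
    have "r3 (0,a,b) + ((if a = 0 \<and> b = 1 then qb \<sigma> - r3 (0,0,1) - qb \<sigma> else 0) - c *\<^sub>C cf (0,a,b) (x1 * mon (0,0,1))) \<in> ?A"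
    proof (cases b)
      case 0
      have "r3 (0,a,0) \<in> ?A"
      proof (cases "a = 0")
        case False
        then have "of_nat a + c * of_nat 0 - c \<noteq> 0" using generic(3)[of a 0] by auto
        then show ?thesis using k3[of a 0] S unfolding Y by simp
      qed (use r0 ideal_zero[OF G] in \<open>simp add: zero_mi\<close>)
      then show ?thesis using 0 by (simp add: Y')
    next
      case (Suc b')
      show ?thesis
      proof (cases "a = 0 \<and> b' = 0")
        case True
        then show ?thesis using Suc by (simp add: Y' cx1' ideal_zero[OF G])
      next
        case False
        let ?w = "of_nat a + c * of_nat b'"
        have w: "?w \<noteq> 0" using False generic(1) by blast
        have "(1 / ?w) *\<^sub>C (?w *\<^sub>C r3 (0,a,Suc b') + c *\<^sub>C r1 (1,a,b')) \<in> ?A"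
          using k3[of a "Suc b'"] unfolding Y r1_def[symmetric] by (intro ideal_scaleC[OF G]) (simp add: algebra_simps)
        then have "r3 (0,a,Suc b') + c *\<^sub>C (1 / ?w) *\<^sub>C r1 (1,a,b') \<in> ?A"
          using w by (simp add: scaleC_add_right scaleC_scaleC scaleC_one)
        then show ?thesis
          using Suc False by (auto simp: Y' cx1' scaleC_minus_left scaleC_minus_right)
      qed
    qed
    then show "cf (0,a,b) (defect \<tau> (0,0,1)) \<in> ?A" by (rule sub[OF V(5)])
    have "r3 (1,a,b) + ((if a = 0 \<and> b = 0 then pb \<sigma> - r3 (1,0,0) - pb \<sigma> else 0)
      + (if a = 0 \<and> b = 1 then pc \<sigma> - r3 (1,0,1) + c *\<^sub>C r2 (1,1,0) - pc \<sigma> else 0)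
      + (of_nat a + c * of_nat b - c) *\<^sub>C cf (0,a,b) x3 - c *\<^sub>C cf (1,a,b) (x1 * mon (0,0,1))) = 0"
    proof -
      consider "a = 0 \<and> b = 0" | "a = 0 \<and> b = 1" | "\<not> (a = 0 \<and> b = 0)"
        "\<not> (a = 0 \<and> b = 1)" by blast
      then show ?thesis
      proof cases
        case 1
        then show ?thesis by (simp add: cx3 Y')
      next
        case 2
        then show ?thesis using Y(4)[of 0 0 x1] cx1(2)[of 0 0] by (simp add: cx3)
      next
        case 3
        have "cf (1,a,b) (x1 * mon (0,0,1)) = 0"
          using 3 by (cases b) (auto simp: Y' cx1')
        moreover have w: "of_nat a + c * of_nat b - c \<noteq> 0" using 3 generic(3)[of a b] by auto
        ultimately show ?thesis
          unfolding cx3 if_not_P[OF 3(1)] if_not_P[OF 3(2)] if_P[OF conjI[OF 3]] N[OF w] by simp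
      qed
    qed
    then show "cf (1,a,b) (defect \<tau> (0,0,1)) \<in> ?A"
      by (intro sub[OF V(6)]) (simp only: ideal_zero[OF G])
  qed
  \<comment> \<open>Each parameter changes within the n-th power while its partner lies in the
    maximal ideal, so the products change only in the next power.\<close>
  have prod: "q' * p' \<in> ?A" if "q * p \<in> ?A" "q' - q \<in> aug_power n" "p' - p \<in> aug_power n"
    "aug q = 0" "aug p' = 0"
    for p q p' q' :: 'a
  proof -
    have "q' * p' = q * p + ((q' - q) * p' + q * (p' - p))" by (simp add: algebra_simps)
    moreover have "(q' - q) * p' \<in> ?A" "q * (p' - p) \<in> ?A"
      using that(2-) by (simp_all add: aug_power_mult_left aug_power_mult_right aug_ideal_iff)
    ultimately show ?thesis using that(1) by (simp add: ideal_add[OF G])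
  qed
  have "qa \<tau> * pa \<tau> \<in> ?A" "qb \<tau> * pb \<tau> \<in> ?A"
    using \<sigma> \<tau> close ka kb aug_homogeneous_1 unfolding admissible_def gauge_close_def by (auto intro: prod)
  then have "good (Suc n) \<tau>"
    unfolding good_def using \<tau> defect_ideal[OF \<tau> graded_ideal_aug_power _ D1 D2 D3] by blast
  then show ?thesis using close by blast
qed

end

section \<open>Limits\<close>

lemma ser_limit:
  fixes F :: "nat \<Rightarrow> 'a::augmented_algebra ser"
  assumes c: "complete_base TYPE('a)" and F: "\<And>n. F (Suc n) - F n \<in> ser_power n"
  shows "\<exists>Y. \<forall>n. Y - F n \<in> ser_power n"
proof -
  have "\<exists>y. \<forall>n. y - cf I (F n) \<in> aug_power n" for I
  proof -
    have "cf I (F (Suc n)) - cf I (F n) \<in> aug_power n" for n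
      using aug_power_cf[OF F[of n], of I] by (simp add: cf_diff)
    then show ?thesis by (rule complete_base_limit[OF c])
  qed
  then obtain y where y: "\<And>I n. y I - cf I (F n) \<in> aug_power n" by metis
  have "mk y - F n \<in> ser_power n" for n
    unfolding ser_ideal_iff[OF graded_ideal_aug_power] by (simp add: cf_diff cf_mk y)
  then show ?thesis by blast
qed

lemma ser_separated:
  fixes F :: "'a::augmented_algebra ser"
  assumes c: "complete_base TYPE('a)" and F: "\<And>n. F \<in> ser_power n"
  shows "F = 0"
proof (rule ser_eqI)
  fix I
  have "cf I F = 0" using aug_power_cf[OF F] by (rule complete_base_separated[OF c])
  then show "cf I F = cf I 0" by simp
qed

lemma homogeneous_limit:
  fixes x :: "nat \<Rightarrow> 'a::augmented_algebra"
  assumes c: "complete_base TYPE('a)" and y: "\<And>n. y - x n \<in> aug_power n" and x: "\<And>n. homogeneous p (x n)"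
  shows "homogeneous p y"
proof -
  have "hcomp (p + 1) y \<in> aug_power n" for n
    using ideal_hcomp[OF graded_ideal_aug_power y[of n], of "p + 1"] homogeneous_other[OF x[of n], of "p + 1"]
    by (cases p) (simp_all add: hcomp_diff)
  then have "hcomp (p + 1) y = 0" by (rule complete_base_separated[OF c])
  then show ?thesis using hcomp_parts[of p y] by (simp add: homogeneous_def)
qed

lemma ser_homogeneous_limit:
  fixes F :: "nat \<Rightarrow> 'a::augmented_algebra ser"
  assumes c: "complete_base TYPE('a)" and Y: "\<And>n. Y - F n \<in> ser_power n" and F: "\<And>n. homogeneous p (F n)"
  shows "homogeneous p Y"
proof -
  have "homogeneous (p + wpar I) (cf I Y)" for I
    by (rule homogeneous_limit[OF c, of _ "\<lambda>n. cf I (F n)"])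
      (use aug_power_cf[OF Y] homogeneous_cf[OF F] in \<open>simp_all add: cf_diff\<close>)
  then show ?thesis by (simp add: homogeneous_iff_cf)
qed

lemma pullback_mon_id: "cf 0 F = 0 \<Longrightarrow> pullback mon F = F"
proof (rule lincont_ext[OF lincont_pullback lincont_id])
  have t: "triangular mon" by (simp add: triangular_def order_mon)
  show "pullback mon (mon J) = mon J" if "J \<in> mis" for J using pullback_mon[OF t that] .
qed

lemma pullback_mon_diff: "cf 0 F = 0 \<Longrightarrow> pullback (\<lambda>K. mon K - r K) F = F - pullback r F"
  by (simp add: pullback_family_diff pullback_mon_id)

context generic_rows
begin

text \<open>Continuity of the defect in the gauge, which carries the congruences over to the
  limit.\<close>

lemma defect_close:
  assumes "gauge_close n \<tau> \<sigma>" shows "defect \<tau> M - defect \<sigma> M \<in> ser_power n"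
proof -
  note A = graded_ideal_aug_power[of n, where 'a = 'a]
  have "defect \<tau> M - defect \<sigma> M = pullback (\<lambda>K. urow c \<tau> K - urow c \<sigma> K) (mrow \<tau> M)
      + pullback (urow c \<sigma>) (mrow \<tau> M - mrow \<sigma> M) - pullback (\<lambda>K. mrow \<tau> K - mrow \<sigma> K) (d M)"
    by (simp add: defect_def pullback_family_diff pullback_diff)
  moreover have "pullback (\<lambda>K. urow c \<tau> K - urow c \<sigma> K) (mrow \<tau> M) \<in> ser_power n"
    "pullback (urow c \<sigma>) (mrow \<tau> M - mrow \<sigma> M) \<in> ser_power n"
    "pullback (\<lambda>K. mrow \<tau> K - mrow \<sigma> K) (d M) \<in> ser_power n"
    by (rule pullback_ideal_family[OF A urow_close[OF assms]], rule pullback_ideal_arg[OF A mrow_close[OF assms]],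
        rule pullback_ideal_family[OF A mrow_close[OF assms]])
  ultimately show ?thesis
    by (simp add: ideal_add[OF graded_ideal_ser_power] ideal_diff[OF graded_ideal_ser_power])
qed

definition trivial_gauge :: "'a gauge" where
  "trivial_gauge = \<lparr>ga = mon (1,0,0), gb = mon (0,1,0), gc = mon (0,0,1), pa = 0, pb = 0, pc = 0, qa = 0, qb = 0\<rparr>"

text \<open>Identity substitution and zero parameters: modulo the maximal ideal both families are
  d_c. The induction starts at exponent 1, from where on corrections lie in the maximal
  ideal.\<close>

lemma good_trivial: "good 1 trivial_gauge"
proof -
  have a: "admissible trivial_gauge"
    using homogeneous_mon[of "(1,0,0)"] homogeneous_mon[of "(0,1,0)"] homogeneous_mon[of "(0,0,1)"]
    by (simp add: admissible_def trivial_gauge_def cf_mon zero_mi wpar.simps ideal_zero[OF graded_ideal_ser_max])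
  have m: "mrow trivial_gauge M = mon M" if "M \<in> mis" for M
    using gam_mon[OF that] by (simp add: mrow_def trivial_gauge_def)
  have u: "urow c trivial_gauge = vrow c"
    by (simp add: urow_def vrow_def trivial_gauge_def lam2_0 lam3_0)
  have "defect trivial_gauge M \<in> ser_max" if M: "M \<in> mis" for M
  proof -
    have "pullback (mrow trivial_gauge) (d M) = pullback mon (d M)" by (rule pullback_cong) (rule m)
    then have "defect trivial_gauge M = vrow c M - d M"
      using urow_facts(3)[OF a M] by (simp add: defect_def m M u pullback_mon_id cf_0_d)
    then show ?thesis using ideal_sub_swap[OF graded_ideal_ser_max reduction[OF M]] by simp
  qed
  then show ?thesis using a by (simp add: good_def trivial_gauge_def aug_power_zero[of 1, simplified])
qed

lemma gauge_limit:
  fixes f :: "nat \<Rightarrow> 'a gauge"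
  assumes c: "complete_base TYPE('a)" and cl: "\<And>n. gauge_close n (f (Suc n)) (f n)"
    and adm: "\<And>n. admissible (f n)"
  obtains \<sigma> where "admissible \<sigma>" "\<And>n. gauge_close n \<sigma> (f n)"
proof -
  note cl = cl[unfolded gauge_close_def]
  obtain xa where xa: "\<And>n. xa - ga (f n) \<in> ser_power n"
    using ser_limit[OF c, of "\<lambda>n. ga (f n)"] cl by metis
  obtain xb where xb: "\<And>n. xb - gb (f n) \<in> ser_power n"
    using ser_limit[OF c, of "\<lambda>n. gb (f n)"] cl by metis
  obtain xc where xc: "\<And>n. xc - gc (f n) \<in> ser_power n"
    using ser_limit[OF c, of "\<lambda>n. gc (f n)"] cl by metis
  obtain ya where ya: "\<And>n. ya - pa (f n) \<in> aug_power n"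
    using complete_base_limit[OF c, of "\<lambda>n. pa (f n)"] cl by metis
  obtain yb where yb: "\<And>n. yb - pb (f n) \<in> aug_power n"
    using complete_base_limit[OF c, of "\<lambda>n. pb (f n)"] cl by metis
  obtain yc where yc: "\<And>n. yc - pc (f n) \<in> aug_power n"
    using complete_base_limit[OF c, of "\<lambda>n. pc (f n)"] cl by metis
  obtain za where za: "\<And>n. za - qa (f n) \<in> aug_power n"
    using complete_base_limit[OF c, of "\<lambda>n. qa (f n)"] cl by metis
  obtain zb where zb: "\<And>n. zb - qb (f n) \<in> aug_power n"
    using complete_base_limit[OF c, of "\<lambda>n. qb (f n)"] cl by metis
  let ?\<sigma> = "\<lparr>ga = xa, gb = xb, gc = xc, pa = ya, pb = yb, pc = yc, qa = za, qb = zb\<rparr>"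
  have close: "gauge_close n ?\<sigma> (f n)" for n
    by (simp add: gauge_close_def xa xb xc ya yb yc za zb)
  note adm = adm[unfolded admissible_def]
  have z: "cf 0 Y = 0" if "\<And>n. Y - F n \<in> ser_power n"
    "\<And>n. cf 0 (F n) = 0" for Y :: "'a ser" and F
    by (rule complete_base_separated[OF c]) (use aug_power_cf[OF that(1), of 0] that(2) in \<open>simp add: cf_diff\<close>)
  have s: "Y - m \<in> ser_max" if "\<And>n. Y - F n \<in> ser_power n"
    "\<And>n. F n - m \<in> ser_max" for Y :: "'a ser" and F m
    using ideal_trans[OF graded_ideal_ser_max _ that(2)[of 1]] that(1)[of 1] by simp
  have a: "aug y = 0" if "\<And>n. y - x n \<in> aug_power n" "\<And>n. aug (x n) = 0" for y :: 'a and x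
    using that(1)[of 1] that(2)[of 1] by (simp add: aug_ideal_iff aug_diff)
  have "admissible ?\<sigma>"
    unfolding admissible_def gauge.simps
    by (intro conjI ser_homogeneous_limit[OF c xa] ser_homogeneous_limit[OF c xb] ser_homogeneous_limit[OF c xc]
        homogeneous_limit[OF c ya] homogeneous_limit[OF c yb] homogeneous_limit[OF c yc]
        homogeneous_limit[OF c za] homogeneous_limit[OF c zb] z[OF xa] z[OF xb] z[OF xc]
        s[OF xa] s[OF xb] s[OF xc] a[OF ya] a[OF yb] a[OF yc])
      (use adm in auto)
  then show ?thesis using close by (rule that)
qed

lemma exists_gauge:
  assumes c: "complete_base TYPE('a)"
  obtains \<sigma> where "admissible \<sigma>"
    "\<And>M. M \<in> mis \<Longrightarrow> defect \<sigma> M = 0" "qa \<sigma> * pa \<sigma> = 0"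
    "qb \<sigma> * pb \<sigma> = 0"
proof -
  have "\<exists>f. \<forall>n. good (Suc n) (f n) \<and> gauge_close (Suc n) (f (Suc n)) (f n)"
    by (rule dependent_nat_choice) (use good_trivial good_step in auto)
  then obtain f where f: "\<And>n. good (Suc n) (f n)"
    "\<And>n. gauge_close (Suc n) (f (Suc n)) (f n)" by blast
  have down: "gauge_close (Suc n) \<tau> \<sigma> \<Longrightarrow> gauge_close n \<tau> \<sigma>" for n and \<sigma> \<tau> :: "'a gauge"
    using aug_power_Suc_subset[of n, where 'a = 'a] by (auto simp: gauge_close_def ser_ideal_def)
  obtain \<sigma> where \<sigma>: "admissible \<sigma>" "\<And>n. gauge_close n \<sigma> (f n)"
    using gauge_limit[OF c, of f] f down by (metis good_def)
  have sub: "x \<in> aug_power (Suc n) \<Longrightarrow> x \<in> aug_power n" for x :: 'a and n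
    using aug_power_Suc_subset by blast
  have "defect \<sigma> M = 0" if M: "M \<in> mis" for M
  proof (rule ser_separated[OF c])
    fix n
    have "defect (f n) M \<in> ser_power n"
      using f(1)[of n] M sub by (auto simp: good_def ser_ideal_def)
    then show "defect \<sigma> M \<in> ser_power n"
      using defect_close[OF \<sigma>(2)[of n], of M] ideal_cong[OF graded_ideal_ser_power] by blast
  qed
  moreover have "qa \<sigma> * pa \<sigma> = 0" "qb \<sigma> * pb \<sigma> = 0"
  proof -
    have "qa \<sigma> * pa \<sigma> \<in> aug_power n \<and> qb \<sigma> * pb \<sigma> \<in> aug_power n" for n
    proof -
      have "qa (f n) * pa (f n) \<in> aug_power n" "qb (f n) * pb (f n) \<in> aug_power n"
        using f(1)[of n] sub by (auto simp: good_def)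
      moreover have "qa \<sigma> * pa \<sigma> - qa (f n) * pa (f n) \<in> aug_power n"
        "qb \<sigma> * pb \<sigma> - qb (f n) * pb (f n) \<in> aug_power n"
        using \<sigma>(2)[of n] unfolding gauge_close_def by (auto intro: ideal_mult_cong[OF graded_ideal_aug_power])
      ultimately show ?thesis using ideal_cong[OF graded_ideal_aug_power] by blast
    qed
    then show "qa \<sigma> * pa \<sigma> = 0"
      "qb \<sigma> * pb \<sigma> = 0" using complete_base_separated[OF c] by blast+
  qed
  ultimately show ?thesis using \<sigma>(1) by (intro that) auto
qed

end

subsection \<open>Inverses\<close>

lemma comp_endos:
  assumes T: "T \<in> endos" "triangular (row T)" and U: "U \<in> endos" "triangular (row U)"
  shows "smap_comp T U \<in> endos"
proof -
  have z: "smap_comp T U I M = 0" if "I \<notin> mis \<or> M \<notin> mis_upto (deg I)" for I M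
    unfolding smap_comp_def
  proof (rule sum.neutral, intro ballI, clarify)
    fix K assume "U I K \<noteq> 0"
    then have "I \<in> mis" "deg K \<le> deg I"
      using triangular_row[OF U, of I K] endos_support[OF U(1), of I K] by (auto simp: mis_upto_def)
    have "T K M = 0"
    proof (rule ccontr)
      assume "T K M \<noteq> 0"
      then have "M \<in> mis_upto (deg K)" by (rule triangular_row[OF T])
      then have "M \<in> mis_upto (deg I)" using \<open>deg K \<le> deg I\<close> by (simp add: mis_upto_def)
      then show False using that \<open>I \<in> mis\<close> by blast
    qed
    then show "T K M * U I K = 0" by simp
  qed
  have "finite {M. smap_comp T U I M \<noteq> 0}" for I
    by (rule finite_subset[OF _ finite_mis_upto[of "deg I"]]) (use z in blast)
  moreover have "I \<in> mis \<and> M \<in> mis" if "smap_comp T U I M \<noteq> 0" for I M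
    using z[of I M] that unfolding mis_upto_def by blast
  ultimately show ?thesis unfolding endos_def by blast
qed

text \<open>If F is killed, it equals its image under \<open>mon - r\<close>, whose rows have
  coefficients in the maximal ideal. So F lies in every power.\<close>

lemma pullback_injective:
  fixes r :: "mi \<Rightarrow> 'a::augmented_algebra ser"
  assumes c: "complete_base TYPE('a)" and r: "\<And>K. K \<in> mis \<Longrightarrow> mon K - r K \<in> ser_max"
    and F: "cf 0 F = 0" "pullback r F = 0"
  shows "F = 0"
proof (rule ser_separated[OF c])
  fix n show "F \<in> ser_power n"
  proof (induction n)
    case (Suc n)
    show ?case using pullback_power_arg[OF Suc, of "\<lambda>K. mon K - r K"] r by (simp add: pullback_mon_diff F)
  qed (simp add: ser_ideal_def)
qed

text \<open>Neumann iteration: adding the error \<open>mon M - pullback r F\<close> to F replaces it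
  by its image under \<open>mon - r\<close>, one power further. Each iterate vanishes below the
  degree of M, and so does the limit; this makes the inverse triangular.\<close>

lemma pullback_surjective:
  fixes r :: "mi \<Rightarrow> 'a::augmented_algebra ser"
  assumes c: "complete_base TYPE('a)" and r: "\<And>K. K \<in> mis \<Longrightarrow> mon K - r K \<in> ser_max" and M: "M \<in> mis"
  shows "\<exists>F. pullback r F = mon M \<and> (\<forall>I. deg I < deg M \<longrightarrow> cf I F = 0)"
proof -
  define f where "f = rec_nat (mon M) (\<lambda>_ F. F + (mon M - pullback r F))"
  have f: "f 0 = mon M" "f (Suc n) = f n + (mon M - pullback r (f n))" for n
    by (simp_all add: f_def)
  define e where "e n = mon M - pullback r (f n)" for n
  have e0: "cf 0 (e n) = 0" for n using M by (simp add: e_def cf_diff cf_mon mis_eq)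
  have eS: "e (Suc n) = pullback (\<lambda>K. mon K - r K) (e n)" for n
    by (simp add: pullback_mon_diff e0) (simp add: e_def f pullback_add pullback_diff)
  have en: "e n \<in> ser_power n" for n
  proof (induction n)
    case (Suc n)
    then show ?case unfolding eS by (rule pullback_power_arg) (rule r)
  qed (simp add: ser_ideal_def)
  obtain F where F: "\<And>n. F - f n \<in> ser_power n"
    using ser_limit[OF c, of f] en by (auto simp: f e_def)
  have "pullback r F - mon M \<in> ser_power n" for n
  proof -
    have "pullback r F - mon M = pullback r (F - f n) - e n" by (simp add: pullback_diff e_def)
    then show ?thesis
      using pullback_ideal_arg[OF graded_ideal_aug_power F[of n], of r] en[of n] ideal_diff[OF graded_ideal_ser_power] by metis
  qed
  then have "pullback r F - mon M = 0" by (rule ser_separated[OF c])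
  moreover have "cf I F = 0" if I: "deg I < deg M" for I
  proof (rule complete_base_separated[OF c])
    fix n
    have "agree_upto (deg I) (f n) 0"
    proof (induction n)
      case 0
      then show ?case using I by (simp add: f agree_upto_def order_mon)
    next
      case (Suc n)
      have "agree_upto (deg I) (pullback r (f n)) 0" using pullback_agree_upto[OF Suc, of r] by simp
      then show ?case using Suc I by (simp add: f agree_upto_def cf_add cf_diff order_mon)
    qed
    then have "cf I (f n) = 0" by (simp add: agree_upto_def)
    then show "cf I F \<in> aug_power n" using aug_power_cf[OF F[of n], of I] by (simp add: cf_diff)
  qed
  ultimately show ?thesis by auto
qed

text \<open>Solving for every monomial gives an inverse s on one side. On the other side,
  \<open>pullback r\<close> takes both \<open>pullback s (r M)\<close> and \<open>mon M\<close> to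
  \<open>r M\<close>, and injectivity identifies them.\<close>

lemma invertible_smap:
  fixes r :: "mi \<Rightarrow> 'a::augmented_algebra ser"
  assumes c: "complete_base TYPE('a)" and t: "triangular r" and r: "\<And>K. K \<in> mis \<Longrightarrow> r K - mon K \<in> ser_max"
  shows "\<exists>h\<in>endos. smap_comp (smap_of r) h = id_smap \<and> smap_comp h (smap_of r) = id_smap"
proof -
  have r': "mon K - r K \<in> ser_max" if "K \<in> mis" for K
    using ideal_sub_swap[OF graded_ideal_ser_max r[OF that]] .
  obtain s where s: "\<And>M. M \<in> mis \<Longrightarrow> pullback r (s M) = mon M"
    "\<And>M I. M \<in> mis \<Longrightarrow> deg I < deg M \<Longrightarrow> cf I (s M) = 0"
    using pullback_surjective[OF c r'] by metis
  have ts: "triangular s" using s(2) by (simp add: triangular_def)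
  have row: "row (smap_of q) M = q M" if "triangular q" "M \<in> mis" for q :: "mi \<Rightarrow> 'a ser" and M
    using that(2) triangular_cf_0[OF that] by (rule row_smap_of)
  have tri: "triangular (row (smap_of q))" if "triangular q" for q :: "mi \<Rightarrow> 'a ser"
    using that row[OF that] by (simp add: triangular_def)
  have opr: "pullback (row (smap_of q)) F = pullback q F" if "triangular q" for q :: "mi \<Rightarrow> 'a ser" and F
    using row[OF that] by (rule pullback_cong)
  note er = smap_of_endos[OF t] and es = smap_of_endos[OF ts]
  have "pullback s (r M) = mon M" if M: "M \<in> mis" for M
  proof -
    have z: "cf 0 (r M) = 0" by (rule triangular_cf_0[OF t M])
    have "pullback r (pullback s (r M)) = pullback (\<lambda>K. pullback r (s K)) (r M)" by (rule pullback_pullback[OF t ts z])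
    also have "\<dots> = pullback mon (r M)" by (rule pullback_cong) (rule s(1))
    also have "\<dots> = pullback r (mon M)" by (simp add: pullback_mon_id z pullback_mon[OF t M])
    finally have "pullback r (pullback s (r M) - mon M) = 0" by (simp add: pullback_diff)
    moreover have "cf 0 (pullback s (r M) - mon M) = 0" using M by (simp add: cf_diff cf_mon mis_eq)
    ultimately have "pullback s (r M) - mon M = 0"
      using pullback_injective[OF c, of r "pullback s (r M) - mon M"] r' by blast
    then show ?thesis by simp
  qed
  then have "smap_comp (smap_of r) (smap_of s) = id_smap"
    by (intro smap_eqI comp_endos er es tri t ts id_endos)
      (simp add: row_comp er es tri t ts opr row row_id)
  moreover have "smap_comp (smap_of s) (smap_of r) = id_smap"
    using s(1) by (intro smap_eqI comp_endos er es tri t ts id_endos)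
      (simp add: row_comp er es tri t ts opr row row_id)
  ultimately show ?thesis using es by blast
qed

subsection \<open>Normal forms of deformations\<close>

text \<open>Stated for graded additive maps, so that it serves base homomorphisms and also the
  augmentation, which takes values in the algebra \<open>complex\<close>.\<close>

lemma graded_additive:
  fixes f :: "'a::supercomm_algebra \<Rightarrow> 'b::supercomm_algebra"
  assumes "\<And>x y. f (x + y) = f x + f y" "\<And>p x. f (hcomp p x) = hcomp p (f x)"
  shows "f 0 = 0" "f (of_nat k * x) = of_nat k * f x" "f (gsign p x) = gsign p (f x)"
    "f (sum h S) = (\<Sum>x\<in>S. f (h x))"
proof -
  show z: "f 0 = 0" using assms(1)[of 0 0] by simp
  show "f (of_nat k * x) = of_nat k * f x"
    by (induction k) (simp_all add: z assms(1) algebra_simps)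
  have "f (x - y) = f x - f y" for x y
    using assms(1)[of "x - y" y] by (simp add: algebra_simps)
  then show "f (gsign p x) = gsign p (f x)"
    by (simp add: gsign_def assms)
  show "f (sum h S) = (\<Sum>x\<in>S. f (h x))"
    by (induction S rule: infinite_finite_induct) (simp_all add: z assms(1))
qed

lemma phi_push:
  fixes f :: "'a::supercomm_algebra \<Rightarrow> 'b::supercomm_algebra"
  assumes f: "\<And>x y. f (x + y) = f x + f y" "\<And>p x. f (hcomp p x) = hcomp p (f x)"
  shows "f (phi I j a I' M) = phi I j (f a) I' M"
proof -
  note P = graded_additive[of f, OF f]
  have "f (coder l I' M) = coder (\<lambda>J j. f (l J j)) I' M" for l
    unfolding coder_def by (auto simp: P split_beta if_distrib[of f]
        simp del: mbinom.simps of_nat_mult intro!: sum.cong)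
  moreover have "(\<lambda>J k. f (if J = I \<and> k = j then of_nat (mfact I) * gsign (wpar I) a else 0))
      = (\<lambda>J k. if J = I \<and> k = j then of_nat (mfact I) * gsign (wpar I) (f a) else 0)"
    by (intro ext) (simp add: P)
  ultimately show ?thesis by (simp add: phi_def)
qed

lemma universal_push:
  fixes f :: "'a::supercomm_algebra \<Rightarrow> 'b::supercomm_algebra"
  assumes f: "\<And>x y. f (x + y) = f x + f y" "\<And>p x. f (hcomp p x) = hcomp p (f x)"
    and "\<And>r x. f (r *\<^sub>C x) = r *\<^sub>C f x" "f 1 = 1"
  shows "f (universal c a1 a2 a3 e1 e2 I M) = universal c (f a1) (f a2) (f a3) (f e1) (f e2) I M"
  unfolding universal_def by (simp add: phi_push[of f, OF f] assms)

lemma phi_zero: "phi I j 0 = 0"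
  using phi_push[of "\<lambda>_. 0" I j 0] by (intro ext) (simp add: fun_eq_iff)

lemma universal_0_complex: "universal c 0 0 0 0 0 = phi (1,1,0) 2 1 + phi (1,0,1) 3 c"
  by (simp add: universal_def phi_zero scaleC_complex_def)

lemma aug_universal:
  "aug (universal c a1 a2 a3 e1 e2 I M) = universal c (aug a1) (aug a2) (aug a3) (aug e1) (aug e2) I M"
  by (rule universal_push) (simp_all add: aug_add aug_hcomp hcomp_complex_def aug_scaleC aug_one scaleC_complex_def)

lemma deformation_universal:
  assumes h: "homogeneous 0 a1" "homogeneous 0 a2" "homogeneous 0 a3" "homogeneous 1 e1" "homogeneous 1 e2"
    and z: "aug a1 = 0" "aug a2 = 0" "aug a3 = 0" "e1 * a1 = 0" "e2 * a2 = 0"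
  shows "deformation (universal c 0 0 0 0 0) (universal c a1 a2 a3 e1 e2)"
proof -
  let ?r = "drow (lam2 a1 e1) (lam3 c a2 a3 e2)"
  have df: "derivation_family ?r"
    using homogeneous_lam2[OF h(1,4)] homogeneous_lam3[OF h(2,3,5), of c] by (intro derivation_family_drow) auto
  then have cod: "coderivation 1 (universal c a1 a2 a3 e1 e2)"
    unfolding universal_eq_smap_of[OF h(1-3)] by (rule coderivation_smap_of)
  let ?D = "universal c a1 a2 a3 e1 e2"
  have e: "?D \<in> endos" using cod by (simp add: coderivation_def)
  have t: "triangular (row ?D)" using derivation_family_row[OF cod] by (simp add: derivation_family_def)
  have rr: "row ?D M = ?r M" if "M \<in> mis" for M by (rule row_universal[OF that h(1-3)])
  note S = universal_square[OF h, of c]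
  have "pullback ?r (?r M) \<in> ser_ideal {0}" if "M \<in> mis" for M
    by (rule square_ideal[OF df graded_ideal_zero _ _ _ that]; simp only: S; simp add: z ser_ideal_def)
  then have sq: "pullback ?r (?r M) = 0" if "M \<in> mis" for M
    using that by (intro ser_eqI) (auto simp: ser_ideal_def)
  have "smap_comp ?D ?D = (\<lambda>_ _. 0)"
  proof (rule smap_eqI)
    fix M assume M: "M \<in> mis"
    have "row (smap_comp ?D ?D) M = pullback (row ?D) (row ?D M)" by (rule row_comp[OF e e t])
    also have "\<dots> = pullback ?r (?r M)" unfolding rr[OF M] by (rule pullback_cong) (rule rr)
    also have "\<dots> = row (\<lambda>_ _. 0) M" unfolding sq[OF M] by (rule ser_eqI) (simp add: cf_row)
    finally show "row (smap_comp ?D ?D) M = row (\<lambda>_ _. 0) M" .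
  qed (use comp_endos[OF e t e t] in \<open>simp_all add: endos_def\<close>)
  then have "gcommutator 1 1 ?D ?D = 0"
    by (intro ext) (simp add: gcommutator_def)
  then show ?thesis
    using cod z h unfolding deformation_def linf_structure_def
    by (simp add: aug_universal aug_homogeneous_1)
qed

lemma deformation_rows:
  fixes D :: "'a::augmented_algebra smap"
  assumes D: "deformation (universal c 0 0 0 0 0) D"
  shows "coderivation_rows c (row D)"
proof
  have cod: "coderivation 1 D" and gc: "gcommutator 1 1 D D = 0"
    using D by (auto simp: deformation_def linf_structure_def)
  show df: "derivation_family (row D)" by (rule derivation_family_row[OF cod])
  have e: "D \<in> endos" using cod by (simp add: coderivation_def)
  have t: "triangular (row D)" using df by (simp add: derivation_family_def)
  \<comment> \<open>The graded commutator of an odd map with itself is twice its square.\<close>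
  have "smap_comp D D I M = 0" for I M
    using fun_cong[OF fun_cong[OF gc, of I], of M] by (rule_tac double_eq_0) (simp add: gcommutator_def)
  then show "pullback (row D) (row D M) = 0" if "M \<in> mis" for M
    using that unfolding row_comp[OF e e t, symmetric] by (intro ser_eqI) (simp add: cf_row)
  fix M assume M: "M \<in> mis"
  have "(vrow c M :: 'a ser) = row (universal c 0 0 0 0 0) M"
    by (simp add: row_universal[OF M] lam2_0 lam3_0 vrow_def)
  moreover have "aug (D I M - universal c 0 0 0 0 0 I M) = 0" for I
    using D by (simp add: aug_diff aug_universal deformation_def)
  ultimately show "row D M - vrow c M \<in> ser_max"
    unfolding ser_ideal_iff[OF graded_ideal_aug]
    by (simp add: cf_diff cf_row aug_ideal_iff aug_diff aug_scaleC aug_universal)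
qed

text \<open>The limit gauge has defect 0, so its substitution intertwines the two structures
  exactly. It is invertible because it reduces to the identity, and its parameters satisfy the
  relations on the nose.\<close>

lemma equivalent_universal:
  fixes D :: "'a::augmented_algebra smap"
  assumes c: "complete_base TYPE('a)" and D: "deformation (universal c 0 0 0 0 0) D"
    and gen: "\<And>a b. of_nat a + c * of_nat b = 0 \<Longrightarrow> a = 0 \<and> b = 0"
    "\<And>a b. of_nat a + c * of_nat b = 1 \<Longrightarrow> a = 1 \<and> b = 0"
    "\<And>a b. of_nat a + c * of_nat b = c \<Longrightarrow> a = 0 \<and> b = 1"
  obtains a1 a2 a3 e1 e2 where "homogeneous 0 a1" "homogeneous 0 a2" "homogeneous 0 a3" "homogeneous 1 e1"
    "homogeneous 1 e2"
    "aug a1 = 0" "aug a2 = 0" "aug a3 = 0" "e1 * a1 = 0" "e2 * a2 = 0"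
    "equivalent (universal c a1 a2 a3 e1 e2) D"
proof -
  interpret coderivation_rows c "row D" by (rule deformation_rows[OF D])
  interpret generic_rows c "row D" by unfold_locales (fact gen)+
  obtain \<sigma> where \<sigma>: "admissible \<sigma>"
    "\<And>M. M \<in> mis \<Longrightarrow> defect \<sigma> M = 0" "qa \<sigma> * pa \<sigma> = 0"
    "qb \<sigma> * pb \<sigma> = 0"
    using exists_gauge[OF c] by blast
  have h: "homogeneous 0 (pa \<sigma>)" "homogeneous 0 (pb \<sigma>)" "homogeneous 0 (pc \<sigma>)"
    "homogeneous 1 (qa \<sigma>)"
    "homogeneous 1 (qb \<sigma>)" "aug (pa \<sigma>) = 0" "aug (pb \<sigma>) = 0" "aug (pc \<sigma>) = 0"
    using \<sigma>(1) by (auto simp: admissible_def)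
  let ?g = "smap_of (mrow \<sigma>)" and ?U = "universal c (pa \<sigma>) (pb \<sigma>) (pc \<sigma>) (qa \<sigma>) (qb \<sigma>)"
  note G = coalgebra_map_smap_of[OF morphism_family_mrow[OF \<sigma>(1)]]
  note tm = mrow_facts(1)[OF \<sigma>(1)]
  have rg: "row ?g M = mrow \<sigma> M" if "M \<in> mis" for M
    using that mrow_facts(3)[OF \<sigma>(1) that] by (rule row_smap_of)
  have tg: "triangular (row ?g)" using tm by (simp add: triangular_def rg)
  have aut: "coalgebra_aut ?g"
    unfolding coalgebra_aut_def using G invertible_smap[OF c tm mrow_max[OF \<sigma>(1)]] by blast
  have red: "aug (?g I M) = id_smap I M" for I M
  proof (cases "I \<in> mis \<and> M \<in> mis")
    case True
    have "aug (cf I (mrow \<sigma> M)) = aug (cf I (mon M) :: 'a)"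
      using mrow_max[OF \<sigma>(1), of M] True by (auto simp: ser_ideal_def cf_diff aug_ideal_iff aug_diff)
    then show ?thesis
      using True by (auto simp: smap_of_def aug_scaleC cf_mon id_smap_def mis_mi0 aug_one)
  qed (auto simp: smap_of_def id_smap_def)
  have eD: "D \<in> endos" and eU: "?U \<in> endos"
    using D deformation_universal[OF h(1-5) h(6-8) \<sigma>(3,4), of c]
    by (auto simp: deformation_def linf_structure_def coderivation_def)
  have rU: "row ?U M = urow c \<sigma> M" if "M \<in> mis" for M
    using row_universal[OF that h(1-3)] by (simp add: urow_def)
  have tU: "triangular (row ?U)" using urow_facts(1)[OF \<sigma>(1)] by (simp add: triangular_def rU)
  have "smap_comp ?g ?U = smap_comp D ?g"
  proof (rule smap_eqI)
    fix M assume M: "M \<in> mis"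
    have "row (smap_comp ?g ?U) M = pullback (urow c \<sigma>) (mrow \<sigma> M)"
      unfolding row_comp[OF G(1) eU tU] rg[OF M] by (rule pullback_cong) (rule rU)
    moreover have "row (smap_comp D ?g) M = pullback (mrow \<sigma>) (row D M)"
      unfolding row_comp[OF eD G(1) tg] by (rule pullback_cong) (rule rg)
    ultimately show "row (smap_comp ?g ?U) M = row (smap_comp D ?g) M"
      using \<sigma>(2)[OF M] by (simp add: defect_def)
  qed (intro comp_endos G(1) eU eD tg tU tri_d)+
  then have "equivalent ?U D" unfolding equivalent_def using aut red by blast
  then show ?thesis using h \<sigma>(3,4) by (intro that)
qed

section \<open>Homomorphisms out of the base\<close>

lemma complete_base_unique:
  fixes y :: "'a::augmented_algebra"
  assumes c: "complete_base TYPE('a)" and y: "\<And>n. y - x n \<in> aug_power n" and y': "\<And>n. y' - x n \<in> aug_power n"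
  shows "y = y'"
proof -
  have "y - y' \<in> aug_power n" for n
    using aug_power_diff[OF y[of n] y'[of n]] by simp
  then have "y - y' = 0" by (rule complete_base_separated[OF c])
  then show ?thesis by simp
qed

text \<open>Evaluation at an even element s of the maximal ideal, as the limit of the partial sums.
  The coefficient ring is arbitrary, with a given map \<phi> to the target, so that the construction
  can be iterated.\<close>

lemma fps_evaluation:
  fixes \<phi> :: "'c::comm_ring_1 \<Rightarrow> 'b::augmented_algebra"
  assumes c: "complete_base TYPE('b)"
    and \<phi>: "\<And>x y. \<phi> (x + y) = \<phi> x + \<phi> y"
      "\<And>x y. \<phi> (x * y) = \<phi> x * \<phi> y" "\<phi> 1 = 1" "\<And>x. homogeneous 0 (\<phi> x)"
    and s: "homogeneous 0 s" "aug s = 0"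
  obtains \<psi> :: "'c fps \<Rightarrow> 'b" where "\<And>x y. \<psi> (x + y) = \<psi> x + \<psi> y"
    "\<And>x y. \<psi> (x * y) = \<psi> x * \<psi> y" "\<psi> 1 = 1"
    "\<And>x. homogeneous 0 (\<psi> x)" "\<And>a. \<psi> (fps_const a) = \<phi> a" "\<psi> fps_X = s"
    "\<And>p. aug (\<psi> p) = aug (\<phi> (p $ 0))"
proof -
  define S where "S p n = (\<Sum>i<n. s ^ i * \<phi> (p $ i))" for p n
  have sm: "s \<in> aug_ideal" by (simp add: aug_ideal_iff s)
  have "\<exists>y. \<forall>n. y - S p n \<in> aug_power n" for p
    by (rule complete_base_limit[OF c]) (simp add: S_def aug_power_mult_power[OF sm])
  then obtain \<psi> where \<psi>: "\<And>p n. \<psi> p - S p n \<in> aug_power n" by metis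
  have uniq: "\<psi> p = y" if "\<And>n. y - S p n \<in> aug_power n" for p y
    by (rule complete_base_unique[OF c \<psi> that])
  note G = graded_ideal_aug_power[where 'a = 'b]
  have \<phi>0: "\<phi> 0 = 0" using \<phi>(1)[of 0 0] by simp
  have add: "\<psi> (p + q) = \<psi> p + \<psi> q" for p q
  proof (rule uniq)
    fix n
    have "\<psi> p + \<psi> q - S (p + q) n = (\<psi> p - S p n) + (\<psi> q - S q n)"
      by (simp add: S_def \<phi> algebra_simps sum.distrib)
    then show "\<psi> p + \<psi> q - S (p + q) n \<in> aug_power n" using ideal_add[OF G \<psi> \<psi>] by metis
  qed
  have smul: "\<psi> (fps_const a * p) = \<phi> a * \<psi> p" for a p
  proof (rule uniq)
    fix n
    have "s ^ i * (\<phi> a * x) = \<phi> a * (s ^ i * x)" for i x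
      by (metis \<phi>(4) even_commute mult.assoc)
    then have "\<phi> a * \<psi> p - S (fps_const a * p) n = \<phi> a * (\<psi> p - S p n)"
      by (simp add: S_def \<phi> sum_distrib_left right_diff_distrib)
    then show "\<phi> a * \<psi> p - S (fps_const a * p) n \<in> aug_power n" using ideal_left[OF G \<psi>] by metis
  qed
  have shift: "\<psi> (fps_X * p) = s * \<psi> p" for p
  proof (rule uniq)
    fix n
    show "s * \<psi> p - S (fps_X * p) n \<in> aug_power n"
    proof (cases n)
      case (Suc m)
      have "S (fps_X * p) (Suc m) = s * S p m"
        unfolding S_def by (subst sum.lessThan_Suc_shift) (simp add: \<phi>0 sum_distrib_left mult.assoc)
      then have "s * \<psi> p - S (fps_X * p) n = s * (\<psi> p - S p m)" by (simp add: Suc right_diff_distrib)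
      then show ?thesis using aug_power_mult_left[OF sm \<psi>[of p m]] by (simp add: Suc)
    qed simp
  qed
  have const: "\<psi> (fps_const a) = \<phi> a" for a
  proof (rule uniq)
    fix n
    show "\<phi> a - S (fps_const a) n \<in> aug_power n"
    proof (cases n)
      case (Suc m)
      have "S (fps_const a) (Suc m) = \<phi> a"
        unfolding S_def by (subst sum.lessThan_Suc_shift) (simp add: \<phi>0)
      then show ?thesis by (simp add: Suc aug_power_zero)
    qed simp
  qed
  have one: "\<psi> 1 = 1" using const[of 1] \<phi>(3) by simp
  have mult: "\<psi> (p * q) = \<psi> p * \<psi> q" for p q
  proof -
    \<comment> \<open>Writing p = p_0 + X r, the failure of multiplicativity for p is s times that
      for r. Each step gains one power of the maximal ideal, so the failure lies in all of
      them.\<close>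
    have "\<psi> (p * q) - \<psi> p * \<psi> q \<in> aug_power n" for n
    proof (induction n arbitrary: p)
      case (Suc n)
      define r where "r = fps_shift 1 p"
      have p: "p = fps_const (p $ 0) + fps_X * r"
        unfolding r_def by (rule fps_ext) (simp add: fps_X_mult_nth)
      have "p * q = fps_const (p $ 0) * q + fps_X * (r * q)"
        by (subst p) (simp add: algebra_simps)
      then have "\<psi> (p * q) = \<phi> (p $ 0) * \<psi> q + s * \<psi> (r * q)"
        by (simp only: add smul shift)
      moreover have "\<psi> p = \<phi> (p $ 0) + s * \<psi> r"
        by (subst p) (simp only: add const shift)
      ultimately have "\<psi> (p * q) - \<psi> p * \<psi> q = s * (\<psi> (r * q) - \<psi> r * \<psi> q)"
        by (simp add: algebra_simps)
      then show ?case using aug_power_mult_left[OF sm Suc[of r]] by simp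
    qed simp
    then have "\<psi> (p * q) - \<psi> p * \<psi> q = 0" by (rule complete_base_separated[OF c])
    then show ?thesis by simp
  qed
  have X: "\<psi> fps_X = s" using shift[of 1] one by simp
  have even: "homogeneous 0 (\<psi> p)" for p
  proof (rule homogeneous_limit[OF c \<psi>])
    fix n
    have "homogeneous 0 (s ^ i)" for i
    proof (induction i)
      case (Suc i)
      then show ?case using homogeneous_mult[OF s(1) Suc] by simp
    qed simp
    then have "homogeneous 0 (s ^ i * \<phi> (p $ i))" for i
      using homogeneous_mult[of 0 "s ^ i" 0] \<phi>(4) by simp
    then show "homogeneous 0 (S p n)" unfolding S_def by (intro homogeneous_sum)
  qed
  have "aug (\<psi> p) = aug (\<phi> (p $ 0))" for p
    using \<psi>[of p 1] by (simp add: S_def aug_ideal_iff aug_diff)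
  then show ?thesis using that add mult one even const X by blast
qed

lemma sps_evaluation:
  fixes s1 s2 s3 e1 e2 :: "'b::augmented_algebra"
  assumes c: "complete_base TYPE('b)"
    and h: "homogeneous 0 s1" "homogeneous 0 s2" "homogeneous 0 s3" "homogeneous 1 e1" "homogeneous 1 e2"
    and z: "aug s1 = 0" "aug s2 = 0" "aug s3 = 0"
  obtains f :: "sps \<Rightarrow> 'b" where "base_hom f" "f T1 = s1" "f T2 = s2" "f T3 = s3" "f Th1 = e1"
    "f Th2 = e2"
proof -
  let ?i = "\<lambda>r :: complex. r *\<^sub>C (1 :: 'b)"
  have i: "?i (x + y) = ?i x + ?i y" "?i (x * y) = ?i x * ?i y" "?i 1 = 1" "homogeneous 0 (?i x)" for x y
    by (simp_all add: scaleC_add_left scaleC_mult_left scaleC_scaleC scaleC_one homogeneous_scaleC)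
  \<comment> \<open>The nested series are evaluated from the innermost variable t^3
    outwards.\<close>
  obtain f1 where f1: "\<And>x y. f1 (x + y) = f1 x + f1 y" "\<And>x y. f1 (x * y) = f1 x * f1 y" "f1 1 = 1"
    "\<And>x. homogeneous 0 (f1 x)" "\<And>a. f1 (fps_const a) = ?i a" "f1 fps_X = s3"
    "\<And>p. aug (f1 p) = aug (?i (p $ 0))"
    by (rule fps_evaluation[OF c i h(3) z(3)]) blast
  obtain f2 where f2: "\<And>x y. f2 (x + y) = f2 x + f2 y" "\<And>x y. f2 (x * y) = f2 x * f2 y" "f2 1 = 1"
    "\<And>x. homogeneous 0 (f2 x)" "\<And>a. f2 (fps_const a) = f1 a" "f2 fps_X = s2"
    "\<And>p. aug (f2 p) = aug (f1 (p $ 0))"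
    by (rule fps_evaluation[OF c f1(1-4) h(2) z(2)]) blast
  obtain f3 where f3: "\<And>x y. f3 (x + y) = f3 x + f3 y" "\<And>x y. f3 (x * y) = f3 x * f3 y" "f3 1 = 1"
    "\<And>x. homogeneous 0 (f3 x)" "\<And>a. f3 (fps_const a) = f2 a" "f3 fps_X = s1"
    "\<And>p. aug (f3 p) = aug (f2 (p $ 0))"
    by (rule fps_evaluation[OF c f2(1-4) h(1) z(1)]) blast
  have cc: "f3 (ccst r) = ?i r" for r by (simp add: ccst_def f3 f2 f1)
  have f30: "f3 0 = 0" using f3(1)[of 0 0] by simp
  have f3m: "f3 (x - y) = f3 x - f3 y" for x y using f3(1)[of "x - y" y] by (simp add: algebra_simps)
  have com: "e1 * f3 p = f3 p * e1" "e2 * f3 p = f3 p * e2"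
    "e1 * (f3 p * y) = f3 p * (e1 * y)" "e2 * (f3 p * y) = f3 p * (e2 * y)" for y p
    using even_commute[OF f3(4)[of p]] by (metis mult.assoc)+
  define f where "f x = f3 (c0 x) + f3 (c1 x) * e1 + f3 (c2 x) * e2 + f3 (c12 x) * (e1 * e2)" for x
  have e: "e1 * e1 = 0" "e2 * e2 = 0" "e2 * e1 = - (e1 * e2)"
    using odd_square[OF h(4)] odd_square[OF h(5)] homogeneous_commute[OF h(5,4)] by simp_all
  have e3: "e1 * (e1 * x) = 0" "e2 * (e2 * x) = 0" "e2 * (e1 * x) = - (e1 * (e2 * x))" for x
    using e by (metis mult.assoc mult_zero_left mult_minus_left)+
  have hf: "homogeneous 1 (f3 p * e1)" "homogeneous 1 (f3 p * e2)" "homogeneous 0 (f3 p * (e1 * e2))" for p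
    using homogeneous_mult[OF f3(4)[of p] h(4)] homogeneous_mult[OF f3(4)[of p] h(5)]
      homogeneous_mult[OF f3(4)[of p] homogeneous_mult[OF h(4,5)]] by simp_all
  have "base_hom f"
    unfolding base_hom_def
  proof (intro conjI allI)
    fix x y :: sps and r p
    show "f (x + y) = f x + f y" by (simp add: f_def sps_defs f3 algebra_simps)
    show "f (x * y) = f x * f y"
      by (simp add: f_def sps_defs f3(1,2) f3m distrib_left distrib_right left_diff_distrib mult.assoc com e e3
          add_ac)
    show "f 1 = 1" by (simp add: f_def sps_defs f3 f30)
    show "f (r *\<^sub>C x) = r *\<^sub>C f x"
      by (simp add: f_def sps_defs f3 cc scaleC_mult_left scaleC_add_right)
    show "f (hcomp p x) = hcomp p (f x)"
      using hf[THEN homogeneous_other] f3(4)[THEN homogeneous_other]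
      by (cases p) (simp_all add: f_def sps_defs hcomp_add f30)
    show "aug (f x) = aug x"
      using aug_homogeneous_1[OF h(4)] aug_homogeneous_1[OF h(5)]
      by (simp add: f_def sps_defs aug_add aug_mult f3 f2 f1 aug_scaleC aug_one)
  qed
  moreover have "f T1 = s1" "f T2 = s2" "f T3 = s3" "f Th1 = e1" "f Th2 = e2"
    by (simp_all add: f_def T1_def T2_def T3_def Th1_def Th2_def f30 f3 f2 f1)
  ultimately show ?thesis by (rule that)
qed

lemma abs_rep_vbase: "abs_vbase (rep_vbase v) = v"
  by (rule Quotient_abs_rep[OF Quotient_vbase])

lemma abs_vbase_eq_iff: "abs_vbase x = abs_vbase y \<longleftrightarrow> x - y \<in> rel_ideal"
  using vbase.abs_eq_iff[of x y] by (simp add: rel_eq_def)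

lemma abs_vbase_surj: obtains x where "v = abs_vbase x"
  using abs_rep_vbase[of v] by metis

lemma abs_vbase_hom:
  "abs_vbase (x + y) = abs_vbase x + abs_vbase y" "abs_vbase (x * y) = abs_vbase x * abs_vbase y"
  "abs_vbase 1 = 1" "abs_vbase 0 = 0" "abs_vbase (x - y) = abs_vbase x - abs_vbase y"
  "abs_vbase (r *\<^sub>C x) = r *\<^sub>C abs_vbase x" "abs_vbase (hcomp p x) = hcomp p (abs_vbase x)"
  "aug (abs_vbase x) = aug x"
  by (simp_all only: plus_vbase.abs_eq times_vbase.abs_eq one_vbase_def zero_vbase_def minus_vbase.abs_eq
      scaleC_vbase.abs_eq hcomp_vbase.abs_eq aug_vbase.abs_eq)

lemma vbase_generators: "t1 = abs_vbase T1" "t2 = abs_vbase T2" "t3 = abs_vbase T3" "th1 = abs_vbase Th1"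
  "th2 = abs_vbase Th2"
  by (simp_all add: t1_def t2_def t3_def th1_def th2_def)

lemma base_hom_zero: "base_hom f \<Longrightarrow> f 0 = 0"
  unfolding base_hom_def by (metis add_cancel_left_right)

lemma base_hom_diff: "base_hom f \<Longrightarrow> f (x - y) = f x - f y"
  unfolding base_hom_def by (metis add_diff_cancel_right' diff_add_cancel)

lemma vbase_evaluation:
  fixes s1 s2 s3 e1 e2 :: "'b::augmented_algebra"
  assumes c: "complete_base TYPE('b)"
    and h: "homogeneous 0 s1" "homogeneous 0 s2" "homogeneous 0 s3" "homogeneous 1 e1" "homogeneous 1 e2"
    and z: "aug s1 = 0" "aug s2 = 0" "aug s3 = 0" "e1 * s1 = 0" "e2 * s2 = 0"
  obtains f :: "vbase \<Rightarrow> 'b" where "base_hom f" "f t1 = s1" "f t2 = s2" "f t3 = s3" "f th1 = e1"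
    "f th2 = e2"
proof -
  obtain g :: "sps \<Rightarrow> 'b" where g: "base_hom g" "g T1 = s1" "g T2 = s2" "g T3 = s3" "g Th1 = e1"
    "g Th2 = e2"
    by (rule sps_evaluation[OF c h z(1-3)])
  note gh = g(1)[unfolded base_hom_def] and g0 = base_hom_zero[OF g(1)] and gd = base_hom_diff[OF g(1)]
  have "is_ideal {x. g x = 0}" using gh g0 by (auto simp: is_ideal_def)
  moreover have "{T1 * Th1, T2 * Th2} \<subseteq> {x. g x = 0}"
    using gh even_commute[OF h(1)] even_commute[OF h(2)] z by (auto simp: g)
  ultimately have k: "rel_ideal \<subseteq> {x. g x = 0}" unfolding rel_ideal_def by (rule ideal_gen_minimal)
  define f where "f v = g (rep_vbase v)" for v
  have f: "f (abs_vbase x) = g x" for x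
  proof -
    have "rep_vbase (abs_vbase x) - x \<in> rel_ideal"
      using abs_rep_vbase abs_vbase_eq_iff by blast
    then show ?thesis using k gd by (auto simp: f_def)
  qed
  have "base_hom f"
    unfolding base_hom_def
  proof (intro conjI allI)
    fix a b :: vbase and r p
    obtain x y where "a = abs_vbase x" "b = abs_vbase y" using abs_vbase_surj by metis
    then show "f (a + b) = f a + f b" "f (a * b) = f a * f b" "f 1 = 1" "f (r *\<^sub>C a) = r *\<^sub>C f a"
      "f (hcomp p a) = hcomp p (f a)" "aug (f a) = aug a"
      using gh by (simp_all add: f abs_vbase_hom(8) flip: abs_vbase_hom(1-7))
  qed
  then show ?thesis by (rule that) (simp_all add: vbase_generators f g)
qed

subsection \<open>Completeness of the base\<close>

definition ordn :: "nat \<Rightarrow> complex fps fps fps \<Rightarrow> bool" where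
  "ordn n p \<longleftrightarrow> (\<forall>i j k. i + j + k < n \<longrightarrow> p $ i $ j $ k = 0)"

text \<open>Total degree at least n, where each \<theta> counts as 1. Subtraction of natural numbers
  makes the conditions on the \<theta>-parts void for small n.\<close>

definition sord :: "nat \<Rightarrow> sps set" where
  "sord n = {x. ordn n (c0 x) \<and> ordn (n - 1) (c1 x) \<and> ordn (n - 1) (c2 x) \<and> ordn (n - 2) (c12 x)}"

lemma ordn_mono: "ordn n p \<Longrightarrow> m \<le> n \<Longrightarrow> ordn m p"
  by (auto simp: ordn_def)

lemma ordn_add: "ordn n p \<Longrightarrow> ordn n q \<Longrightarrow> ordn n (p + q)"
  and ordn_diff: "ordn n p \<Longrightarrow> ordn n q \<Longrightarrow> ordn n (p - q)"
  and ordn_zero: "ordn n 0"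
  and ordn_0: "ordn 0 p"
  by (auto simp: ordn_def)

lemma ordn_mult:
  assumes "ordn m p" "ordn n q" "l \<le> m + n" shows "ordn l (p * q)"
  unfolding ordn_def
proof (intro allI impI)
  fix i j k assume l: "i + j + k < l"
  have "p $ a $ b $ d * q $ (i - a) $ (j - b) $ (k - d) = 0"
    if "a \<le> i" "b \<le> j" "d \<le> k" for a b d
  proof (cases "a + b + d < m")
    case False
    then have "(i - a) + (j - b) + (k - d) < n" using that l assms(3) by linarith
    then show ?thesis using assms(2) by (simp add: ordn_def)
  qed (use assms(1) in \<open>simp add: ordn_def\<close>)
  then show "(p * q) $ i $ j $ k = 0"
    unfolding fps_mult_nth fps_sum_nth by (intro sum.neutral ballI) auto
qed

lemma sord_add: "x \<in> sord n \<Longrightarrow> y \<in> sord n \<Longrightarrow> x + y \<in> sord n"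
  by (simp add: sord_def sps_defs ordn_add)

lemma sord_zero: "0 \<in> sord n"
  by (simp add: sord_def sps_defs ordn_zero)

lemma sord_mult: "x \<in> sord m \<Longrightarrow> y \<in> sord n \<Longrightarrow> x * y \<in> sord (m + n)"
  unfolding sord_def sps_defs mem_Collect_eq sps.sel
  by (intro conjI ordn_add ordn_diff; (elim conjE, rule ordn_mult, assumption, assumption, simp))

lemma sord_0: "x \<in> sord 0"
  by (simp add: sord_def ordn_0)

lemma sord_1: "x \<in> sord 1 \<longleftrightarrow> aug x = 0"
  by (simp add: sord_def ordn_def sps_defs)

lemma sord_mono: "m \<le> n \<Longrightarrow> x \<in> sord n \<Longrightarrow> x \<in> sord m"
  by (auto simp: sord_def intro: ordn_mono)

text \<open>The \<theta>-free part is divided by t^1, its remainder by t^2, and the next remainder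
  by t^3; nothing is left over since the constant term is 0. The \<theta>^1 \<theta>^2 part is
  assigned to \<theta>^1.\<close>

lemma sord_decompose:
  assumes x: "x \<in> sord (Suc n)"
  obtains a b d u v where "x = T1 * a + T2 * b + T3 * d + Th1 * u + Th2 * v"
    "a \<in> sord n" "b \<in> sord n" "d \<in> sord n" "u \<in> sord n" "v \<in> sord n"
proof -
  have o: "ordn (Suc n) (c0 x)" "ordn n (c1 x)" "ordn n (c2 x)" "ordn (n - 1) (c12 x)"
    using x by (auto simp: sord_def)
  let ?a = "SPS (fps_shift 1 (c0 x)) 0 0 0" and ?b = "SPS (fps_const (fps_shift 1 (c0 x $ 0))) 0 0 0"
    and ?d = "SPS (fps_const (fps_const (fps_shift 1 (c0 x $ 0 $ 0)))) 0 0 0"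
    and ?u = "SPS (c1 x) 0 (c12 x) 0" and ?v = "SPS (c2 x) 0 0 0"
  have split: "p = fps_X * fps_shift 1 p + fps_const (p $ 0)" for p :: "'z::comm_ring_1 fps"
    by (rule fps_ext) (simp add: fps_X_mult_nth)
  have "c0 x $ 0 $ 0 $ 0 = 0" using o(1) by (simp add: ordn_def)
  then have "c0 x $ 0 $ 0 = fps_X * fps_shift 1 (c0 x $ 0 $ 0)"
    using split[of "c0 x $ 0 $ 0"] by simp
  then have "c0 x = fps_X * fps_shift 1 (c0 x) + fps_const (fps_X * fps_shift 1 (c0 x $ 0)
      + fps_const (fps_X * fps_shift 1 (c0 x $ 0 $ 0)))"
    using split[of "c0 x"] split[of "c0 x $ 0"] by metis
  then have "x = T1 * ?a + T2 * ?b + T3 * ?d + Th1 * ?u + Th2 * ?v"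
    by (cases x) (simp add: T1_def T2_def T3_def Th1_def Th2_def sps_defs add.assoc)
  moreover have "?a \<in> sord n" "?u \<in> sord n" "?v \<in> sord n"
    using o by (auto simp: sord_def ordn_def)
  moreover have "?b \<in> sord n"
    using o(1) by (auto simp: sord_def ordn_def fps_const_def)
  moreover have "?d \<in> sord n"
    using o(1) by (auto simp: sord_def ordn_def fps_const_def)
  ultimately show ?thesis by (intro that)
qed

lemma generators_sord: "T1 \<in> sord 1" "T2 \<in> sord 1" "T3 \<in> sord 1" "Th1 \<in> sord 1"
  "Th2 \<in> sord 1"
  by (simp_all add: sord_1[unfolded One_nat_def] sps_defs T1_def T2_def T3_def Th1_def Th2_def)

text \<open>The variables generate the maximal ideal, so its powers are the images of the filtration
  by total degree. Completeness of the quotient thereby becomes a question about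
  coefficients.\<close>

lemma aug_power_vbase: "aug_power n = abs_vbase ` sord n"
proof (induction n)
  case 0
  have "v \<in> abs_vbase ` sord 0" for v by (metis abs_rep_vbase image_eqI sord_0)
  then show ?case by auto
next
  case (Suc n)
  show ?case
  proof
    have "is_ideal (abs_vbase ` sord (Suc n))"
      unfolding is_ideal_def
    proof (intro conjI ballI allI)
      show "0 \<in> abs_vbase ` sord (Suc n)"
        using sord_zero by (metis abs_vbase_hom(4) image_eqI)
      fix v assume "v \<in> abs_vbase ` sord (Suc n)"
      then obtain x where x: "v = abs_vbase x" "x \<in> sord (Suc n)" by blast
      fix w obtain y where y: "w = abs_vbase y" by (rule abs_vbase_surj)
      show "w * v \<in> abs_vbase ` sord (Suc n)" "v * w \<in> abs_vbase ` sord (Suc n)"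
        using sord_mult[OF sord_0 x(2), of y] sord_mult[OF x(2) sord_0, of y]
        by (auto simp: x y simp flip: abs_vbase_hom(2))
      assume "w \<in> abs_vbase ` sord (Suc n)"
      then show "v + w \<in> abs_vbase ` sord (Suc n)"
        using x sord_add by (auto simp flip: abs_vbase_hom(1))
    qed
    moreover have "{x * y |x y :: vbase. x \<in> aug_ideal \<and> y \<in> aug_power n} \<subseteq> abs_vbase ` sord (Suc n)"
    proof clarify
      fix v w :: vbase assume v: "v \<in> aug_ideal" and w: "w \<in> aug_power n"
      obtain x where x: "v = abs_vbase x" by (rule abs_vbase_surj)
      then have "x \<in> sord 1" using v unfolding sord_1 by (simp add: aug_ideal_iff abs_vbase_hom)
      moreover obtain y where "w = abs_vbase y" "y \<in> sord n" using w Suc by blast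
      ultimately show "v * w \<in> abs_vbase ` sord (Suc n)"
        using sord_mult[of x 1 y n] by (auto simp: x simp flip: abs_vbase_hom(2))
    qed
    ultimately show "aug_power (Suc n) \<subseteq> abs_vbase ` sord (Suc n)"
      unfolding aug_power.simps by (rule ideal_gen_minimal)
    show "abs_vbase ` sord (Suc n) \<subseteq> aug_power (Suc n)"
    proof clarify
      fix x assume "x \<in> sord (Suc n)"
      then obtain a b d u v where x: "x = T1 * a + T2 * b + T3 * d + Th1 * u + Th2 * v"
        "a \<in> sord n" "b \<in> sord n" "d \<in> sord n" "u \<in> sord n" "v \<in> sord n"
        by (rule sord_decompose)
      have "abs_vbase g * abs_vbase y \<in> aug_power (Suc n)" if "g \<in> sord 1" "y \<in> sord n" for g y
        using that Suc unfolding sord_1 by (intro aug_power_mult_left) (auto simp: aug_ideal_iff abs_vbase_hom)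
      then show "abs_vbase x \<in> aug_power (Suc n)"
        unfolding x(1) abs_vbase_hom by (intro aug_power_add) (use x generators_sord in auto)
    qed
  qed
qed

text \<open>The four conditions say that \<open>x\<close> has the form
  \<open>t^1 a \<theta>^1 + t^2 b \<theta>^2 + (t^1 e + t^2 f) \<theta>^1 \<theta>^2\<close>.\<close>

lemma rel_ideal_iff:
  "x \<in> rel_ideal \<longleftrightarrow> c0 x = 0 \<and> c1 x $ 0 = 0 \<and> (\<forall>i. c2 x $ i $ 0 = 0)
     \<and> c12 x $ 0 $ 0 = 0"
proof
  let ?Z = "{x. c0 x = 0 \<and> c1 x $ 0 = 0 \<and> (\<forall>i. c2 x $ i $ 0 = 0)
     \<and> c12 x $ 0 $ 0 = 0}"
  have "is_ideal ?Z"
    by (auto simp: is_ideal_def sps_defs fps_mult_nth fps_sum_nth)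
  moreover have "{T1 * Th1, T2 * Th2} \<subseteq> ?Z"
    by (auto simp: T1_def T2_def Th1_def Th2_def sps_defs fps_mult_nth)
  ultimately have "rel_ideal \<subseteq> ?Z" unfolding rel_ideal_def by (rule ideal_gen_minimal)
  then show "x \<in> rel_ideal \<Longrightarrow> c0 x = 0 \<and> c1 x $ 0 = 0 \<and> (\<forall>i. c2 x $ i $ 0 = 0)
     \<and> c12 x $ 0 $ 0 = 0" by blast
next
  assume z: "c0 x = 0 \<and> c1 x $ 0 = 0 \<and> (\<forall>i. c2 x $ i $ 0 = 0)
     \<and> c12 x $ 0 $ 0 = 0"
  define a where "a = fps_shift 1 (c1 x)"
  define b where "b = Abs_fps (\<lambda>i. fps_shift 1 (c2 x $ i))"
  define d where "d = fps_shift 1 (c12 x)"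
  define e where "e = fps_const (fps_shift 1 (c12 x $ 0))"
  have split: "p = fps_X * fps_shift 1 p + fps_const (p $ 0)" for p :: "'z::comm_ring_1 fps"
    by (rule fps_ext) (simp add: fps_X_mult_nth)
  have 1: "c1 x = fps_X * a" using split[of "c1 x"] z by (simp add: a_def)
  have 2: "c2 x = fps_const fps_X * b"
    using z split[of "c2 x $ _"] by (intro fps_ext) (simp add: b_def)
  have "c12 x $ 0 = fps_X * fps_shift 1 (c12 x $ 0)"
    using split[of "c12 x $ 0"] z by simp
  then have 12: "c12 x = fps_X * d + fps_const fps_X * e"
    using split[of "c12 x"] by (simp add: d_def e_def)
  have "x = (T1 * Th1) * SPS a 0 d 0 + (T2 * Th2) * SPS b (- e) 0 0"
    using z 1 2 12 by (cases x) (simp add: T1_def T2_def Th1_def Th2_def sps_defs)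
  moreover have "T1 * Th1 \<in> rel_ideal" "T2 * Th2 \<in> rel_ideal"
    unfolding rel_ideal_def by (auto intro: gen_in_ideal_gen)
  ultimately show "x \<in> rel_ideal" by (metis rel_ideal_add rel_ideal_right)
qed

text \<open>By \<open>rel_ideal_iff\<close>, membership in the ideal of relations is the vanishing
  of certain coefficients. Each of them agrees with that of a representative of arbitrarily high
  order, hence is 0: the ideal is closed.\<close>

lemma vbase_separated:
  assumes "\<And>n. v \<in> (aug_power n :: vbase set)" shows "v = 0"
proof -
  obtain x where x: "v = abs_vbase x" by (rule abs_vbase_surj)
  have "\<exists>y. y \<in> sord n \<and> x - y \<in> rel_ideal" for n
    using assms[of n] unfolding aug_power_vbase x using abs_vbase_eq_iff by auto
  then obtain y where y: "\<And>n. y n \<in> sord n" "\<And>n. x - y n \<in> rel_ideal" by metis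
  note r = y(2)[unfolded rel_ideal_iff]
  have o: "ordn n (c0 (y n))" "ordn (n - 1) (c1 (y n))" "ordn (n - 1) (c2 (y n))"
    "ordn (n - 2) (c12 (y n))" for n
    using y(1)[of n] by (auto simp: sord_def)
  have "x \<in> rel_ideal"
    unfolding rel_ideal_iff
  proof (intro conjI allI fps_ext)
    fix i j k
    show "c0 x $ i $ j $ k = 0 $ i $ j $ k"
      using r[of "i + j + k + 1"] o(1)[of "i + j + k + 1"] by (simp add: sps_defs ordn_def)
    show "c1 x $ 0 $ j $ k = 0 $ j $ k"
      using r[of "j + k + 2"] o(2)[of "j + k + 2"] by (simp add: sps_defs ordn_def)
    show "c2 x $ i $ 0 $ k = 0 $ k"
      using r[of "i + k + 2"] o(3)[of "i + k + 2"] by (simp add: sps_defs ordn_def)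
    show "c12 x $ 0 $ 0 $ k = 0 $ k"
      using r[of "k + 3"] o(4)[of "k + 3"] by (simp add: sps_defs ordn_def)
  qed
  then show ?thesis using abs_vbase_eq_iff[of x 0] by (simp add: x abs_vbase_hom)
qed

lemma sps_limit:
  fixes X :: "nat \<Rightarrow> sps"
  assumes X: "\<And>n. X (Suc n) - X n \<in> sord n"
  shows "\<exists>Y. \<forall>n. Y - X n \<in> sord n"
proof -
  have d: "X (m + k) - X m \<in> sord m" for m k
  proof (induction k)
    case (Suc k)
    have "X (m + k) - X m + (X (Suc (m + k)) - X (m + k)) \<in> sord m"
      using Suc sord_mono[OF _ X[of "m + k"], of m] by (intro sord_add) simp_all
    then show ?case by simp
  qed (simp add: sord_zero)
  \<comment> \<open>The coefficient at i, j, k of the \<theta>-free part is stable from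
    \<open>X (i + j + k + 1)\<close> on. The shifts 2, 2 and 3 account for the degrees of
    \<theta>^1, \<theta>^2 and \<theta>^1 \<theta>^2.\<close>
  define Y where "Y = SPS
    (Abs_fps (\<lambda>i. Abs_fps (\<lambda>j. Abs_fps (\<lambda>k. c0 (X (i + j + k + 1)) $ i $ j $ k))))
    (Abs_fps (\<lambda>i. Abs_fps (\<lambda>j. Abs_fps (\<lambda>k. c1 (X (i + j + k + 2)) $ i $ j $ k))))
    (Abs_fps (\<lambda>i. Abs_fps (\<lambda>j. Abs_fps (\<lambda>k. c2 (X (i + j + k + 2)) $ i $ j $ k))))
    (Abs_fps (\<lambda>i. Abs_fps (\<lambda>j. Abs_fps (\<lambda>k. c12 (X (i + j + k + 3)) $ i $ j $ k))))"
  have e: "c0 (X n) $ i $ j $ k = c0 (X m) $ i $ j $ k"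
      "i + j + k + 1 < m \<Longrightarrow> c1 (X n) $ i $ j $ k = c1 (X m) $ i $ j $ k"
      "i + j + k + 1 < m \<Longrightarrow> c2 (X n) $ i $ j $ k = c2 (X m) $ i $ j $ k"
      "i + j + k + 2 < m \<Longrightarrow> c12 (X n) $ i $ j $ k = c12 (X m) $ i $ j $ k"
    if "i + j + k < m" "m \<le> n" for m n i j k
    using d[of m "n - m"] that by (auto simp: sord_def ordn_def sps_defs)
  have "Y - X n \<in> sord n" for n
    unfolding sord_def ordn_def mem_Collect_eq
  proof (intro conjI allI impI)
    fix i j k
    show "c0 (Y - X n) $ i $ j $ k = 0" if "i + j + k < n"
      using e(1)[of i j k "i + j + k + 1" n] that by (simp add: Y_def sps_defs)
    show "c1 (Y - X n) $ i $ j $ k = 0" if "i + j + k < n - 1"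
      using e(2)[of i j k "i + j + k + 2" n] that by (simp add: Y_def sps_defs)
    show "c2 (Y - X n) $ i $ j $ k = 0" if "i + j + k < n - 1"
      using e(3)[of i j k "i + j + k + 2" n] that by (simp add: Y_def sps_defs)
    show "c12 (Y - X n) $ i $ j $ k = 0" if "i + j + k < n - 2"
      using e(4)[of i j k "i + j + k + 3" n] that by (simp add: Y_def sps_defs)
  qed
  then show ?thesis by blast
qed

text \<open>Successive differences lift to series of growing order, so a limit can be taken upstairs
  and projected; uniqueness is \<open>vbase_separated\<close>.\<close>

lemma complete_vbase: "complete_base TYPE(vbase)"
  unfolding complete_base_def
proof (intro allI impI)
  fix x :: "nat \<Rightarrow> vbase" assume x: "\<forall>n. x (Suc n) - x n \<in> aug_power n"
  then have "\<exists>z. x (Suc n) - x n = abs_vbase z \<and> z \<in> sord n" for n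
    unfolding aug_power_vbase by blast
  then obtain z where z: "\<And>n. x (Suc n) - x n = abs_vbase (z n)" "\<And>n. z n \<in> sord n" by metis
  obtain x0 where x0: "x 0 = abs_vbase x0" by (rule abs_vbase_surj)
  define X where "X n = x0 + (\<Sum>k<n. z k)" for n
  have aX: "abs_vbase (X n) = x n" for n
  proof (induction n)
    case (Suc n)
    have "abs_vbase (X (Suc n)) = abs_vbase (X n) + abs_vbase (z n)"
      by (simp add: X_def add.assoc flip: abs_vbase_hom(1))
    then show ?case using Suc z(1)[of n] by (simp add: algebra_simps)
  qed (simp add: X_def x0)
  have "X (Suc n) - X n \<in> sord n" for n by (simp add: X_def z)
  then obtain Y where Y: "\<And>n. Y - X n \<in> sord n" using sps_limit[of X] by blast
  have y: "abs_vbase Y - x n \<in> aug_power n" for n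
    unfolding aug_power_vbase aX[symmetric] abs_vbase_hom(5)[symmetric] using Y by blast
  show "\<exists>!y. \<forall>n. y - x n \<in> aug_power n"
  proof (rule ex1I)
    show "\<forall>n. abs_vbase Y - x n \<in> aug_power n" using y by blast
    fix y' assume y': "\<forall>n. y' - x n \<in> aug_power n"
    have "y' - abs_vbase Y \<in> aug_power n" for n
      using aug_power_diff[OF y'[rule_format, of n] y[of n]] by simp
    then have "y' - abs_vbase Y = 0" by (rule vbase_separated)
    then show "y' = abs_vbase Y" by simp
  qed
qed

lemma base_hom_power:
  fixes f :: "'a::augmented_algebra \<Rightarrow> 'b::augmented_algebra"
  assumes f: "base_hom f" shows "x \<in> aug_power n \<Longrightarrow> f x \<in> aug_power n"
proof (induction n arbitrary: x)
  case (Suc n)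
  note fh = f[unfolded base_hom_def]
  have "is_ideal {x. f x \<in> aug_power (Suc n)}"
    using fh base_hom_zero[OF f] graded_ideal_aug_power[of "Suc n", where 'a = 'b]
    by (auto simp: is_ideal_def graded_ideal_def)
  moreover have "{x * y |x y. x \<in> aug_ideal \<and> y \<in> aug_power n} \<subseteq> {x. f x \<in> aug_power (Suc n)}"
    using fh Suc.IH by (auto simp: aug_ideal_iff intro!: aug_power_mult_left)
  ultimately have "aug_power (Suc n) \<subseteq> {x. f x \<in> aug_power (Suc n)}"
    unfolding aug_power.simps by (rule ideal_gen_minimal)
  then show ?case using Suc.prems by blast
qed simp

text \<open>Modulo the square of the maximal ideal every element is a linear combination of 1 and
  the five generators, and both homomorphisms send that square to 0.\<close>

lemma base_hom_eqI:
  fixes f g :: "vbase \<Rightarrow> 'b::augmented_algebra"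
  assumes inf: "aug_power 2 = {0 :: 'b}" and f: "base_hom f" and g: "base_hom g"
    and e: "f t1 = g t1" "f t2 = g t2" "f t3 = g t3" "f th1 = g th1" "f th2 = g th2"
  shows "f = g"
proof
  fix v
  obtain x where x: "v = abs_vbase x" by (rule abs_vbase_surj)
  let ?k = "\<lambda>p i j k. p $ i $ j $ k"
  define l where "l = ?k (c0 x) 0 0 0 *\<^sub>C 1 + ?k (c0 x) 1 0 0 *\<^sub>C T1 + ?k (c0 x) 0 1 0 *\<^sub>C T2
    + ?k (c0 x) 0 0 1 *\<^sub>C T3 + ?k (c1 x) 0 0 0 *\<^sub>C Th1 + ?k (c2 x) 0 0 0 *\<^sub>C Th2"
  have c: "c0 l = ccst (?k (c0 x) 0 0 0) + ccst (?k (c0 x) 1 0 0) * fps_X + ccst (?k (c0 x) 0 1 0) * fps_const fps_X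
      + ccst (?k (c0 x) 0 0 1) * fps_const (fps_const fps_X)"
    "c1 l = ccst (?k (c1 x) 0 0 0)" "c2 l = ccst (?k (c2 x) 0 0 0)"
    by (simp_all add: l_def sps_defs T1_def T2_def T3_def Th1_def Th2_def)
  have "?k (c0 l) i j k = ?k (c0 x) i j k" if "i + j + k < 2" for i j k
  proof -
    consider "i = 0" "j = 0" "k = 0" | "i = 1" "j = 0" "k = 0" | "i = 0" "j = 1" "k = 0" | "i = 0" "j = 0"
      "k = 1"
      using \<open>i + j + k < 2\<close> by linarith
    then show ?thesis by cases (simp_all add: c ccst_def)
  qed
  then have "x - l \<in> sord 2"
    by (auto simp: sord_def ordn_def sps_defs c ccst_def)
  then have "abs_vbase (x - l) \<in> aug_power 2" unfolding aug_power_vbase by blast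
  then have "f (abs_vbase (x - l)) = 0" "g (abs_vbase (x - l)) = 0"
    using base_hom_power[OF f] base_hom_power[OF g] inf by blast+
  moreover have "f (abs_vbase l) = g (abs_vbase l)"
    using f g e unfolding l_def abs_vbase_hom vbase_generators[symmetric] by (simp add: base_hom_def)
  ultimately show "f v = g v"
    by (simp add: x abs_vbase_hom base_hom_diff[OF f] base_hom_diff[OF g])
qed

section \<open>Uniqueness over infinitesimal bases\<close>

text \<open>Converse to the construction of an equivalence from a gauge: a coalgebra automorphism is
  recovered from its values on the three coordinates, so every equivalence with a member of the
  family is a gauge of defect 0.\<close>

lemma equivalent_gauge:
  fixes D :: "'a::augmented_algebra smap"
  assumes D: "deformation (universal c 0 0 0 0 0) D"
    and h: "homogeneous 0 a1" "homogeneous 0 a2" "homogeneous 0 a3" "homogeneous 1 e1" "homogeneous 1 e2"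
    and z: "aug a1 = 0" "aug a2 = 0" "aug a3 = 0"
    and e: "equivalent (universal c a1 a2 a3 e1 e2) D"
  obtains \<sigma> where "admissible \<sigma>" "pa \<sigma> = a1" "pb \<sigma> = a2" "pc \<sigma> = a3"
    "qa \<sigma> = e1" "qb \<sigma> = e2"
    "\<And>M. M \<in> mis \<Longrightarrow> coderivation_rows.defect c (row D) \<sigma> M = 0"
proof -
  interpret coderivation_rows c "row D" by (rule deformation_rows[OF D])
  obtain g where g: "coalgebra_aut g" "\<And>I M. aug (g I M) = id_smap I M"
    "smap_comp g (universal c a1 a2 a3 e1 e2) = smap_comp D g"
    using e by (auto simp: equivalent_def)
  have eg: "g \<in> endos" "has_parity 0 g" "comul_after g = before_comul (tensor 0 g g)"
    using g(1) by (auto simp: coalgebra_aut_def)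
  note mg = morphism_family_row[OF eg]
  have tg: "triangular (row g)" using mg by (simp add: morphism_family_def)
  have max: "row g M - mon M \<in> ser_max" if M: "M \<in> mis" for M
    unfolding ser_ideal_iff[OF graded_ideal_aug]
  proof
    fix I assume I: "I \<in> mi0"
    have "aug (cf I (mon M) :: 'a) = id_smap I M"
      using M by (auto simp: cf_mon id_smap_def aug_one mis_mi0)
    then show "cf I (row g M - mon M) \<in> aug_ideal"
      using I by (auto simp: aug_ideal_iff cf_diff aug_diff cf_row aug_scaleC g(2) id_smap_def)
  qed
  define \<sigma> where "\<sigma> = \<lparr>ga = row g (1,0,0), gb = row g (0,1,0), gc = row g (0,0,1),
    pa = a1, pb = a2, pc = a3, qa = e1, qb = e2\<rparr>"
  have hg: "homogeneous (wpar M) (row g M)" if "M \<in> mis" for M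
    using mg that by (auto simp: morphism_family_def)
  have adm: "admissible \<sigma>"
    using hg[OF unit_mis(1)] hg[OF unit_mis(2)] hg[OF unit_mis(3)] h z
      max[OF unit_mis(1)] max[OF unit_mis(2)] max[OF unit_mis(3)]
    by (simp add: admissible_def \<sigma>_def cf_0_row[OF eg(1)] wpar.simps)
  have m: "mrow \<sigma> M = row g M" if "M \<in> mis" for M
    using morphism_family_eq_gam[OF mg that] by (simp add: mrow_def \<sigma>_def)
  have u: "row (universal c a1 a2 a3 e1 e2) M = urow c \<sigma> M" if "M \<in> mis" for M
    using row_universal[OF that h(1-3)] by (simp add: urow_def \<sigma>_def)
  have tu: "triangular (row (universal c a1 a2 a3 e1 e2))"
    using urow_facts(1)[OF adm] by (simp add: triangular_def u)
  have eu: "universal c a1 a2 a3 e1 e2 \<in> endos"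
    unfolding universal_eq_smap_of[OF h(1-3)]
    using urow_facts(1)[OF adm] by (intro smap_of_endos) (simp add: urow_def \<sigma>_def)
  have eD: "D \<in> endos"
    using D by (auto simp: deformation_def linf_structure_def coderivation_def)
  have "defect \<sigma> M = 0" if M: "M \<in> mis" for M
  proof -
    have "pullback (urow c \<sigma>) (mrow \<sigma> M) = row (smap_comp g (universal c a1 a2 a3 e1 e2)) M"
      unfolding row_comp[OF eg(1) eu tu] m[OF M] by (rule pullback_cong) (simp add: u)
    also have "\<dots> = pullback (mrow \<sigma>) (row D M)"
      unfolding g(3) row_comp[OF eD eg(1) tg] by (rule pullback_cong) (simp add: m)
    finally show ?thesis by (simp add: defect_def)
  qed
  moreover have "pa \<sigma> = a1" "pb \<sigma> = a2" "pc \<sigma> = a3" "qa \<sigma> = e1" "qb \<sigma> = e2"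
    by (simp_all add: \<sigma>_def)
  ultimately show ?thesis using adm by (intro that[of \<sigma>])
qed

text \<open>All admissible gauges agree modulo the maximal ideal. As its square is 0, the first
  order variation formula is exact here. At the exponents of the parameters the coordinate changes
  contribute nothing, because their constant terms vanish or the weight is 0; the exception is a
  rescaling of \<xi>.\<close>

lemma gauge_parameters_unique:
  fixes D :: "'a::augmented_algebra smap"
  assumes D: "deformation (universal c 0 0 0 0 0) D" and inf: "aug_power 2 = {0 :: 'a}" and c: "c \<noteq> 0"
    and \<sigma>: "admissible \<sigma>" "\<And>M. M \<in> mis \<Longrightarrow> coderivation_rows.defect c (row D) \<sigma> M = 0"
    and \<tau>: "admissible \<tau>" "\<And>M. M \<in> mis \<Longrightarrow> coderivation_rows.defect c (row D) \<tau> M = 0"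
  shows "pa \<tau> = pa \<sigma>" "pb \<tau> = pb \<sigma>" "pc \<tau> = pc \<sigma>"
    "qa \<tau> = qa \<sigma>" "qb \<tau> = qb \<sigma>"
proof -
  interpret coderivation_rows c "row D" by (rule deformation_rows[OF D])
  have sub: "F - H \<in> ser_max" if "F - K \<in> ser_max" "H - K \<in> ser_max" for F H K :: "'a ser"
    using ideal_diff[OF graded_ideal_ser_max that] by simp
  have "gauge_close 1 \<tau> \<sigma>"
    using \<sigma>(1) \<tau>(1) unfolding gauge_close_def admissible_def One_nat_def aug_power_1
    by (auto intro: sub simp: aug_ideal_iff aug_diff aug_homogeneous_1)
  note V = variation_coefficients[OF \<sigma>(1) \<tau>(1) this, unfolded \<sigma>(2)[OF unit_mis(1)] \<sigma>(2)[OF unit_mis(2)]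
    \<sigma>(2)[OF unit_mis(3)] \<tau>(2)[OF unit_mis(1)] \<tau>(2)[OF unit_mis(2)] \<tau>(2)[OF unit_mis(3)]]
  have p2: "aug_power (Suc 1) = {0 :: 'a}" using inf by (simp only: Suc_1)
  have z: "cf (0,0,0) (ga \<tau> - ga \<sigma>) = 0" "cf (0,0,0) (gb \<tau> - gb \<sigma>) = 0"
    "cf (0,0,0) (gc \<tau> - gc \<sigma>) = 0"
    using \<sigma>(1) \<tau>(1) by (simp_all add: admissible_def cf_diff zero_mi)
  have Y: "cf (1, 0, b) (F * mon (0,1,0)) = 0" "cf (1, 1, b) (F * mon (0,1,0)) = cf (1, 0, b) F"
    "cf (1, a, 0) (F * mon (0,0,1)) = 0" "cf (1, a, 1) (F * mon (0,0,1)) = cf (1, a, 0) F"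
    "cf (0, 1, b) (F * mon (0,1,0)) = cf (0, 0, b) F" "cf (0, a, 1) (F * mon (0,0,1)) = cf (0, a, 0) F"
    for F :: "'a ser" and a b
    unfolding One_nat_def by (rule cf_mult_yz[unfolded One_nat_def]; simp)+
  note simps = p2 z Y cf_zero
  show "pa \<tau> = pa \<sigma>" using V(4)[of 0 0] unfolding simps by simp
  show "qa \<tau> = qa \<sigma>" using V(3)[of 1 0] unfolding simps by simp
  show "pb \<tau> = pb \<sigma>" using V(6)[of 0 0] unfolding simps by simp
  show "qb \<tau> = qb \<sigma>" using V(5)[of 0 1] unfolding simps by simp
  \<comment> \<open>The family has no parameter at \<xi> y in the image of y. This normalization
    forbids rescaling \<xi> and thereby fixes the parameter at \<xi> z.\<close>
  have "cf (1,0,0) (ga \<tau> - ga \<sigma>) = 0" using V(4)[of 1 0] unfolding simps by simp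
  then show "pc \<tau> = pc \<sigma>" using V(6)[of 0 1] unfolding simps by simp
qed

section \<open>Miniversality\<close>

text \<open>If a + c b = 0 with b > 0, then c = - a / b is a nonpositive rational. The other two
  equations reduce to this one by lowering a, respectively b, by one. The remaining cases are a = 0,
  where 1 / c = b, and b = 0, where c = a.\<close>

lemma generic_weights:
  fixes c :: complex
  assumes "\<not> (\<exists>q::rat. q \<le> 0 \<and> c = of_rat q)"
    and "\<not> (\<exists>n::nat. n \<ge> 1 \<and> c = of_nat n)"
    and "\<not> (\<exists>n::nat. n \<ge> 1 \<and> 1 / c = of_nat n)"
  shows "c \<noteq> 0"
    and "\<And>a b. of_nat a + c * of_nat b = 0 \<Longrightarrow> a = 0 \<and> b = 0"
    and "\<And>a b. of_nat a + c * of_nat b = 1 \<Longrightarrow> a = 1 \<and> b = 0"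
    and "\<And>a b. of_nat a + c * of_nat b = c \<Longrightarrow> a = 0 \<and> b = 1"
proof -
  have q: "c \<noteq> - of_nat a / of_nat b" for a b :: nat
  proof
    assume "c = - of_nat a / of_nat b"
    then have "c = of_rat (- (of_nat a / of_nat b))"
      by (simp add: of_rat_minus of_rat_divide)
    moreover have "- (of_nat a / of_nat b) \<le> (0 :: rat)" by simp
    ultimately show False using assms(1) by blast
  qed
  show c0: "c \<noteq> 0" using q[of 0 1] by simp
  have k: "b = 0" if "of_nat a + c * of_nat b = 0" for a b :: nat
  proof (rule ccontr)
    assume "b \<noteq> 0"
    then have "c = - of_nat a / of_nat b" using that by (simp add: field_simps eq_neg_iff_add_eq_0)
    then show False using q by blast
  qed
  then show "a = 0 \<and> b = 0" if "of_nat a + c * of_nat b = 0" for a b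
    using that k[OF that] by simp
  show "a = 1 \<and> b = 0" if e: "of_nat a + c * of_nat b = 1" for a b
  proof (cases a)
    case 0
    then have "1 / c = of_nat b" using e c0 by (auto simp: field_simps)
    moreover have "b \<noteq> 0" using 0 e by (cases b) auto
    ultimately have "1 / c = of_nat b" "b \<noteq> 0" by blast+
    then show ?thesis using assms(3) by (metis Suc_leI One_nat_def gr0I)
  next
    case (Suc a')
    then have "of_nat a' + c * of_nat b = 0" using e by simp
    then show ?thesis using k[of a' b] Suc by simp
  qed
  show "a = 0 \<and> b = 1" if e: "of_nat a + c * of_nat b = c" for a b
  proof (cases b)
    case 0
    then have "c = of_nat a" using e by simp
    moreover from this have "a \<ge> 1" using c0 by (cases a) auto
    ultimately show ?thesis using assms(2) by blast
  next
    case (Suc b')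
    then have "of_nat a + c * of_nat b' = 0" using e by (simp add: algebra_simps)
    then show ?thesis using k[of a b'] Suc by simp
  qed
qed

lemma vbase_parities:
  "homogeneous 0 t1" "homogeneous 0 t2" "homogeneous 0 t3" "homogeneous 1 th1" "homogeneous 1 th2"
  "aug t1 = 0" "aug t2 = 0" "aug t3 = 0" "th1 * t1 = 0" "th2 * t2 = 0"
proof -
  show "homogeneous 0 t1" "homogeneous 0 t2" "homogeneous 0 t3" "homogeneous 1 th1" "homogeneous 1 th2"
    "aug t1 = 0" "aug t2 = 0" "aug t3 = 0"
    unfolding homogeneous_def vbase_generators abs_vbase_hom(7)[symmetric] abs_vbase_hom(8)
    by (simp_all add: T1_def T2_def T3_def Th1_def Th2_def sps_defs)
  have "T1 * Th1 \<in> rel_ideal" "T2 * Th2 \<in> rel_ideal"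
    unfolding rel_ideal_def by (auto intro: gen_in_ideal_gen)
  moreover have "Th1 * T1 = T1 * Th1" "Th2 * T2 = T2 * Th2"
    by (simp_all add: T1_def T2_def Th1_def Th2_def sps_defs)
  ultimately show "th1 * t1 = 0" "th2 * t2 = 0"
    unfolding vbase_generators abs_vbase_hom(2,4)[symmetric] abs_vbase_eq_iff by simp_all
qed

lemma push_universal:
  assumes "base_hom f"
  shows "push f (universal c a1 a2 a3 e1 e2) = universal c (f a1) (f a2) (f a3) (f e1) (f e2)"
  using assms unfolding push_def base_hom_def by (intro ext universal_push) auto

theorem mainTheorem9:
  fixes c :: complex
  assumes "cmod c \<le> 1"
    and "\<not> (\<exists>q::rat. q \<le> 0 \<and> c = of_rat q)"
    and "\<not> (\<exists>n::nat. n \<ge> 1 \<and> c = of_nat n)"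
    and "\<not> (\<exists>n::nat. n \<ge> 1 \<and> 1 / c = of_nat n)"
  shows "miniversal TYPE('b::augmented_algebra)
    (phi (1,1,0) 2 1 + phi (1,0,1) 3 c)
    (phi (1,1,0) 2 1 + phi (1,0,1) 3 (c *\<^sub>C 1) + phi (1,0,0) 2 t1 + phi (1,0,0) 3 t2
      + phi (0,1,0) 2 th1 + phi (0,0,1) 3 th2 + phi (1,0,1) 3 t3 :: vbase smap)"
proof -
  note gen = generic_weights[OF assms(2-4)]
  let ?d = "universal c 0 0 0 0 0 :: complex smap" and ?U = "universal c t1 t2 t3 th1 th2"
  have homs: "homogeneous p (f x)" if "base_hom f" "homogeneous p x" for f :: "vbase \<Rightarrow> 'b" and p x
  proof -
    have "f (hcomp p x) = hcomp p (f x)" using that(1) by (simp add: base_hom_def)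
    then show ?thesis using that(2) by (simp add: homogeneous_def)
  qed
  have augs: "aug (f x) = aug x" if "base_hom f" for f :: "vbase \<Rightarrow> 'b" and x
    using that by (simp add: base_hom_def)
  have versal: "versal TYPE('b) ?d ?U"
    unfolding versal_def
  proof (intro conjI impI allI)
    show "formal_base TYPE(vbase)" using complete_vbase by (simp only: formal_base_iff_complete)
    show "deformation ?d ?U" by (rule deformation_universal[OF vbase_parities])
    fix D :: "'b smap" assume "formal_base TYPE('b)" and D: "deformation ?d D"
    then have cb: "complete_base TYPE('b)" by (simp only: formal_base_iff_complete)
    obtain a1 a2 a3 e1 e2 :: 'b where a: "homogeneous 0 a1" "homogeneous 0 a2" "homogeneous 0 a3"
      "homogeneous 1 e1" "homogeneous 1 e2" "aug a1 = 0" "aug a2 = 0" "aug a3 = 0" "e1 * a1 = 0" "e2 * a2 = 0"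
      "equivalent (universal c a1 a2 a3 e1 e2) D"
      by (rule equivalent_universal[OF cb D gen(2-4)])
    obtain f :: "vbase \<Rightarrow> 'b" where f: "base_hom f" "f t1 = a1" "f t2 = a2" "f t3 = a3"
      "f th1 = e1" "f th2 = e2"
      by (rule vbase_evaluation[OF cb a(1-10)])
    show "\<exists>f. base_hom f \<and> equivalent (push f ?U) D"
      using a(11) f by (intro exI[of _ f]) (simp add: push_universal)
  qed
  have unique: "f = f'"
    if inf: "infinitesimal_base TYPE('b)" and D: "deformation ?d D"
      and f: "base_hom f" "equivalent (push f ?U) D" and f': "base_hom f'" "equivalent (push f' ?U) D"
    for D :: "'b smap" and f f'
  proof -
    have p2: "aug_power 2 = {0 :: 'b}" using inf by (simp add: infinitesimal_base_def)
    have g: "\<exists>\<sigma>. admissible \<sigma> \<and> (\<forall>M\<in>mis. coderivation_rows.defect c (row D) \<sigma> M = 0)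
      \<and> pa \<sigma> = h t1 \<and> pb \<sigma> = h t2 \<and> pc \<sigma> = h t3 \<and> qa \<sigma> = h th1 \<and> qb \<sigma> = h th2"
      if h: "base_hom h" "equivalent (push h ?U) D" for h
    proof -
      note P = vbase_parities
      have A: "aug (h t1) = 0" "aug (h t2) = 0" "aug (h t3) = 0"
        by (simp_all add: augs[OF h(1)] P)
      show ?thesis
        using equivalent_gauge[OF D homs[OF h(1) P(1)] homs[OF h(1) P(2)] homs[OF h(1) P(3)]
            homs[OF h(1) P(4)] homs[OF h(1) P(5)] A h(2)[unfolded push_universal[OF h(1)]]] by metis
    qed
    obtain \<sigma> where \<sigma>: "admissible \<sigma>"
      "\<And>M. M \<in> mis \<Longrightarrow> coderivation_rows.defect c (row D) \<sigma> M = 0"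
      "pa \<sigma> = f t1" "pb \<sigma> = f t2" "pc \<sigma> = f t3" "qa \<sigma> = f th1"
      "qb \<sigma> = f th2"
      using g[OF f] by blast
    obtain \<tau> where \<tau>: "admissible \<tau>"
      "\<And>M. M \<in> mis \<Longrightarrow> coderivation_rows.defect c (row D) \<tau> M = 0"
      "pa \<tau> = f' t1" "pb \<tau> = f' t2" "pc \<tau> = f' t3" "qa \<tau> = f' th1" "qb \<tau> = f' th2"
      using g[OF f'] by blast
    note eq = gauge_parameters_unique[OF D p2 gen(1) \<tau>(1,2) \<sigma>(1,2)]
    show "f = f'"
      by (rule base_hom_eqI[OF p2 f(1) f'(1)]) (use eq \<sigma> \<tau> in simp_all)
  qed
  have "miniversal TYPE('b) ?d ?U"
    unfolding miniversal_def using versal unique by blast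
  then show ?thesis unfolding universal_0_complex unfolding universal_def .
qed

end
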